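(* Let $0<\vartheta\le1$ be such that the following holds: for every $\epsilon>0$ and every $\mathcal{A}>0$, $$\sum_{1\le q\le x^{\vartheta-\epsilon}}\max_{a:\,(a,q)=1}|E(x;q,a)|\ll\frac{x}{\log^{\mathcal{A}}x}$$ for all sufficiently large $x$. Let $k\ge2$, let $\mathbf{j}=(j_1,\dots,j_r)$ with $r\ge2$ be a vector of distinct integers and $\mathbf{a}=(a_1,\dots,a_r)$ integers with $a_i\ge1$, $a_r=1$, $\sum_{i=1}^ra_i=k$. Assume $\max_i|j_i|\ll R^{1/k}$ and $N^{\epsilon}\ll R\ll N^{\min(\frac{\vartheta}{k-1},\frac1k)-\epsilon}$. Then $$\tilde{\mathcal{S}}_k(N,\mathbf{j},\mathbf{a})=\mathcal{S}_k(N,\mathbf{j},\mathbf{a})+O(R^k)+O\!\left(\frac{N}{(\log N)^{\frac{\mathcal{A}}2-4^{k-3/2}+2^{k-1}-1}}\right).$$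
   Context: $\Lambda$ is the von Mangoldt function. For $R\ge1$, $\Lambda_R(n)=\sum_{d\mid n,\,d\le R}\mu(d)\log(R/d)$ for $n\ge1$ and $\Lambda_R(n)=0$ for $n\le0$. Define $$\mathcal{S}_k(N,\mathbf{j},\mathbf{a})=\sum_{n=1}^N\prod_{i=1}^r\Lambda_R(n+j_i)^{a_i},\qquad \tilde{\mathcal{S}}_k(N,\mathbf{j},\mathbf{a})=\sum_{n=1}^N\Big(\prod_{i=1}^{r-1}\Lambda_R(n+j_i)^{a_i}\Big)\Lambda(n+j_r).$$ $\psi(x;q,a)=\sum_{n\le x,\ n\equiv a\ (\mathrm{mod}\ q)}\Lambda(n)$, $E_{a,q}=1$ if $(a,q)=1$ and $0$ otherwise, and $E(x;q,a)=\psi(x;q,a)-E_{a,q}\frac{x}{\phi(q)}$. The hypothesis holds unconditionally for $\vartheta=\frac12$ (Bombieri–Vinogradov). $\epsilon>0$ denotes a small fixed number and $N\to\infty$. *)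

theory Defs
  imports
    Complex_Main
    "HOL-Number_Theory.Number_Theory"
    "HOL-Computational_Algebra.Squarefree"
    "HOL-Library.Landau_Symbols"
begin

definition moebius_mu :: "nat \<Rightarrow> real" where
  "moebius_mu n = (if squarefree n then (- 1) ^ card (prime_factors n) else 0)"

text \<open>
  Since \<open>nat m = 0\<close> for \<open>m \<le> 0\<close> and \<open>mangoldt 0 = 0\<close>, this extends \<open>mangoldt\<close> by zero to the
  non-positive integers.
\<close>

definition mangoldt_int :: "int \<Rightarrow> real" where
  "mangoldt_int m = mangoldt (nat m)"

definition Lambda_R :: "real \<Rightarrow> int \<Rightarrow> real" where
  "Lambda_R R m =
     (if m \<ge> 1 then \<Sum>d | d dvd nat m \<and> real d \<le> R. moebius_mu d * ln (R / real d) else 0)"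

text \<open>
  The vectors \<open>j\<close> and \<open>a\<close> are functions of which only the values at the indices \<open>1, \<dots>, r\<close> matter.
  The order of the correlation is \<open>k = a 1 + \<dots> + a r\<close>.
\<close>

definition corr :: "real \<Rightarrow> nat \<Rightarrow> nat \<Rightarrow> (nat \<Rightarrow> int) \<Rightarrow> (nat \<Rightarrow> nat) \<Rightarrow> real" where
  "corr R N r j a = (\<Sum>n=1..N. \<Prod>i=1..r. Lambda_R R (int n + j i) ^ a i)"

definition mixed_corr :: "real \<Rightarrow> nat \<Rightarrow> nat \<Rightarrow> (nat \<Rightarrow> int) \<Rightarrow> (nat \<Rightarrow> nat) \<Rightarrow> real" where
  "mixed_corr R N r j a =
     (\<Sum>n=1..N. (\<Prod>i=1..r-1. Lambda_R R (int n + j i) ^ a i) * mangoldt_int (int n + j r))"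

definition psi_ap :: "real \<Rightarrow> nat \<Rightarrow> nat \<Rightarrow> real" where
  "psi_ap x q a = (\<Sum>n | 1 \<le> n \<and> real n \<le> x \<and> [n = a] (mod q). mangoldt n)"

definition E_ap :: "real \<Rightarrow> nat \<Rightarrow> nat \<Rightarrow> real" where
  "E_ap x q a = psi_ap x q a - (if coprime a q then 1 else 0) * (x / real (totient q))"

text \<open>
  The maximum over all residues coprime to \<open>q\<close> is taken over the representatives
  \<open>totatives q\<close>, i.e. \<open>1 \<le> a \<le> q\<close>, which suffice because \<open>E_ap x q a\<close> only depends on \<open>a\<close> modulo
  \<open>q\<close>. The Landau symbol refers to \<open>x \<rightarrow> \<infinity>\<close>; its constant may depend on \<open>\<epsilon>\<close> and \<open>A\<close>.
\<close>

definition primes_level_of_distribution :: "real \<Rightarrow> bool" where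
  "primes_level_of_distribution \<theta> \<longleftrightarrow>
     (\<forall>\<epsilon>>0. \<forall>A>0.
        (\<lambda>x::real. \<Sum>q | 1 \<le> q \<and> real q \<le> x powr (\<theta> - \<epsilon>).
            Max ((\<lambda>a. \<bar>E_ap x q a\<bar>) ` totatives q))
        \<in> O(\<lambda>x. x / ln x powr A))"

end

theory Submission
  imports Defs "HOL-Real_Asymp.Real_Asymp"
begin

text \<open>
  Expand the factors \<open>\<Lambda>\<^sub>R\<close> with \<open>i < r\<close> of both correlations over tuples of divisors. For a fixed tuple
  with least common multiple \<open>D\<close>, the variable \<open>n\<close> runs through at most one residue class modulo \<open>D\<close>, and it
  remains to compare the sums of \<open>\<Lambda>\<close> and of \<open>\<Lambda>\<^sub>R\<close> over that class, shifted to \<open>c\<close>. The first one is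
  \<open>N / \<phi>(D)\<close> or negligible according as \<open>(c, D) = 1\<close> or not, up to the error that the level of distribution
  controls on average. The second one is \<open>N / D\<close> times
  \<open>\<Sum>\<^sub>d\<^sub>\<le>\<^sub>R \<mu>(d) f(d) ln (R/d) / d\<close>, where \<open>f\<close> is multiplicative and \<open>f(p)\<close> is \<open>1\<close>, \<open>p\<close> or \<open>0\<close> according as
  \<open>p\<close> does not divide \<open>D\<close>, divides \<open>(c, D)\<close>, or divides \<open>D\<close> only. By the prime number theorem, which is the
  modulus \<open>q = 1\<close> of the hypothesis, this sum is \<open>D / \<phi>(D)\<close> if \<open>(c, D) = 1\<close> and \<open>0\<close> otherwise, up to an
  arbitrary power of the logarithm. As the hypothesis holds for every power of the logarithm, no care is needed
  with the divisor functions that arise from counting tuples.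
\<close>

section \<open>The Moebius function\<close>

text \<open>The delicate classes are those with gcd (c, D) > 1. There the values f(p) = p shorten
  the range R of the sieve sum by the product of the common primes. Each of these divides a
  difference of two shifts, so the product is at most (2 n0)^(k-1), of order R^((k-1)/k) by the
  bound on the shifts; a range of order R^(1/k) survives.

  The error of the sieve sum must be uniform in D, but every prime q of D brings in y / q in place
  of y, arbitrarily far down. Powers of ln y do not survive this. The error is therefore carried as
  \<open>\<eta> + sqrt (Y / y)\<close> with a free threshold Y, which grows at most by sqrt q.

  The passage from primes to sums of mu is elementary: a bootstrap for the sum of mu(d) / d gains
  half a power of the logarithm per step.

  Up to constants, R^(k-1) stays below N^(\<theta> - (k-1) \<epsilon>) and R^k below N^(1 - k
  \<epsilon>). The first admits all moduli D; the second makes R^k times any power of the logarithm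
  negligible against N / (ln N)^B.\<close>

lemma moebius_mu_1 [simp]: "moebius_mu (Suc 0) = 1"
  by (simp add: moebius_mu_def)

lemma abs_moebius_mu_le: "\<bar>moebius_mu n\<bar> \<le> 1"
  by (simp add: moebius_mu_def power_abs)

lemma moebius_mu_mult_coprime:
  assumes "coprime a b"
  shows "moebius_mu (a * b) = moebius_mu a * moebius_mu b"
proof (cases "squarefree a \<and> squarefree b")
  case True
  hence nz: "a \<noteq> 0" "b \<noteq> 0" by (auto intro: Nat.gr0I)
  have "prime_factors a \<inter> prime_factors b = {}"
    using assms nz by (auto simp: in_prime_factors_iff dest: coprime_common_divisor)
  hence "card (prime_factors (a * b)) = card (prime_factors a) + card (prime_factors b)"
    using nz by (simp add: prime_factors_product card_Un_disjoint)
  moreover have "squarefree (a * b)"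
    using True assms squarefree_mult_coprime by blast
  ultimately show ?thesis
    using True by (simp add: moebius_mu_def power_add)
next
  case False
  hence "\<not> squarefree (a * b)"
    using squarefree_multD by blast
  with False show ?thesis
    by (auto simp: moebius_mu_def)
qed

lemma moebius_mu_prime: "prime p \<Longrightarrow> moebius_mu p = - 1"
  by (simp add: moebius_mu_def squarefree_prime prime_factorization_prime)

lemma moebius_mu_prime_mult:
  assumes "prime p" "\<not> p dvd n"
  shows "moebius_mu (p * n) = - moebius_mu n"
  using assms by (simp add: moebius_mu_mult_coprime prime_imp_coprime moebius_mu_prime)

lemma moebius_mu_not_squarefree: "\<not> squarefree n \<Longrightarrow> moebius_mu n = 0"
  by (simp add: moebius_mu_def)

text \<open>For a fixed prime p dividing n > 1, the squarefree divisors pair off as d and p * d with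
  opposite signs.\<close>

lemma sum_moebius_mu_divisors:
  assumes "n > 0"
  shows "(\<Sum>d | d dvd n. moebius_mu d) = (if n = 1 then 1 else 0)"
proof (cases "n = 1")
  case False
  then obtain p where p: "prime p" "p dvd n"
    using prime_factor_nat by blast
  define A where "A = {d. d dvd n \<and> squarefree d \<and> \<not> p dvd d}"
  have fin: "finite {d. d dvd n}" using assms by simp
  have finA: "finite A" by (rule finite_subset[OF _ fin]) (auto simp: A_def)
  have split: "{d. d dvd n \<and> squarefree d} = A \<union> (*) p ` A"
  proof (intro equalityI subsetI)
    fix d assume "d \<in> {d. d dvd n \<and> squarefree d}"
    hence d: "d dvd n" "squarefree d" by auto
    show "d \<in> A \<union> (*) p ` A"
    proof (cases "p dvd d")
      case True
      then obtain e where e: "d = p * e" by (auto simp: dvd_def)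
      have "squarefree e" using d e squarefree_multD by blast
      moreover have "\<not> p dvd e"
      proof
        assume "p dvd e"
        hence "p\<^sup>2 dvd d" using e by (auto simp: power2_eq_square)
        hence "is_unit p" using d by (auto simp: squarefree_def)
        thus False using p by auto
      qed
      moreover have "e dvd n" using d e dvd_mult_right by blast
      ultimately show ?thesis using e by (auto simp: A_def)
    qed (use d in \<open>auto simp: A_def\<close>)
  next
    fix d assume "d \<in> A \<union> (*) p ` A"
    thus "d \<in> {d. d dvd n \<and> squarefree d}"
    proof
      assume "d \<in> (*) p ` A"
      then obtain e where e: "d = p * e" "e \<in> A" by auto
      hence "coprime p e" using p by (auto simp: A_def prime_imp_coprime)
      thus ?thesis
        using e p by (auto simp: A_def divides_mult squarefree_mult_coprime squarefree_prime)
    qed (auto simp: A_def)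
  qed
  have "(\<Sum>d | d dvd n. moebius_mu d) = (\<Sum>d | d dvd n \<and> squarefree d. moebius_mu d)"
    by (rule sum.mono_neutral_right) (use fin in \<open>auto simp: moebius_mu_def\<close>)
  also have "\<dots> = (\<Sum>d\<in>A. moebius_mu d) + (\<Sum>d\<in>(*) p ` A. moebius_mu d)"
    unfolding split by (rule sum.union_disjoint) (use finA in \<open>auto simp: A_def\<close>)
  also have "(\<Sum>d\<in>(*) p ` A. moebius_mu d) = (\<Sum>d\<in>A. moebius_mu (p * d))"
    by (subst sum.reindex) (use p in \<open>auto simp: inj_on_def prime_gt_0_nat\<close>)
  also have "\<dots> = (\<Sum>d\<in>A. - moebius_mu d)"
    by (rule sum.cong) (use p in \<open>auto simp: A_def moebius_mu_prime_mult\<close>)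
  finally show ?thesis using False by (simp add: sum_negf)
qed (use assms in auto)

text \<open>Both sides run over the pairs (a, b) with a * b <= x; the right side groups them by k =
  a * b.\<close>

lemma sum_hyperbola:
  fixes \<phi> :: "nat \<Rightarrow> nat \<Rightarrow> real"
  shows "(\<Sum>a=1..x. \<Sum>b=1..x div a. \<phi> a b) = (\<Sum>k=1..x. \<Sum>a | a dvd k. \<phi> a (k div a))"
proof -
  have "(\<Sum>a=1..x. \<Sum>b=1..x div a. \<phi> a b) = (\<Sum>(a,b)\<in>(SIGMA a:{1..x}. {1..x div a}). \<phi> a b)"
    by (subst sum.Sigma) auto
  also have "\<dots> = (\<Sum>(k,a)\<in>(SIGMA k:{1..x}. {a. a dvd k}). \<phi> a (k div a))"
  proof (rule sum.reindex_bij_witness[where i = "\<lambda>(k,a). (a, k div a)" and j = "\<lambda>(a,b). (a * b, a)"], goal_cases)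
    case (2 p)
    then obtain a b where p: "p = (a, b)" "1 \<le> a" "a \<le> x" "1 \<le> b" "b \<le> x div a" by auto
    hence "a * b \<le> x" by (metis mult.commute div_times_less_eq_dividend le_trans mult_le_mono1)
    with p show ?case by auto
  next
    case (4 p)
    then obtain k a where p: "p = (k, a)" "1 \<le> k" "k \<le> x" "a dvd k" by auto
    hence "a > 0" "a \<le> k" by (auto intro: Nat.gr0I dvd_imp_le)
    with p show ?case by (auto intro: div_le_mono simp: div_greater_zero_iff Suc_le_eq)
  qed (auto simp: Suc_le_eq intro: Nat.gr0I)
  also have "\<dots> = (\<Sum>k=1..x. \<Sum>a | a dvd k. \<phi> a (k div a))"
    by (subst sum.Sigma) auto
  finally show ?thesis .
qed

lemma moebius_inversion:
  fixes f g :: "nat \<Rightarrow> real"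
  assumes g: "\<And>n. n > 0 \<Longrightarrow> (\<Sum>d | d dvd n. f d) = g n" and n: "n > 0"
  shows "f n = (\<Sum>d | d dvd n. moebius_mu d * g (n div d))"
proof -
  have pos: "d > 0" "n div d > 0" if "d dvd n" for d
    using that n by (auto intro: Nat.gr0I simp: dvd_div_eq_0_iff)
  have swap: "b dvd n \<and> a dvd n div b" if "a dvd n" "b dvd n div a" for a b
  proof -
    from that obtain c where c: "n div a = b * c" by (auto simp: dvd_def)
    hence "n = b * (a * c)" using that by (metis dvd_mult_div_cancel mult.left_commute)
    moreover have "b > 0" using \<open>n = b * (a * c)\<close> n by (auto intro: Nat.gr0I)
    ultimately show ?thesis by simp
  qed
  have "(\<Sum>d | d dvd n. moebius_mu d * g (n div d)) =
        (\<Sum>d | d dvd n. \<Sum>e | e dvd n div d. moebius_mu d * f e)"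
    by (intro sum.cong refl) (simp add: g[symmetric] pos sum_distrib_left)
  also have "\<dots> = (\<Sum>(d,e)\<in>(SIGMA d:{d. d dvd n}. {e. e dvd n div d}). moebius_mu d * f e)"
    by (rule sum.Sigma) (use n pos in auto)
  also have "\<dots> = (\<Sum>(e,d)\<in>(SIGMA e:{e. e dvd n}. {d. d dvd n div e}). moebius_mu d * f e)"
    by (rule sum.reindex_bij_witness[where i = "\<lambda>(a,b). (b,a)" and j = "\<lambda>(a,b). (b,a)"])
       (use swap in auto)
  also have "\<dots> = (\<Sum>e | e dvd n. \<Sum>d | d dvd n div e. moebius_mu d * f e)"
    by (rule sum.Sigma[symmetric]) (use n pos in auto)
  also have "\<dots> = (\<Sum>e | e dvd n. if e = n then f e else 0)"
  proof (intro sum.cong refl)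
    fix e assume "e \<in> {e. e dvd n}"
    hence e: "e dvd n" by simp
    have "(\<Sum>d | d dvd n div e. moebius_mu d * f e) = (if n div e = 1 then 1 else 0) * f e"
      by (subst sum_moebius_mu_divisors[symmetric]) (use e pos in \<open>auto simp: sum_distrib_right\<close>)
    also have "n div e = 1 \<longleftrightarrow> e = n"
      using e n pos[OF e] by (metis dvd_div_mult_self mult_1 div_self neq0_conv)
    finally show "(\<Sum>d | d dvd n div e. moebius_mu d * f e) = (if e = n then f e else 0)" by simp
  qed
  also have "\<dots> = f n" using n by (subst sum.delta) auto
  finally show ?thesis by simp
qed

text \<open>Inversion of \<open>mangoldt_sum\<close> gives Lambda(n) as the divisor sum of mu(d) ln
  (n/d). The part ln n drops out: the divisor sum of mu is 0 unless n = 1, where ln n = 0.\<close>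

lemma sum_moebius_ln_divisors:
  assumes "n > 0"
  shows "(\<Sum>d | d dvd n. moebius_mu d * ln (real d)) = - mangoldt n"
proof -
  have "mangoldt n = (\<Sum>d | d dvd n. moebius_mu d * ln (real (n div d)))"
    by (rule moebius_inversion) (use assms in \<open>auto simp: mangoldt_sum\<close>)
  also have "\<dots> = (\<Sum>d | d dvd n. ln (real n) * moebius_mu d - moebius_mu d * ln (real d))"
  proof (intro sum.cong refl)
    fix d assume "d \<in> {d. d dvd n}"
    hence "d dvd n" "d > 0" using assms by (auto intro: Nat.gr0I)
    thus "moebius_mu d * ln (real (n div d)) = ln (real n) * moebius_mu d - moebius_mu d * ln (real d)"
      using assms by (simp add: real_of_nat_div ln_div algebra_simps)
  qed
  also have "\<dots> = ln (real n) * (if n = 1 then 1 else 0) - (\<Sum>d | d dvd n. moebius_mu d * ln (real d))"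
    by (simp add: sum_subtractf sum_distrib_left[symmetric] sum_moebius_mu_divisors[OF assms])
  finally show ?thesis by (auto split: if_splits)
qed

text \<open>By the preceding lemma, mu ln has divisor sums -Lambda; invert once more.\<close>

lemma moebius_mangoldt_convolution:
  assumes "n > 0"
  shows "(\<Sum>d | d dvd n. moebius_mu d * mangoldt (n div d)) = - (moebius_mu n * ln (real n))"
proof -
  have "moebius_mu n * ln (real n) = (\<Sum>d | d dvd n. moebius_mu d * (- mangoldt (n div d)))"
    by (rule moebius_inversion) (use assms in \<open>auto simp: sum_moebius_ln_divisors\<close>)
  thus ?thesis by (simp add: sum_negf)
qed

text \<open>Adding up the divisor sums of mu gives 1 as the sum of mu(a) floor (x/a). Dropping the
  floor costs nothing for a = 1 and at most 1 for every other a, so x times the sum is within x - 1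
  of 1.\<close>

lemma abs_sum_moebius_mu_over_le_1: "\<bar>\<Sum>d=1..x. moebius_mu d / real d\<bar> \<le> 1"
proof (cases "x = 0")
  case False
  have "(\<Sum>a=1..x. moebius_mu a * real (x div a)) = (\<Sum>a=1..x. \<Sum>b=1..x div a. moebius_mu a)"
    by (simp add: mult.commute)
  also have "\<dots> = (\<Sum>k=1..x. \<Sum>a | a dvd k. moebius_mu a)"
    by (rule sum_hyperbola)
  also have "\<dots> = (\<Sum>k=1..x. if k = 1 then 1 else 0)"
    by (intro sum.cong refl) (simp add: sum_moebius_mu_divisors)
  also have "\<dots> = 1" using False by (subst sum.delta) auto
  finally have 1: "(\<Sum>a=1..x. moebius_mu a * real (x div a)) = 1" .
  have fr: "\<bar>moebius_mu a * (real x / real a - real (x div a))\<bar> \<le> (if a = 1 then 0 else 1)" for a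
  proof -
    have "0 \<le> real x / real a - real (x div a)" "real x / real a - real (x div a) \<le> 1"
      using floor_correct[of "real x / real a"]
      by (simp_all add: floor_divide_of_nat_eq)
    hence "\<bar>moebius_mu a * (real x / real a - real (x div a))\<bar> \<le> 1 * 1"
      unfolding abs_mult by (intro mult_mono abs_moebius_mu_le) auto
    thus ?thesis by auto
  qed
  have "real x * (\<Sum>d=1..x. moebius_mu d / real d) - 1
        = (\<Sum>a=1..x. moebius_mu a * (real x / real a - real (x div a)))"
    by (subst 1[symmetric]) (simp add: sum_distrib_left sum_subtractf algebra_simps)
  hence "\<bar>real x * (\<Sum>d=1..x. moebius_mu d / real d) - 1\<bar> \<le> (\<Sum>a=1..x. if a = 1 then 0 else 1)"
    using fr by (auto intro!: order_trans[OF sum_abs] sum_mono)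
  also have "(\<Sum>a=1..x. if a = 1 then 0 else 1 :: real) = (\<Sum>a\<in>{1..x}-{1}. 1)"
    by (rule sum.mono_neutral_cong_right) auto
  also have "\<dots> = real x - 1" using False by (simp add: of_nat_diff)
  finally have "\<bar>real x * (\<Sum>d=1..x. moebius_mu d / real d)\<bar> \<le> real x" by linarith
  thus ?thesis using False by (simp add: abs_mult)
qed auto

section \<open>The prime number theorem and the function \<open>\<Sum>\<^sub>d\<^sub>\<le>\<^sub>y \<mu>(d) ln (y/d) / d\<close>\<close>

text \<open>The summand 1 keeps \<open>lg\<close> at least 1 on x >= 1, so that bounds by negative
  powers can be stated for all n >= 1 instead of eventually.\<close>

definition lg :: "real \<Rightarrow> real" where "lg x = 1 + ln x"

lemma lg_ge_1: "x \<ge> 1 \<Longrightarrow> lg x \<ge> 1"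
  by (simp add: lg_def)

lemma lg_mono: "0 < x \<Longrightarrow> x \<le> y \<Longrightarrow> lg x \<le> lg y"
  by (simp add: lg_def)

section \<open>Sequences whose increments save powers of the logarithm\<close>

lemma bounded_of_eventually_bounded:
  fixes f g :: "nat \<Rightarrow> real"
  assumes "eventually (\<lambda>n. \<bar>f n\<bar> \<le> C * g n) sequentially" and g: "\<And>n. n \<ge> 1 \<Longrightarrow> g n > 0"
  shows "\<exists>C'\<ge>0. \<forall>n\<ge>1. \<bar>f n\<bar> \<le> C' * g n"
proof -
  from assms(1) obtain n0 where n0: "\<And>n. n \<ge> n0 \<Longrightarrow> \<bar>f n\<bar> \<le> C * g n"
    by (auto simp: eventually_sequentially)
  define C' where "C' = \<bar>C\<bar> + (\<Sum>n=1..n0. \<bar>f n\<bar> / g n)"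
  have nn: "(\<Sum>n=1..n0. \<bar>f n\<bar> / g n) \<ge> 0"
    by (intro sum_nonneg divide_nonneg_nonneg) (use g in \<open>auto intro: less_imp_le\<close>)
  have "\<bar>f n\<bar> \<le> C' * g n" if n: "n \<ge> 1" for n
  proof (cases "n \<ge> n0")
    case True
    have "\<bar>f n\<bar> \<le> C * g n" by (rule n0[OF True])
    also have "\<dots> \<le> C' * g n"
      by (rule mult_right_mono) (use nn g[OF n] in \<open>auto simp: C'_def\<close>)
    finally show ?thesis .
  next
    case False
    have "\<bar>f n\<bar> / g n \<le> (\<Sum>n=1..n0. \<bar>f n\<bar> / g n)"
      by (rule member_le_sum) (use g False n in \<open>auto intro!: divide_nonneg_pos\<close>)
    also have "\<dots> \<le> C'" by (simp add: C'_def)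
    finally show ?thesis using g[OF n] by (simp add: field_simps)
  qed
  moreover have "C' \<ge> 0" using nn by (simp add: C'_def)
  ultimately show ?thesis by blast
qed

lemma ln_Suc_div_ge_inverse:
  assumes "n \<ge> 1"
  shows "ln (real (Suc n) / real n) \<ge> 1 / real (Suc n)"
proof -
  have "ln (real n / real (Suc n)) \<le> real n / real (Suc n) - 1"
    by (rule ln_le_minus_one) (use assms in auto)
  moreover have "ln (real n / real (Suc n)) = - ln (real (Suc n) / real n)"
    using assms by (simp add: ln_div)
  moreover have "real n / real (Suc n) - 1 = - 1 / real (Suc n)"
    by (simp add: field_simps)
  ultimately show ?thesis by linarith
qed

lemma ln_Suc_div_ge:
  assumes "n \<ge> 1"
  shows "ln (real (Suc n) / real n) \<ge> 1 / (2 * real n)"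
proof -
  have "1 / (2 * real n) \<le> 1 / real (Suc n)"
    using assms by (intro divide_left_mono) auto
  with ln_Suc_div_ge_inverse[OF assms] show ?thesis by linarith
qed

lemma ln_Suc_div_le:
  assumes "n \<ge> 1"
  shows "ln (real (Suc n) / real n) \<le> 1 / real n"
proof -
  have "ln (real (Suc n) / real n) \<le> real (Suc n) / real n - 1"
    by (rule ln_le_minus_one) (use assms in auto)
  also have "\<dots> = 1 / real n" using assms by (simp add: field_simps)
  finally show ?thesis .
qed

lemma lg_Suc_le: "n \<ge> 1 \<Longrightarrow> lg (real (Suc n)) \<le> 2 * lg (real n)"
proof -
  assume n: "n \<ge> 1"
  have "ln (real (Suc n)) = ln (real (Suc n) / real n) + ln (real n)"
    using n by (simp add: ln_div)
  also have "ln (real (Suc n) / real n) \<le> 1"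
    using ln_Suc_div_le[OF n] n by (auto intro: order_trans)
  finally have "ln (real (Suc n)) \<le> 1 + ln (real n)" by simp
  moreover have "ln (real n) \<ge> 0" using n by simp
  moreover have "1 + x \<le> 2 * (1 + y)" if "x \<le> 1 + y" "0 \<le> y" for x y :: real
    using that by auto
  ultimately show ?thesis unfolding lg_def by blast
qed

text \<open>A discrete form of comparing 1 / (x lg(x)^(s+1)) with the derivative of lg^(-s); it
  makes series with these terms telescope. The 4 combines ln (1 + 1/n) >= 1/(2n) with lg (n+1) <= 2
  lg n.\<close>

lemma inverse_lg_power_diff:
  assumes s: "s \<ge> 1" and n: "n \<ge> 1"
  shows "1 / (4 * real n * lg (real n) ^ Suc s) \<le> 1 / lg (real n) ^ s - 1 / lg (real (Suc n)) ^ s"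
proof -
  define a b where "a = lg (real n)" and "b = lg (real (Suc n))"
  have a: "a \<ge> 1" "b \<le> 2 * a" "a \<le> b"
    using lg_Suc_le[OF n] n by (auto simp: a_def b_def intro: lg_ge_1 lg_mono)
  have ba: "b - a \<ge> 1 / (2 * real n)"
    using ln_Suc_div_ge[OF n] n by (simp add: a_def b_def lg_def ln_div)
  have "1 / (4 * real n * a ^ Suc s) = (1 / (2 * real n)) / (2 * a * a ^ s)" by (simp add: field_simps)
  also have "\<dots> \<le> (b - a) / (2 * a * a ^ s)"
    using a by (intro divide_right_mono ba) auto
  also have "\<dots> \<le> (b - a) / (b * a ^ s)"
    using a by (intro divide_left_mono mult_right_mono mult_pos_pos) auto
  also have "\<dots> = 1 / a ^ s - 1 / (b * a ^ (s - 1))"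
    using a s by (cases s) (auto simp: field_simps)
  also have "\<dots> \<le> 1 / a ^ s - 1 / b ^ s"
  proof -
    have "b * a ^ (s - 1) \<le> b * b ^ (s - 1)"
      using a by (intro mult_left_mono power_mono) auto
    also have "\<dots> = b ^ s" using s by (cases s) auto
    finally show ?thesis using a by (intro diff_left_mono divide_left_mono) auto
  qed
  finally show ?thesis by (simp add: a_def b_def)
qed

lemma inverse_lg_power_tendsto_0:
  assumes "s \<ge> 1"
  shows "(\<lambda>n. 1 / lg (real n) ^ s) \<longlonglongrightarrow> 0"
proof -
  have "filterlim (\<lambda>n. lg (real n)) at_top sequentially"
    unfolding lg_def by real_asymp
  hence "((\<lambda>n. inverse (lg (real n)) ^ s) \<longlongrightarrow> 0 ^ s) sequentially"
    by (intro tendsto_power tendsto_inverse_0_at_top)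
  thus ?thesis using assms by (simp add: field_simps power_0_left)
qed

text \<open>
  Adding and subtracting \<open>4 C / lg n ^ s\<close> makes \<open>f\<close> decreasing and increasing, respectively.
\<close>

lemma converges_of_small_differences:
  fixes f :: "nat \<Rightarrow> real"
  assumes s: "s \<ge> 1" and C: "C \<ge> 0"
    and diff: "\<And>n. n \<ge> 1 \<Longrightarrow> \<bar>f (Suc n) - f n\<bar> \<le> C / (real n * lg (real n) ^ Suc s)"
  shows "\<exists>c. \<forall>n\<ge>1. \<bar>f n - c\<bar> \<le> 4 * C / lg (real n) ^ s"
proof -
  define h where "h = (\<lambda>n. 4 * C / lg (real (Suc n)) ^ s)"
  have h0: "h \<longlonglongrightarrow> 0"
    using tendsto_mult_left[OF LIMSEQ_Suc[OF inverse_lg_power_tendsto_0[OF s]], of "4 * C"]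
    by (simp add: h_def)
  have hd: "\<bar>f (Suc (Suc n)) - f (Suc n)\<bar> \<le> h n - h (Suc n)" for n
  proof -
    have "\<bar>f (Suc (Suc n)) - f (Suc n)\<bar> \<le> C / (real (Suc n) * lg (real (Suc n)) ^ Suc s)"
      by (rule diff) auto
    also have "\<dots> = 4 * C * (1 / (4 * real (Suc n) * lg (real (Suc n)) ^ Suc s))"
      by (simp only: times_divide_eq_right mult_1_right mult.assoc) (rule mult_divide_mult_cancel_left[symmetric], simp)
    also have "\<dots> \<le> 4 * C * (1 / lg (real (Suc n)) ^ s - 1 / lg (real (Suc (Suc n))) ^ s)"
      by (rule mult_left_mono[OF inverse_lg_power_diff[OF s]]) (use C in auto)
    finally show ?thesis by (simp add: h_def algebra_simps)
  qed
  define up where "up = (\<lambda>n. f (Suc n) + h n)"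
  define lo where "lo = (\<lambda>n. f (Suc n) - h n)"
  have dec: "decseq up" unfolding decseq_Suc_iff up_def using abs_le_D1[OF hd] by (simp add: algebra_simps)
  have inc: "incseq lo" unfolding incseq_Suc_iff lo_def using abs_le_D2[OF hd] by (simp add: algebra_simps)
  have "h n \<ge> 0" for n using C by (auto simp: h_def intro!: divide_nonneg_nonneg zero_le_power order_trans[OF _ lg_ge_1])
  hence "lo n \<le> up n" for n by (simp add: lo_def up_def add_increasing2)
  hence "up n \<ge> lo 0" for n using inc by (meson incseqD order_trans zero_le)
  then obtain c where c: "up \<longlonglongrightarrow> c" "\<And>n. c \<le> up n"
    using decseq_convergent[OF dec, of "lo 0"] by auto
  have "(\<lambda>n. up n - 2 * h n) \<longlonglongrightarrow> c - 2 * 0"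
    by (intro tendsto_intros c h0)
  hence "lo \<longlonglongrightarrow> c" by (simp add: up_def lo_def)
  hence lo: "lo n \<le> c" for n using inc by (rule incseq_le[rotated])
  have "\<bar>f n - c\<bar> \<le> 4 * C / lg (real n) ^ s" if "n \<ge> 1" for n
  proof -
    obtain m where m: "n = Suc m" using \<open>n \<ge> 1\<close> by (cases n) auto
    show ?thesis using lo[of m] c(2)[of m] by (simp add: m up_def lo_def h_def)
  qed
  thus ?thesis by blast
qed

section \<open>From the level of distribution to the sum of Lambda(i) / i\<close>

lemma psi_ap_1: "psi_ap (real n) 1 1 = (\<Sum>i=1..n. mangoldt i)"
proof -
  have "{i. 1 \<le> i \<and> real i \<le> real n \<and> [i = 1] (mod 1)} = {1..n}" by (auto simp: cong_def)
  thus ?thesis by (simp add: psi_ap_def)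
qed

text \<open>For q = 1 the maximum is over the single residue 1 and equals |psi(x) - x|. All terms of
  the sum over q are nonnegative, so this one is bounded by the whole sum.\<close>

lemma prime_number_theorem_of_level:
  assumes "primes_level_of_distribution \<theta>" "\<theta> > 0"
  shows "\<exists>C\<ge>0. \<forall>n\<ge>1. \<bar>(\<Sum>i=1..n. mangoldt i) - real n\<bar> \<le> C * (real n / lg (real n) ^ s)"
proof -
  let ?T = "\<lambda>x. \<Sum>q | 1 \<le> q \<and> real q \<le> x powr (\<theta> - \<theta> / 2). Max ((\<lambda>a. \<bar>E_ap x q a\<bar>) ` totatives q)"
  \<comment> \<open>The exponent \<open>real s + 1\<close> is positive also for s = 0, as the
    hypothesis demands; the surplus factor ln n >= 1 is dropped below. Taking \<theta> / 2 for the
    small loss keeps the exponent of the range positive, so that q = 1 lies in it.\<close>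
  have "?T \<in> O(\<lambda>x. x / ln x powr (real s + 1))"
    using assms(1)[unfolded primes_level_of_distribution_def, rule_format, of "\<theta> / 2" "real s + 1"] assms(2)
    by simp
  then obtain c where c: "c > 0" "eventually (\<lambda>x. norm (?T x) \<le> c * norm (x / ln x powr (real s + 1))) at_top"
    by (rule landau_o.bigE)
  have ev: "eventually (\<lambda>n. norm (?T (real n)) \<le> c * norm (real n / ln (real n) powr (real s + 1))) sequentially"
    using c(2) by (rule eventually_compose_filterlim[OF _ filterlim_real_sequentially])
  have "eventually (\<lambda>n. n \<ge> (3::nat)) sequentially" by (rule eventually_ge_at_top)
  with ev have ev': "eventually (\<lambda>n. \<bar>(\<Sum>i=1..n. mangoldt i) - real n\<bar> \<le> (c * 2 ^ s) * (real n / lg (real n) ^ s)) sequentially"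
  proof eventually_elim
    case (elim n)
    have "exp 1 \<le> (3::real)" by (rule exp_le)
    hence ln: "ln (real n) \<ge> 1" using elim by (subst ln_ge_iff) auto
    have fin: "finite {q. 1 \<le> q \<and> real q \<le> real n powr (\<theta> - \<theta> / 2)}"
      by (rule finite_subset[of _ "{..nat \<lfloor>real n powr (\<theta> - \<theta> / 2)\<rfloor>}"]) (auto simp: le_nat_floor)
    have "\<bar>(\<Sum>i=1..n. mangoldt i) - real n\<bar> = Max ((\<lambda>a. \<bar>E_ap (real n) 1 a\<bar>) ` totatives 1)"
      by (simp add: E_ap_def psi_ap_1[simplified])
    also have "\<dots> \<le> ?T (real n)"
    proof (rule member_le_sum)
      show "1 \<in> {q. 1 \<le> q \<and> real q \<le> real n powr (\<theta> - \<theta> / 2)}"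
        using elim assms by (auto intro!: ge_one_powr_ge_zero)
      fix q assume "q \<in> {q. 1 \<le> q \<and> real q \<le> real n powr (\<theta> - \<theta> / 2)} - {1}"
      hence "1 \<in> totatives q" by (auto simp: totatives_def)
      hence "\<bar>E_ap (real n) q 1\<bar> \<le> Max ((\<lambda>a. \<bar>E_ap (real n) q a\<bar>) ` totatives q)"
        by (intro Max_ge) auto
      thus "0 \<le> Max ((\<lambda>a. \<bar>E_ap (real n) q a\<bar>) ` totatives q)" by linarith
    qed (rule fin)
    also have "\<dots> \<le> c * (real n / ln (real n) powr (real s + 1))"
      using elim ln by simp
    also have "ln (real n) powr (real s + 1) = ln (real n) ^ (s + 1)"
      using ln by (subst powr_realpow[symmetric]) (auto simp: add.commute)
    also have "c * (real n / ln (real n) ^ (s + 1)) \<le> c * (real n / (lg (real n) / 2) ^ s)"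
    proof (intro mult_left_mono divide_left_mono)
      have "(lg (real n) / 2) ^ s \<le> ln (real n) ^ s"
        using ln by (intro power_mono) (auto simp: lg_def)
      also have "\<dots> \<le> ln (real n) ^ (s + 1)" using ln by (intro power_increasing) auto
      finally show "(lg (real n) / 2) ^ s \<le> ln (real n) ^ (s + 1)" .
    qed (use c ln in \<open>auto simp: lg_def\<close>)
    finally show ?case by (simp add: power_divide mult_ac)
  qed
  have "real n / lg (real n) ^ s > 0" if "n \<ge> 1" for n
    using that lg_ge_1[of "real n"] by (auto intro!: divide_pos_pos zero_less_power)
  with ev' show ?thesis by (rule bounded_of_eventually_bounded)
qed

text \<open>From 1 + a ln x <= x^a with a = \<delta> / (s + 1), raised to the power s; the
  denominator s + 1 covers s = 0.\<close>

lemma lg_power_le_powr: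
  assumes "\<delta> > 0"
  shows "\<exists>C>0. \<forall>x\<ge>1. lg x ^ s \<le> C * x powr \<delta>"
proof -
  define a where "a = \<delta> / (real s + 1)"
  have a: "a > 0" using assms by (simp add: a_def)
  have "lg x ^ s \<le> (1 + 1 / a) ^ s * x powr \<delta>" if x: "x \<ge> 1" for x
  proof -
    have "1 + a * ln x \<le> exp (a * ln x)" by (rule exp_ge_add_one_self)
    also have "exp (a * ln x) = x powr a" using x by (simp add: powr_def)
    finally have 1: "ln x \<le> x powr a / a" using a by (simp add: field_simps)
    have 2: "1 \<le> x powr a" using x a by (simp add: ge_one_powr_ge_zero)
    have "lg x \<le> (1 + 1 / a) * x powr a"
      using 1 2 by (simp add: lg_def algebra_simps)
    hence "lg x ^ s \<le> ((1 + 1 / a) * x powr a) ^ s"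
      using lg_ge_1[OF x] by (intro power_mono) auto
    also have "\<dots> = (1 + 1 / a) ^ s * x powr (a * real s)"
      using x by (simp add: power_mult_distrib powr_powr[symmetric] powr_realpow)
    also have "\<dots> \<le> (1 + 1 / a) ^ s * x powr \<delta>"
    proof (intro mult_left_mono powr_mono)
      show "a * real s \<le> \<delta>" using assms by (simp add: a_def field_simps)
    qed (use x a in auto)
    finally show ?thesis .
  qed
  moreover have "(1 + 1 / a) ^ s > 0" using a by (intro zero_less_power) (simp add: add_pos_pos)
  ultimately show ?thesis by blast
qed

lemma sum_inverse_le_ln:
  assumes "1 \<le> w" "w \<le> n"
  shows "(\<Sum>a=w+1..n. 1 / real a) \<le> ln (real n / real w)"
  using assms(2)
proof (induction n rule: dec_induct)
  case (step n)
  have "(\<Sum>a=w+1..Suc n. 1 / real a) = (\<Sum>a=w+1..n. 1 / real a) + 1 / real (Suc n)"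
    using step by simp
  also have "\<dots> \<le> ln (real n / real w) + ln (real (Suc n) / real n)"
    using step ln_Suc_div_ge_inverse[of n] assms by (intro add_mono) auto
  also have "\<dots> = ln (real (Suc n) / real w)"
    using step assms by (simp add: ln_div)
  finally show ?case .
qed (use assms in auto)

lemma sum_inverse_le_lg:
  assumes "1 \<le> n"
  shows "(\<Sum>a=1..n. 1 / real a) \<le> lg (real n)"
proof -
  have "(\<Sum>a=1..n. 1 / real a) = 1 + (\<Sum>a=1+1..n. 1 / real a)"
    using assms by (subst sum.atLeast_Suc_atMost) auto
  also have "\<dots> \<le> 1 + ln (real n / real 1)"
    by (intro add_left_mono sum_inverse_le_ln) (use assms in auto)
  finally show ?thesis by (simp add: lg_def)
qed

lemma ln_Suc_le_sum_inverse: "ln (real (Suc n)) \<le> (\<Sum>a=1..n. 1 / real a)"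
proof (induction n)
  case (Suc n)
  have "ln (real (Suc (Suc n))) = ln (real (Suc n)) + ln (real (Suc (Suc n)) / real (Suc n))"
    by (subst ln_div) auto
  also have "\<dots> \<le> (\<Sum>a=1..n. 1 / real a) + 1 / real (Suc n)"
    using Suc.IH by (intro add_mono ln_Suc_div_le) auto
  finally show ?case by simp
qed auto

text \<open>
  Partial summation is avoided by correcting \<open>\<Sum> \<Lambda>(i)/i - ln n\<close> by \<open>(\<psi>(n) - n) / n\<close>: the increments of the
  corrected sequence no longer involve \<open>\<Lambda>\<close>.
\<close>

lemma mangoldt_sum_asymptotics_nat:
  assumes "primes_level_of_distribution \<theta>" "\<theta> > 0" and s: "s \<ge> 1"
  shows "\<exists>\<kappa> C. C \<ge> 0 \<and> (\<forall>n\<ge>1. \<bar>(\<Sum>i=1..n. mangoldt i / real i) - ln (real n) - \<kappa>\<bar> \<le> C / lg (real n) ^ s)"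
proof -
  obtain C1 where C1: "C1 \<ge> 0"
    "\<And>n. n \<ge> 1 \<Longrightarrow> \<bar>(\<Sum>i=1..n. mangoldt i) - real n\<bar> \<le> C1 * (real n / lg (real n) ^ Suc s)"
    using prime_number_theorem_of_level[OF assms(1,2), of "Suc s"] by blast
  obtain C2 where C2: "C2 > 0" "\<And>x. x \<ge> 1 \<Longrightarrow> lg x ^ Suc s \<le> C2 * x powr 1"
    using lg_power_le_powr[of 1 "Suc s"] by auto
  define \<Delta> where "\<Delta> = (\<lambda>n. (\<Sum>i=1..n. mangoldt i) - real n)"
  define f where "f = (\<lambda>n. (\<Sum>i=1..n. mangoldt i / real i) - ln (real n) - \<Delta> n / real n)"
  have "\<bar>f (Suc n) - f n\<bar> \<le> (C1 + C2) / (real n * lg (real n) ^ Suc s)" if n: "n \<ge> 1" for n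
  proof -
    define P where "P = lg (real n) ^ Suc s"
    have P: "P \<ge> 1" using lg_ge_1[of "real n"] n unfolding P_def by (intro one_le_power) auto
    have \<Lambda>: "mangoldt (Suc n) = 1 + \<Delta> (Suc n) - \<Delta> n" by (simp add: \<Delta>_def)
    have "f (Suc n) - f n = mangoldt (Suc n) / real (Suc n) - ln (real (Suc n) / real n)
            - \<Delta> (Suc n) / real (Suc n) + \<Delta> n / real n"
      using n by (simp add: f_def ln_div)
    also have "\<dots> = (1 / real (Suc n) - ln (real (Suc n) / real n)) + \<Delta> n * (1 / real n - 1 / real (Suc n))"
      unfolding \<Lambda> by (simp add: diff_divide_distrib add_divide_distrib algebra_simps)
    finally have eq: "f (Suc n) - f n = \<dots>" .
    have d: "1 / real n - 1 / real (Suc n) = 1 / (real n * real (Suc n))"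
      using n by (simp add: field_simps)
    have "\<bar>1 / real (Suc n) - ln (real (Suc n) / real n)\<bar> \<le> 1 / real n - 1 / real (Suc n)"
      using ln_Suc_div_le[OF n] ln_Suc_div_ge_inverse[OF n] by linarith
    also have "\<dots> = 1 / (real n * real (Suc n))" by (rule d)
    also have "\<dots> \<le> C2 / (real n * P)"
    proof -
      have "P \<le> C2 * real n" using C2(2)[of "real n"] n by (simp add: P_def)
      also have "\<dots> \<le> C2 * real (Suc n)" using C2(1) by (intro mult_left_mono) auto
      finally have "P \<le> C2 * real (Suc n)" .
      thus ?thesis using P n by (simp add: divide_simps mult_ac mult_left_mono)
    qed
    finally have t1: "\<bar>1 / real (Suc n) - ln (real (Suc n) / real n)\<bar> \<le> C2 / (real n * P)" .
    have "\<bar>\<Delta> n * (1 / real n - 1 / real (Suc n))\<bar> = \<bar>\<Delta> n\<bar> * (1 / (real n * real (Suc n)))"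
      unfolding d abs_mult by simp
    also have "\<dots> \<le> (C1 * (real n / P)) * (1 / (real n * real n))"
    proof (intro mult_mono divide_left_mono)
      show "\<bar>\<Delta> n\<bar> \<le> C1 * (real n / P)" using C1(2)[OF n] by (simp only: \<Delta>_def P_def)
    qed (use n C1(1) P in auto)
    also have "\<dots> = C1 / (real n * P)" using n by (simp add: field_simps)
    finally have t2: "\<bar>\<Delta> n * (1 / real n - 1 / real (Suc n))\<bar> \<le> C1 / (real n * P)" .
    have "\<bar>f (Suc n) - f n\<bar> \<le> C2 / (real n * P) + C1 / (real n * P)"
      unfolding eq using t1 t2 by (rule abs_triangle_ineq[THEN order_trans, OF add_mono])
    thus ?thesis by (simp add: P_def add_divide_distrib add.commute)
  qed
  then obtain \<kappa> where \<kappa>: "\<And>n. n \<ge> 1 \<Longrightarrow> \<bar>f n - \<kappa>\<bar> \<le> 4 * (C1 + C2) / lg (real n) ^ s"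
    using converges_of_small_differences[OF s, of "C1 + C2" f] C1(1) C2(1) by auto
  have "\<bar>(\<Sum>i=1..n. mangoldt i / real i) - ln (real n) - \<kappa>\<bar> \<le> (4 * (C1 + C2) + C1) / lg (real n) ^ s"
    if n: "n \<ge> 1" for n
  proof -
    have lg: "lg (real n) \<ge> 1" using n by (intro lg_ge_1) auto
    have "\<bar>\<Delta> n / real n\<bar> \<le> (C1 * (real n / lg (real n) ^ Suc s)) / real n"
      unfolding abs_divide abs_of_nat \<Delta>_def by (intro divide_right_mono C1(2)[OF n]) auto
    also have "\<dots> = C1 / lg (real n) ^ Suc s" using n by simp
    also have "\<dots> \<le> C1 / lg (real n) ^ s"
      using lg C1(1) by (intro divide_left_mono power_increasing) auto
    finally have "\<bar>\<Delta> n / real n\<bar> \<le> C1 / lg (real n) ^ s" .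
    moreover have "(\<Sum>i=1..n. mangoldt i / real i) - ln (real n) - \<kappa> = (f n - \<kappa>) + \<Delta> n / real n"
      by (simp add: f_def)
    ultimately show ?thesis using \<kappa>[OF n] unfolding add_divide_distrib by linarith
  qed
  thus ?thesis using C1(1) C2(1) by (intro exI[of _ \<kappa>] exI[of _ "4 * (C1 + C2) + C1"]) auto
qed

lemma mangoldt_sum_asymptotics:
  assumes "primes_level_of_distribution \<theta>" "\<theta> > 0" and s: "s \<ge> 1"
  shows "\<exists>\<kappa> C. C \<ge> 0 \<and> (\<forall>u\<ge>1. \<bar>(\<Sum>i=1..nat \<lfloor>u\<rfloor>. mangoldt i / real i) - ln u - \<kappa>\<bar> \<le> C / lg u ^ s)"
proof -
  obtain \<kappa> C1 where C1: "C1 \<ge> 0"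
    "\<And>n. n \<ge> 1 \<Longrightarrow> \<bar>(\<Sum>i=1..n. mangoldt i / real i) - ln (real n) - \<kappa>\<bar> \<le> C1 / lg (real n) ^ s"
    using mangoldt_sum_asymptotics_nat[OF assms] by blast
  obtain C2 where C2: "C2 > 0" "\<And>x. x \<ge> 1 \<Longrightarrow> lg x ^ s \<le> C2 * x powr 1"
    using lg_power_le_powr[of 1 s] by auto
  have "\<bar>(\<Sum>i=1..nat \<lfloor>u\<rfloor>. mangoldt i / real i) - ln u - \<kappa>\<bar> \<le> (C1 + C2) * 2 ^ s / lg u ^ s" if u: "u \<ge> 1" for u
  proof -
    define n where "n = nat \<lfloor>u\<rfloor>"
    have n: "n \<ge> 1" "real n \<le> u" "u \<le> real (Suc n)"
      using u real_of_int_floor_add_one_ge[of u] by (auto simp: n_def le_nat_floor of_nat_floor add.commute)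
    have lgn: "lg (real n) \<ge> 1" using n by (intro lg_ge_1) auto
    have "ln u \<le> ln (real (Suc n))" using n u by simp
    hence "\<bar>ln u - ln (real n)\<bar> \<le> ln (real (Suc n) / real n)" using n u by (simp add: ln_div)
    also have "\<dots> \<le> 1 / real n" by (rule ln_Suc_div_le[OF n(1)])
    also have "\<dots> \<le> C2 / lg (real n) ^ s"
      using C2(2)[of "real n"] n lgn by (simp add: divide_simps)
    finally have "\<bar>(\<Sum>i=1..n. mangoldt i / real i) - ln u - \<kappa>\<bar> \<le> (C1 + C2) / lg (real n) ^ s"
      using C1(2)[OF n(1)] unfolding add_divide_distrib by linarith
    also have "\<dots> \<le> (C1 + C2) / (lg u / 2) ^ s"
    proof (intro divide_left_mono power_mono)
      have "lg u \<le> lg (real (Suc n))" using n u by (intro lg_mono) auto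
      also have "\<dots> \<le> 2 * lg (real n)" by (rule lg_Suc_le[OF n(1)])
      finally show "lg u / 2 \<le> lg (real n)" by simp
    qed (use lg_ge_1[OF u] C1 C2 lgn in auto)
    finally show ?thesis by (simp add: power_divide n_def)
  qed
  moreover have "(C1 + C2) * 2 ^ s \<ge> 0" using C1 C2 by simp
  ultimately show ?thesis by blast
qed

text \<open>
  The integer \<open>w\<close> is \<open>x exp (1 - l)\<close> rounded down.
\<close>

lemma sqrt_lg_split:
  fixes x :: nat
  assumes x: "x \<ge> 1"
  defines "l \<equiv> sqrt (lg (real x))"
  obtains w :: nat where "1 \<le> w" "w \<le> x" "lg (real w) \<ge> l\<^sup>2 / 4"
    "\<And>a. 1 \<le> a \<Longrightarrow> a \<le> w \<Longrightarrow> lg (real x / real a) \<ge> l" "lg (real x / real (Suc w)) \<le> l"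
proof
  have l1: "l \<ge> 1" using lg_ge_1[of "real x"] x by (simp add: l_def)
  have l2: "lg (real x) = l\<^sup>2" using lg_ge_1[of "real x"] x by (simp add: l_def)
  define y where "y = real x * exp (1 - l)"
  define w where "w = nat \<lfloor>y\<rfloor>"
  have y0: "y > 0" using x by (simp add: y_def)
  have lny: "ln y = l\<^sup>2 - l" using x l2 by (simp add: y_def ln_mult lg_def)
  have "l * 1 \<le> l * l" using l1 by (intro mult_left_mono) auto
  hence "ln y \<ge> 0" by (simp add: lny power2_eq_square)
  hence y1: "y \<ge> 1" using y0 by simp
  have "y \<le> real x * 1" unfolding y_def using l1 by (intro mult_left_mono) auto
  hence yx: "y \<le> real x" by simp
  show w1: "1 \<le> w" using y1 by (simp add: w_def le_nat_floor)
  have wy: "real w \<le> y" "y \<le> real (Suc w)" using y1 real_of_int_floor_add_one_ge[of y] by (auto simp: w_def add.commute)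
  show "w \<le> x" using wy yx by linarith
  have "ln y \<le> ln (real (Suc w))" using y0 wy by simp
  also have "\<dots> = ln (real w) + ln (real (Suc w) / real w)" using w1 by (simp add: ln_div)
  also have "ln (real (Suc w) / real w) \<le> 1 / real w" by (rule ln_Suc_div_le[OF w1])
  also have "1 / real w \<le> 1" using w1 by simp
  finally have a: "lg (real w) \<ge> l\<^sup>2 - l" by (simp add: lny lg_def)
  have b: "lg (real w) \<ge> 1" using w1 by (intro lg_ge_1) auto
  \<comment> \<open>The bound l^2 - l degenerates near l = 1. For l <= 2 the bound
    \<open>lg w >= 1\<close> is enough, since then l^2 / 4 <= 1.\<close>
  show "lg (real w) \<ge> l\<^sup>2 / 4"
  proof (cases "l \<le> 2")
    case True
    hence "l\<^sup>2 \<le> 2\<^sup>2" using l1 by (intro power_mono) auto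
    thus ?thesis using b by simp
  next
    case False
    hence "2 * l \<le> l * l" by (intro mult_right_mono) auto
    moreover have "l * l \<ge> 0" by simp
    ultimately have "l * l - l \<ge> l * l / 4" by linarith
    thus ?thesis using a by (simp add: power2_eq_square)
  qed
  show "lg (real x / real a) \<ge> l" if "1 \<le> a" "a \<le> w" for a
  proof -
    have "ln (real a) \<le> ln y" using that wy y0 by simp
    thus ?thesis using x that l2 lny by (simp add: lg_def ln_div)
  qed
  have "ln y \<le> ln (real (Suc w))" using y0 wy by simp
  thus "lg (real x / real (Suc w)) \<le> l" using x l2 lny by (simp add: lg_def ln_div)
qed

section \<open>Decay of the sum of mu(d) / d\<close>

definition mob_sum :: "nat \<Rightarrow> real" where
  "mob_sum n = (\<Sum>d=1..n. moebius_mu d / real d)"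

lemma abs_mob_sum_le_1: "\<bar>mob_sum n\<bar> \<le> 1"
  using abs_sum_moebius_mu_over_le_1 by (simp add: mob_sum_def)

lemma mob_sum_diff: "w \<le> n \<Longrightarrow> (\<Sum>a=w+1..n. moebius_mu a / real a) = mob_sum n - mob_sum w"
  unfolding mob_sum_def by (induction n rule: dec_induct) auto

text \<open>Write ln x = ln (x/a) + ln a and replace -mu ln by the convolution of mu and Lambda. The
  bracket on the right is then close to a constant for small a, so the factor ln x on the left is a
  gain.\<close>

lemma mob_sum_times_ln:
  assumes "x \<ge> 1"
  shows "mob_sum x * ln (real x) =
    (\<Sum>a=1..x. moebius_mu a / real a * (ln (real x / real a) - (\<Sum>i=1..x div a. mangoldt i / real i)))"
proof -
  have "(\<Sum>a=1..x. moebius_mu a / real a * (\<Sum>i=1..x div a. mangoldt i / real i))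
      = (\<Sum>a=1..x. \<Sum>i=1..x div a. moebius_mu a / real a * (mangoldt i / real i))"
    by (simp add: sum_distrib_left)
  also have "\<dots> = (\<Sum>k=1..x. \<Sum>a | a dvd k. moebius_mu a / real a * (mangoldt (k div a) / real (k div a)))"
    by (rule sum_hyperbola)
  also have "\<dots> = (\<Sum>k=1..x. (\<Sum>a | a dvd k. moebius_mu a * mangoldt (k div a)) / real k)"
    unfolding sum_divide_distrib
  proof (intro sum.cong refl)
    fix k a assume "k \<in> {1..x}" "a \<in> {a. a dvd k}"
    thus "moebius_mu a / real a * (mangoldt (k div a) / real (k div a)) = moebius_mu a * mangoldt (k div a) / real k"
      by (auto simp: real_of_nat_div)
  qed
  also have "\<dots> = (\<Sum>k=1..x. - (moebius_mu k * ln (real k)) / real k)"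
    by (intro sum.cong refl) (simp add: moebius_mangoldt_convolution)
  finally have 1: "(\<Sum>a=1..x. moebius_mu a / real a * (\<Sum>i=1..x div a. mangoldt i / real i)) =
     (\<Sum>k=1..x. - (moebius_mu k * ln (real k)) / real k)" .
  have "(\<Sum>a=1..x. moebius_mu a / real a * ln (real x / real a))
     = (\<Sum>a=1..x. moebius_mu a / real a * ln (real x) - moebius_mu a * ln (real a) / real a)"
    by (intro sum.cong refl) (use assms in \<open>auto simp: ln_div algebra_simps\<close>)
  also have "\<dots> = mob_sum x * ln (real x) - (\<Sum>a=1..x. moebius_mu a * ln (real a) / real a)"
    by (simp add: sum_subtractf mob_sum_def sum_distrib_right)
  finally show ?thesis using 1 by (simp add: right_diff_distrib sum_subtractf sum_negf)
qed

text \<open>The weight g x - g a vanishes at a = x, so no boundary term arises. With g = ln the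
  weights are ln (x/a).\<close>

lemma abel_summation_tail:
  fixes c g :: "nat \<Rightarrow> real"
  assumes "w \<le> x"
  shows "(\<Sum>a=w+1..x. c a * (g x - g a)) = (\<Sum>n=w+1..<x. (g (Suc n) - g n) * (\<Sum>a=w+1..n. c a))"
  using assms
proof (induction x rule: dec_induct)
  case (step n)
  have "(\<Sum>a=w+1..Suc n. c a * (g (Suc n) - g a)) = (\<Sum>a=w+1..n. c a * (g n - g a) + (g (Suc n) - g n) * c a)"
    using step by (simp add: algebra_simps)
  also have "\<dots> = (\<Sum>k=w+1..<n. (g (Suc k) - g k) * (\<Sum>a=w+1..k. c a)) + (g (Suc n) - g n) * (\<Sum>a=w+1..n. c a)"
    by (simp only: sum.distrib step.IH sum_distrib_left[symmetric])
  also have "\<dots> = (\<Sum>k=w+1..<Suc n. (g (Suc k) - g k) * (\<Sum>a=w+1..k. c a))"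
    by (cases "w = n") (use step in auto)
  finally show ?case .
qed auto

text \<open>Both sides run over a > w and i >= 1 with a * i <= x. With a innermost, the sums of
  mu(a) / a become differences of values of \<open>mob_sum\<close> at arguments >= w.\<close>

lemma sum_hyperbola_tail:
  fixes c h :: "nat \<Rightarrow> real"
  shows "(\<Sum>a=w+1..x. c a * (\<Sum>i=1..x div a. h i)) = (\<Sum>i=1..x div (w+1). h i * (\<Sum>a=w+1..x div i. c a))"
proof -
  have "(\<Sum>a=w+1..x. c a * (\<Sum>i=1..x div a. h i)) = (\<Sum>(a,i)\<in>(SIGMA a:{w+1..x}. {1..x div a}). c a * h i)"
    by (simp add: sum_distrib_left sum.Sigma)
  also have "\<dots> = (\<Sum>(i,a)\<in>(SIGMA i:{1..x div (w+1)}. {w+1..x div i}). c a * h i)"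
  proof (rule sum.reindex_bij_witness[where i = "\<lambda>(a,b). (b,a)" and j = "\<lambda>(a,b). (b,a)"], goal_cases)
    case (2 p)
    then obtain a i where p: "p = (a, i)" "w + 1 \<le> a" "a \<le> x" "1 \<le> i" "i \<le> x div a" by auto
    have "x div a \<le> x div (w + 1)" using p by (intro div_le_mono2) auto
    moreover have "i * a \<le> x" using p by (metis div_times_less_eq_dividend le_trans mult_le_mono1)
    hence "a \<le> x div i" using p by (simp add: less_eq_div_iff_mult_less_eq mult.commute)
    ultimately show ?case using p by auto
  next
    case (4 p)
    then obtain a i where p: "p = (i, a)" "w + 1 \<le> a" "a \<le> x div i" "1 \<le> i" "i \<le> x div (w + 1)" by auto
    have "i * a \<le> x" using p by (metis div_times_less_eq_dividend le_trans mult_le_mono1 mult.commute)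
    moreover have "a \<le> x" using p by (meson div_le_dividend le_trans)
    ultimately show ?case using p by (auto simp: less_eq_div_iff_mult_less_eq)
  qed auto
  also have "\<dots> = (\<Sum>i=1..x div (w+1). h i * (\<Sum>a=w+1..x div i. c a))"
    by (simp add: sum_distrib_left sum.Sigma mult.commute)
  finally show ?thesis .
qed

text \<open>
  In \<open>mob_sum_times_ln\<close> the terms with \<open>a \<le> w\<close> are small since \<open>x / a\<close> is large, and those with \<open>a > w\<close> are
  summed by parts, which costs only the factor \<open>sqrt (lg x)\<close>. Dividing by \<open>ln x\<close> gains another \<open>sqrt (lg x)\<close>.
\<close>

lemma mob_sum_bound_step:
  assumes "primes_level_of_distribution \<theta>" "\<theta> > 0"
    and C: "C \<ge> 0" "\<And>n. n \<ge> 1 \<Longrightarrow> \<bar>mob_sum n\<bar> \<le> C / sqrt (lg (real n)) ^ t"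
  shows "\<exists>C'\<ge>0. \<forall>n\<ge>1. \<bar>mob_sum n\<bar> \<le> C' / sqrt (lg (real n)) ^ Suc t"
proof -
  \<comment> \<open>The exponent \<open>Suc t\<close> is what p1 requires: for a <= w the error is
    at most Ce / l^(t+1), the harmonic sum costs l^2, and l / l^t is the size aimed at.\<close>
  obtain \<kappa> Ce where Ce: "Ce \<ge> 0"
    "\<And>u. u \<ge> 1 \<Longrightarrow> \<bar>(\<Sum>i=1..nat \<lfloor>u\<rfloor>. mangoldt i / real i) - ln u - \<kappa>\<bar> \<le> Ce / lg u ^ Suc t"
    using mangoldt_sum_asymptotics[OF assms(1,2), of "Suc t"] by auto
  define Lm where "Lm = (\<lambda>n. \<Sum>i=1..n. mangoldt i / real i)"
  define CL where "CL = 1 + \<bar>\<kappa>\<bar> + Ce"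
  have CL: "CL \<ge> 0" using Ce by (simp add: CL_def)
  have Lm_le: "Lm (nat \<lfloor>u\<rfloor>) \<le> CL * lg u" if u: "u \<ge> 1" for u
  proof -
    have lg: "lg u \<ge> 1" using u by (rule lg_ge_1)
    have "Ce / lg u ^ Suc t \<le> Ce / 1"
      using Ce(1) lg by (intro divide_left_mono one_le_power) auto
    hence "Lm (nat \<lfloor>u\<rfloor>) \<le> lg u + (\<bar>\<kappa>\<bar> + Ce) * 1"
      using Ce(2)[OF u] by (simp add: Lm_def lg_def)
    also have "\<dots> \<le> lg u + (\<bar>\<kappa>\<bar> + Ce) * lg u"
      using lg Ce(1) by (intro add_left_mono mult_left_mono) auto
    finally show ?thesis by (simp add: CL_def algebra_simps)
  qed
  define D where "D = (1 + \<bar>\<kappa>\<bar>) * (C * 2 ^ t) + Ce + 2 * (C * 2 ^ t) + 2 * (C * 2 ^ t) * CL"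
  have "\<bar>mob_sum x\<bar> \<le> D / sqrt (lg (real x)) ^ Suc t" if x: "x \<ge> 1" for x
  proof -
    define l where "l = sqrt (lg (real x))"
    have l1: "l \<ge> 1" using lg_ge_1[of "real x"] x by (simp add: l_def)
    have l2: "lg (real x) = l\<^sup>2" using lg_ge_1[of "real x"] x by (simp add: l_def)
    obtain w where w: "1 \<le> w" "w \<le> x" "lg (real w) \<ge> l\<^sup>2 / 4"
      "\<And>a. 1 \<le> a \<Longrightarrow> a \<le> w \<Longrightarrow> lg (real x / real a) \<ge> l" "lg (real x / real (Suc w)) \<le> l"
      using sqrt_lg_split[OF x, folded l_def] by blast
    \<comment> \<open>For n >= w the hypothesis gives this uniform bound, as
      \<open>lg n >= l^2 / 4\<close> means sqrt (lg n) >= l / 2.\<close>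
    define B where "B = C * 2 ^ t / l ^ t"
    have B0: "B \<ge> 0" using C l1 by (simp add: B_def)
    have mB: "\<bar>mob_sum n\<bar> \<le> B" if "n \<ge> w" for n
    proof -
      have "l\<^sup>2 / 4 \<le> lg (real n)" using w lg_mono[of "real w" "real n"] that by simp
      hence "sqrt ((l / 2)\<^sup>2) \<le> sqrt (lg (real n))"
        by (intro real_sqrt_le_mono) (simp add: power_divide)
      hence l2n: "l / 2 \<le> sqrt (lg (real n))" using l1 by simp
      have "\<bar>mob_sum n\<bar> \<le> C / sqrt (lg (real n)) ^ t" using that w by (intro C) auto
      also have "\<dots> \<le> C / (l / 2) ^ t"
        using C(1) l2n l1 lg_ge_1[of "real n"] that w by (intro divide_left_mono power_mono mult_pos_pos zero_less_power) auto
      also have "\<dots> = B" by (simp add: B_def power_divide)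
      finally show ?thesis .
    qed
    have mB2: "\<bar>mob_sum n - mob_sum w\<bar> \<le> 2 * B" if "n \<ge> w" for n
      using mB[OF that] mB[of w] by linarith
    have fl: "nat \<lfloor>real x / real a\<rfloor> = x div a" for a by (simp add: floor_divide_of_nat_eq)
    let ?F = "\<lambda>a. moebius_mu a / real a * (ln (real x / real a) - Lm (x div a))"
    have "mob_sum x * ln (real x) = (\<Sum>a=1..x. ?F a)"
      unfolding Lm_def by (rule mob_sum_times_ln[OF x])
    also have "\<dots> = (\<Sum>a=1..w. ?F a) + (\<Sum>a=w+1..x. ?F a)"
      using sum.ub_add_nat[of 1 w ?F "x - w"] w by simp
    finally have eq: "mob_sum x * ln (real x) = (\<Sum>a=1..w. ?F a) + (\<Sum>a=w+1..x. ?F a)" .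
    \<comment> \<open>The bracket is near -\<kappa>; its constant part sums to -\<kappa> *
      \<open>mob_sum w\<close>, which is of size B, and only the rest is estimated termwise.\<close>
    have p1: "\<bar>\<Sum>a=1..w. ?F a\<bar> \<le> \<bar>\<kappa>\<bar> * B + Ce * l / l ^ t"
    proof -
      have e: "\<bar>moebius_mu a / real a * (ln (real x / real a) - Lm (x div a) + \<kappa>)\<bar> \<le> 1 / real a * (Ce / l ^ Suc t)"
        if a: "a \<in> {1..w}" for a
      proof -
        have "\<bar>Lm (x div a) - ln (real x / real a) - \<kappa>\<bar> \<le> Ce / lg (real x / real a) ^ Suc t"
          using Ce(2)[of "real x / real a"] a w by (simp add: Lm_def fl)
        also have "\<dots> \<le> Ce / l ^ Suc t"
          using w(4)[of a] a l1 Ce(1) by (intro divide_left_mono power_mono mult_pos_pos zero_less_power) auto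
        finally have "\<bar>ln (real x / real a) - Lm (x div a) + \<kappa>\<bar> \<le> Ce / l ^ Suc t" by linarith
        moreover have "\<bar>moebius_mu a / real a\<bar> \<le> 1 / real a"
          using abs_moebius_mu_le[of a] by (simp add: abs_divide divide_right_mono)
        ultimately show ?thesis unfolding abs_mult by (intro mult_mono) auto
      qed
      have "(\<Sum>a=1..w. ?F a) = (\<Sum>a=1..w. moebius_mu a / real a * (ln (real x / real a) - Lm (x div a) + \<kappa>)) - \<kappa> * mob_sum w"
        by (simp add: mob_sum_def sum_distrib_left sum_subtractf[symmetric] algebra_simps)
      moreover have "\<bar>\<Sum>a=1..w. moebius_mu a / real a * (ln (real x / real a) - Lm (x div a) + \<kappa>)\<bar>
           \<le> (\<Sum>a=1..w. 1 / real a * (Ce / l ^ Suc t))"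
        by (rule order_trans[OF sum_abs sum_mono]) (rule e)
      moreover have "(\<Sum>a=1..w. 1 / real a * (Ce / l ^ Suc t)) \<le> l\<^sup>2 * (Ce / l ^ Suc t)"
        unfolding sum_distrib_right[symmetric]
      proof (intro mult_right_mono)
        have "(\<Sum>a=1..w. 1 / real a) \<le> lg (real w)" by (rule sum_inverse_le_lg[OF w(1)])
        also have "\<dots> \<le> l\<^sup>2" unfolding l2[symmetric] using w by (intro lg_mono) auto
        finally show "(\<Sum>a=1..w. 1 / real a) \<le> l\<^sup>2" .
      qed (use Ce l1 in auto)
      moreover have "l\<^sup>2 * (Ce / l ^ Suc t) = Ce * l / l ^ t"
        using l1 by (simp add: power2_eq_square)
      moreover have "\<bar>\<kappa> * mob_sum w\<bar> \<le> \<bar>\<kappa>\<bar> * B"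
        unfolding abs_mult by (intro mult_left_mono mB) auto
      ultimately show ?thesis by linarith
    qed
    have p2: "\<bar>\<Sum>a=w+1..x. moebius_mu a / real a * ln (real x / real a)\<bar> \<le> 2 * B * l"
    proof (cases "w = x")
      case False
      hence wx: "Suc w \<le> x" using w by simp
      have "(\<Sum>a=w+1..x. moebius_mu a / real a * ln (real x / real a))
          = (\<Sum>a=w+1..x. moebius_mu a / real a * (ln (real x) - ln (real a)))"
        by (intro sum.cong refl) (use x in \<open>auto simp: ln_div\<close>)
      also have "\<dots> = (\<Sum>n=w+1..<x. (ln (real (Suc n)) - ln (real n)) * (mob_sum n - mob_sum w))"
        by (subst abel_summation_tail[OF w(2)], intro sum.cong refl) (simp add: mob_sum_diff[unfolded Suc_eq_plus1[symmetric]])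
      finally have "\<bar>\<Sum>a=w+1..x. moebius_mu a / real a * ln (real x / real a)\<bar>
          \<le> (\<Sum>n=w+1..<x. \<bar>(ln (real (Suc n)) - ln (real n)) * (mob_sum n - mob_sum w)\<bar>)"
        by (simp only: sum_abs)
      also have "\<dots> \<le> (\<Sum>n=w+1..<x. (ln (real (Suc n)) - ln (real n)) * (2 * B))"
      proof (rule sum_mono)
        fix n assume "n \<in> {w+1..<x}"
        thus "\<bar>(ln (real (Suc n)) - ln (real n)) * (mob_sum n - mob_sum w)\<bar> \<le> (ln (real (Suc n)) - ln (real n)) * (2 * B)"
          unfolding abs_mult by (intro mult_mono mB2) auto
      qed
      also have "\<dots> = (ln (real x) - ln (real (Suc w))) * (2 * B)"
        unfolding sum_distrib_right[symmetric] using wx by (subst sum_Suc_diff') auto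
      also have "\<dots> \<le> l * (2 * B)"
        using w(5) x B0 by (intro mult_right_mono) (auto simp: lg_def ln_div)
      finally show ?thesis by (simp add: mult_ac)
    qed (use B0 l1 in auto)
    have p3: "\<bar>\<Sum>a=w+1..x. moebius_mu a / real a * Lm (x div a)\<bar> \<le> 2 * B * CL * l"
    proof (cases "w = x")
      case False
      hence wx: "Suc w \<le> x" using w by simp
      have "(\<Sum>a=w+1..x. moebius_mu a / real a * Lm (x div a))
          = (\<Sum>i=1..x div (w+1). mangoldt i / real i * (\<Sum>a=w+1..x div i. moebius_mu a / real a))"
        unfolding Lm_def by (rule sum_hyperbola_tail)
      hence "\<bar>\<Sum>a=w+1..x. moebius_mu a / real a * Lm (x div a)\<bar>
          \<le> (\<Sum>i=1..x div (w+1). \<bar>mangoldt i / real i * (\<Sum>a=w+1..x div i. moebius_mu a / real a)\<bar>)"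
        by (simp only: sum_abs)
      also have "\<dots> \<le> (\<Sum>i=1..x div (w+1). mangoldt i / real i * (2 * B))"
      proof (rule sum_mono)
        fix i assume "i \<in> {1..x div (w+1)}"
        hence i: "1 \<le> i" "i \<le> x div (w+1)" by auto
        hence "i * (w + 1) \<le> x" by (metis div_times_less_eq_dividend le_trans mult_le_mono1)
        hence "w \<le> x div i" using i by (simp add: less_eq_div_iff_mult_less_eq algebra_simps)
        thus "\<bar>mangoldt i / real i * (\<Sum>a=w+1..x div i. moebius_mu a / real a)\<bar> \<le> mangoldt i / real i * (2 * B)"
          unfolding abs_mult mob_sum_diff[OF \<open>w \<le> x div i\<close>] using mangoldt_nonneg[of i]
          by (intro mult_mono mB2) auto
      qed
      also have "\<dots> = Lm (x div (w+1)) * (2 * B)"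
        by (simp add: Lm_def sum_distrib_right)
      also have "\<dots> \<le> (CL * l) * (2 * B)"
      proof (intro mult_right_mono)
        have "Lm (x div (w+1)) \<le> CL * lg (real x / real (w+1))"
          using Lm_le[of "real x / real (w+1)"] wx by (simp only: fl) auto
        also have "\<dots> \<le> CL * l" using w(5) CL by (intro mult_left_mono) auto
        finally show "Lm (x div (w+1)) \<le> CL * l" .
      qed (use B0 in auto)
      finally show ?thesis by (simp add: mult_ac)
    qed (use B0 l1 CL in auto)
    have "(\<Sum>a=w+1..x. ?F a) = (\<Sum>a=w+1..x. moebius_mu a / real a * ln (real x / real a))
         - (\<Sum>a=w+1..x. moebius_mu a / real a * Lm (x div a))"
      by (simp add: right_diff_distrib sum_subtractf)
    hence "\<bar>mob_sum x * ln (real x)\<bar> \<le> \<bar>\<kappa>\<bar> * B + Ce * l / l ^ t + 2 * B * l + 2 * B * CL * l"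
      unfolding eq using p1 p2 p3 by linarith
    moreover have "\<bar>mob_sum x\<bar> \<le> B" using w by (intro mB) auto
    moreover have "\<bar>mob_sum x\<bar> * lg (real x) = \<bar>mob_sum x * ln (real x)\<bar> + \<bar>mob_sum x\<bar>"
      using x by (simp add: lg_def abs_mult algebra_simps)
    ultimately have "\<bar>mob_sum x\<bar> * l\<^sup>2 \<le> (1 + \<bar>\<kappa>\<bar>) * B * 1 + Ce * l / l ^ t + 2 * B * l + 2 * B * CL * l"
      unfolding l2 by (simp add: algebra_simps)
    also have "\<dots> \<le> (1 + \<bar>\<kappa>\<bar>) * B * l + Ce * l / l ^ t + 2 * B * l + 2 * B * CL * l"
      using l1 B0 by (intro add_right_mono mult_left_mono) auto
    also have "\<dots> = D * l / l ^ t"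
      using l1 by (simp add: D_def B_def field_simps)
    finally have "\<bar>mob_sum x\<bar> * l \<le> D / l ^ t"
      using l1 by (simp add: power2_eq_square divide_simps)
    thus ?thesis using l1 by (simp add: l_def[symmetric] field_simps)
  qed
  moreover have "D \<ge> 0" using C Ce CL by (simp add: D_def)
  ultimately show ?thesis by blast
qed

text \<open>Start from the trivial bound 1. Each step gains sqrt (lg n), so 2 s steps reach the
  power s.\<close>

lemma mob_sum_bound:
  assumes "primes_level_of_distribution \<theta>" "\<theta> > 0"
  shows "\<exists>C\<ge>0. \<forall>n\<ge>1. \<bar>mob_sum n\<bar> \<le> C / lg (real n) ^ s"
proof -
  have "\<exists>C\<ge>0. \<forall>n\<ge>1. \<bar>mob_sum n\<bar> \<le> C / sqrt (lg (real n)) ^ t" for t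
  proof (induction t)
    case 0
    show ?case using abs_mob_sum_le_1 by (intro exI[of _ 1]) auto
  next
    case (Suc t)
    then obtain C where "C \<ge> 0" "\<And>n. n \<ge> 1 \<Longrightarrow> \<bar>mob_sum n\<bar> \<le> C / sqrt (lg (real n)) ^ t" by blast
    thus ?case by (rule mob_sum_bound_step[OF assms])
  qed
  from this[of "2 * s"] obtain C where C: "C \<ge> 0" "\<And>n. n \<ge> 1 \<Longrightarrow> \<bar>mob_sum n\<bar> \<le> C / sqrt (lg (real n)) ^ (2 * s)"
    by blast
  have "sqrt (lg (real n)) ^ (2 * s) = lg (real n) ^ s" if "n \<ge> 1" for n
    using lg_ge_1[of "real n"] that by (simp add: power_mult)
  with C show ?thesis by force
qed

section \<open>The sieve sum with constant weight\<close>

text \<open>Only squarefree d contribute, so the product over the primes of d is the value at d of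
  the multiplicative function that \<open>f\<close> prescribes at primes.\<close>

definition sieve_sum :: "(nat \<Rightarrow> real) \<Rightarrow> real \<Rightarrow> real" where
  "sieve_sum f y = (\<Sum>d | 1 \<le> d \<and> real d \<le> y.
     moebius_mu d / real d * (\<Prod>p\<in>prime_factors d. f p) * ln (y / real d))"

lemma nat_real_le_set: "{d. 1 \<le> d \<and> real d \<le> y} = {1..nat \<lfloor>y\<rfloor>}"
  by (auto simp: le_nat_floor) (use nat_le_real_less in linarith)

lemma finite_nat_real_le [simp]: "finite {d. Suc 0 \<le> d \<and> real d \<le> y}"
  using nat_real_le_set[of y] by simp

lemma sieve_sum_1: "sieve_sum (\<lambda>_. 1) y = (\<Sum>d=1..nat \<lfloor>y\<rfloor>. moebius_mu d / real d * ln (y / real d))"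
  by (simp only: sieve_sum_def nat_real_le_set) simp

text \<open>From n to n + 1 the sum grows by \<open>mob_sum n\<close> * ln ((n+1)/n), the new term d
  = n + 1 carrying ln 1 = 0. By the decay of \<open>mob_sum\<close> these increments are summable;
  the limit c is identified afterwards.\<close>

lemma sieve_sum_1_converges:
  assumes "primes_level_of_distribution \<theta>" "\<theta> > 0" and s: "s \<ge> 1"
  shows "\<exists>c C. C \<ge> 0 \<and> (\<forall>y\<ge>1. \<bar>sieve_sum (\<lambda>_. 1) y - c\<bar> \<le> C / lg y ^ s)"
proof -
  obtain C1 where C1: "C1 \<ge> 0" "\<And>n. n \<ge> 1 \<Longrightarrow> \<bar>mob_sum n\<bar> \<le> C1 / lg (real n) ^ Suc s"
    using mob_sum_bound[OF assms(1,2), of "Suc s"] by blast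
  define f where "f = (\<lambda>n. \<Sum>d=1..n. moebius_mu d / real d * ln (real n / real d))"
  have "\<bar>f (Suc n) - f n\<bar> \<le> C1 / (real n * lg (real n) ^ Suc s)" if n: "n \<ge> 1" for n
  proof -
    have "f (Suc n) = (\<Sum>d=1..n. moebius_mu d / real d * ln (real (Suc n) / real d))"
      by (simp add: f_def)
    also have "\<dots> = (\<Sum>d=1..n. moebius_mu d / real d * ln (real n / real d) +
                       moebius_mu d / real d * ln (real (Suc n) / real n))"
      by (intro sum.cong refl) (use n in \<open>auto simp: ln_div algebra_simps\<close>)
    also have "\<dots> = f n + mob_sum n * ln (real (Suc n) / real n)"
      by (simp add: sum.distrib f_def mob_sum_def sum_distrib_right)
    finally have "\<bar>f (Suc n) - f n\<bar> = \<bar>mob_sum n\<bar> * ln (real (Suc n) / real n)"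
      using n by (simp add: abs_mult)
    also have "\<dots> \<le> C1 / lg (real n) ^ Suc s * (1 / real n)"
      using C1(2)[OF n] ln_Suc_div_le[OF n] n lg_ge_1[of "real n"] C1(1)
      by (intro mult_mono) (auto intro!: divide_nonneg_nonneg mult_nonneg_nonneg)
    finally show ?thesis by (simp add: mult_ac)
  qed
  then obtain c where c: "\<And>n. n \<ge> 1 \<Longrightarrow> \<bar>f n - c\<bar> \<le> 4 * C1 / lg (real n) ^ s"
    using converges_of_small_differences[OF s C1(1), of f] by auto
  have "\<bar>sieve_sum (\<lambda>_. 1) y - c\<bar> \<le> 5 * C1 * 2 ^ s / lg y ^ s" if y: "y \<ge> 1" for y
  proof -
    define n where "n = nat \<lfloor>y\<rfloor>"
    have n: "n \<ge> 1" "real n \<le> y" "y \<le> real (Suc n)"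
      using y real_of_int_floor_add_one_ge[of y] by (auto simp: n_def le_nat_floor of_nat_floor add.commute)
    have lgn: "lg (real n) \<ge> 1" using n by (intro lg_ge_1) auto
    have "sieve_sum (\<lambda>_. 1) y = (\<Sum>d=1..n. moebius_mu d / real d * ln (real n / real d) +
                       moebius_mu d / real d * ln (y / real n))"
      unfolding sieve_sum_1 n_def[symmetric]
      by (intro sum.cong refl) (use n y in \<open>auto simp: ln_div algebra_simps\<close>)
    also have "\<dots> = f n + mob_sum n * ln (y / real n)"
      by (simp add: sum.distrib f_def mob_sum_def sum_distrib_right)
    finally have eq: "sieve_sum (\<lambda>_. 1) y - c = (f n - c) + mob_sum n * ln (y / real n)" by simp
    have "ln (y / real n) \<le> ln (real (Suc n) / real n)" using n y by (simp add: divide_right_mono)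
    also have "\<dots> \<le> 1 / real n" by (rule ln_Suc_div_le[OF n(1)])
    also have "\<dots> \<le> 1" using n by simp
    finally have "ln (y / real n) \<le> 1" .
    moreover have "ln (y / real n) \<ge> 0" using n y by simp
    ultimately have "\<bar>mob_sum n * ln (y / real n)\<bar> \<le> C1 / lg (real n) ^ Suc s * 1"
      unfolding abs_mult using C1(2)[OF n(1)] by (intro mult_mono) auto
    also have "\<dots> \<le> C1 / lg (real n) ^ s"
      using lgn C1(1) by (auto intro!: divide_left_mono)
    finally have "\<bar>sieve_sum (\<lambda>_. 1) y - c\<bar> \<le> 4 * C1 / lg (real n) ^ s + C1 / lg (real n) ^ s"
      unfolding eq using c[OF n(1)] by linarith
    also have "\<dots> = 5 * C1 / lg (real n) ^ s" by (simp add: add_divide_distrib[symmetric])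
    also have "\<dots> \<le> 5 * C1 / (lg y / 2) ^ s"
    proof (intro divide_left_mono power_mono)
      have "lg y \<le> lg (real (Suc n))" using n y by (intro lg_mono) auto
      also have "\<dots> \<le> 2 * lg (real n)" by (rule lg_Suc_le[OF n(1)])
      finally show "lg y / 2 \<le> lg (real n)" by simp
    qed (use lg_ge_1[OF y] C1 lgn in auto)
    finally show ?thesis by (simp add: power_divide)
  qed
  moreover have "5 * C1 * 2 ^ s \<ge> 0" using C1 by simp
  ultimately show ?thesis by blast
qed

text \<open>Summation against 1/n undoes mu: with k = n * d the inner sums are divisor sums of mu,
  and only k = 1 remains. The exact value serves to determine the limit c.\<close>

lemma sum_sieve_sum_1:
  assumes "N \<ge> 1"
  shows "(\<Sum>n=1..N. 1 / real n * sieve_sum (\<lambda>_. 1) (real N / real n)) = ln (real N)"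
proof -
  have fl: "nat \<lfloor>real N / real a\<rfloor> = N div a" for a by (simp add: floor_divide_of_nat_eq)
  have "(\<Sum>n=1..N. 1 / real n * sieve_sum (\<lambda>_. 1) (real N / real n))
      = (\<Sum>n=1..N. \<Sum>d=1..N div n. 1 / real n * (moebius_mu d / real d * ln (real N / real n / real d)))"
    by (simp only: sieve_sum_1 fl sum_distrib_left)
  also have "\<dots> = (\<Sum>k=1..N. \<Sum>n | n dvd k. 1 / real n * (moebius_mu (k div n) / real (k div n) * ln (real N / real n / real (k div n))))"
    by (rule sum_hyperbola)
  also have "\<dots> = (\<Sum>k=1..N. if k = 1 then ln (real N) else 0)"
  proof (intro sum.cong refl)
    fix k assume k: "k \<in> {1..N}"
    have "(\<Sum>n | n dvd k. 1 / real n * (moebius_mu (k div n) / real (k div n) * ln (real N / real n / real (k div n))))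
        = (\<Sum>n | n dvd k. ln (real N / real k) / real k * moebius_mu (k div n))"
      by (intro sum.cong refl) (use k in \<open>auto simp: real_of_nat_div\<close>)
    also have "\<dots> = ln (real N / real k) / real k * (\<Sum>n | n dvd k. moebius_mu (k div n))"
      by (simp only: sum_distrib_left)
    also have "(\<Sum>n | n dvd k. moebius_mu (k div n)) = (\<Sum>n | n dvd k. moebius_mu n)"
      by (rule sum.reindex_bij_witness[where i = "\<lambda>n. k div n" and j = "\<lambda>n. k div n"])
         (use k in \<open>auto simp: div_div_eq_right dest: dvd_div_mult_self\<close>)
    also have "\<dots> = (if k = 1 then 1 else 0)" using k by (intro sum_moebius_mu_divisors) auto
    finally show "(\<Sum>n | n dvd k. 1 / real n * (moebius_mu (k div n) / real (k div n) * ln (real N / real n / real (k div n))))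
       = (if k = 1 then ln (real N) else 0)" by auto
  qed
  also have "\<dots> = ln (real N)" using assms by (subst sum.delta) auto
  finally show ?thesis .
qed

text \<open>Replacing the sieve sums in \<open>sum_sieve_sum_1\<close> by their limit c turns it
  into c ln N = ln N + O(sqrt (lg N)), whence c = 1. For n <= w the error C / l meets a harmonic sum
  of at most l^2; for n > w the error C meets one of at most l.\<close>

lemma sieve_sum_1_asymptotics:
  assumes "primes_level_of_distribution \<theta>" "\<theta> > 0" and s: "s \<ge> 1"
  shows "\<exists>C\<ge>0. \<forall>y\<ge>1. \<bar>sieve_sum (\<lambda>_. 1) y - 1\<bar> \<le> C / lg y ^ s"
proof -
  obtain c C where C: "C \<ge> 0" "\<And>y. y \<ge> 1 \<Longrightarrow> \<bar>sieve_sum (\<lambda>_. 1) y - c\<bar> \<le> C / lg y ^ s"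
    using sieve_sum_1_converges[OF assms] by blast
  have bound: "\<bar>1 - c\<bar> * ln (real N) \<le> \<bar>c\<bar> + 2 * C * sqrt (lg (real N))" if N: "N \<ge> 1" for N
  proof -
    define l where "l = sqrt (lg (real N))"
    have l1: "l \<ge> 1" using lg_ge_1[of "real N"] N by (simp add: l_def)
    have l2: "lg (real N) = l\<^sup>2" using lg_ge_1[of "real N"] N by (simp add: l_def)
    obtain w where w: "1 \<le> w" "w \<le> N"
      "\<And>a. 1 \<le> a \<Longrightarrow> a \<le> w \<Longrightarrow> lg (real N / real a) \<ge> l" "lg (real N / real (Suc w)) \<le> l"
      using sqrt_lg_split[OF N, folded l_def] by blast
    let ?e = "\<lambda>n. sieve_sum (\<lambda>_. 1) (real N / real n) - c"
    let ?H = "\<Sum>n=1..N. 1 / real n"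
    have "ln (real N) = (\<Sum>n=1..N. c * (1 / real n) + 1 / real n * ?e n)"
      by (subst sum_sieve_sum_1[OF N, symmetric]) (simp add: algebra_simps)
    also have "\<dots> = c * ?H + (\<Sum>n=1..N. 1 / real n * ?e n)"
      by (simp only: sum.distrib sum_distrib_left)
    also have "(\<Sum>n=1..N. 1 / real n * ?e n) = (\<Sum>n=1..w. 1 / real n * ?e n) + (\<Sum>n=w+1..N. 1 / real n * ?e n)"
      using sum.ub_add_nat[of 1 w "\<lambda>n. 1 / real n * ?e n" "N - w"] w by simp
    finally have eq: "ln (real N) = c * ?H + ((\<Sum>n=1..w. 1 / real n * ?e n) + (\<Sum>n=w+1..N. 1 / real n * ?e n))" .
    have eb: "\<bar>?e n\<bar> \<le> C / lg (real N / real n)" if "1 \<le> n" "n \<le> N" for n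
    proof -
      have "lg (real N / real n) \<ge> 1" using that by (intro lg_ge_1) auto
      hence "C / lg (real N / real n) ^ s \<le> C / lg (real N / real n) ^ 1"
        using C(1) s by (intro divide_left_mono power_increasing) auto
      thus ?thesis using C(2)[of "real N / real n"] that by auto
    qed
    have 1: "\<bar>\<Sum>n=1..w. 1 / real n * ?e n\<bar> \<le> C * l"
    proof -
      have "\<bar>\<Sum>n=1..w. 1 / real n * ?e n\<bar> \<le> (\<Sum>n=1..w. 1 / real n * (C / l))"
      proof (rule order_trans[OF sum_abs sum_mono])
        fix n assume n: "n \<in> {1..w}"
        have "\<bar>?e n\<bar> \<le> C / lg (real N / real n)" using n w by (intro eb) auto
        also have "\<dots> \<le> C / l" using w(3)[of n] n l1 C(1) by (intro divide_left_mono) auto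
        finally show "\<bar>1 / real n * ?e n\<bar> \<le> 1 / real n * (C / l)"
          unfolding abs_mult by (intro mult_mono) auto
      qed
      also have "\<dots> \<le> l\<^sup>2 * (C / l)"
        unfolding sum_distrib_right[symmetric]
      proof (intro mult_right_mono)
        have "(\<Sum>n=1..w. 1 / real n) \<le> lg (real w)" by (rule sum_inverse_le_lg[OF w(1)])
        also have "\<dots> \<le> l\<^sup>2" unfolding l2[symmetric] using w by (intro lg_mono) auto
        finally show "(\<Sum>n=1..w. 1 / real n) \<le> l\<^sup>2" .
      qed (use C l1 in auto)
      also have "\<dots> = C * l" using l1 by (simp add: power2_eq_square)
      finally show ?thesis .
    qed
    have 2: "\<bar>\<Sum>n=w+1..N. 1 / real n * ?e n\<bar> \<le> C * l"
    proof -
      have "\<bar>\<Sum>n=w+1..N. 1 / real n * ?e n\<bar> \<le> (\<Sum>n=w+1..N. 1 / real n * C)"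
      proof (rule order_trans[OF sum_abs sum_mono])
        fix n assume n: "n \<in> {w+1..N}"
        hence "lg (real N / real n) \<ge> 1" by (intro lg_ge_1) auto
        hence "C / lg (real N / real n) \<le> C / 1" using C(1) by (intro divide_left_mono) auto
        hence "\<bar>?e n\<bar> \<le> C" using eb[of n] n by auto
        thus "\<bar>1 / real n * ?e n\<bar> \<le> 1 / real n * C"
          unfolding abs_mult by (intro mult_mono) auto
      qed
      also have "\<dots> = (\<Sum>n=w+1..N. 1 / real n) * C" by (simp only: sum_distrib_right)
      also have "\<dots> \<le> l * C"
      proof (intro mult_right_mono)
        show "(\<Sum>n=w+1..N. 1 / real n) \<le> l"
        proof (cases "w = N")
          case False
          hence wN: "Suc w \<le> N" using w by simp
          have "(\<Sum>n=w+1..N. 1 / real n) = 1 / real (Suc w) + (\<Sum>n=Suc w+1..N. 1 / real n)"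
            using wN by (subst sum.atLeast_Suc_atMost) auto
          also have "\<dots> \<le> 1 + ln (real N / real (Suc w))"
            using wN by (intro add_mono sum_inverse_le_ln) auto
          also have "\<dots> \<le> l" using w(4) by (simp add: lg_def)
          finally show ?thesis .
        qed (use l1 in auto)
      qed (use C in auto)
      finally show ?thesis by (simp add: mult_ac)
    qed
    have H: "\<bar>?H - ln (real N)\<bar> \<le> 1"
    proof -
      have "ln (real N) \<le> ln (real (Suc N))" using N by simp
      thus ?thesis using ln_Suc_le_sum_inverse[of N] sum_inverse_le_lg[OF N] unfolding lg_def by linarith
    qed
    have "\<bar>1 - c\<bar> * ln (real N) = \<bar>(1 - c) * ln (real N)\<bar>" using N by (simp add: abs_mult)
    also have "(1 - c) * ln (real N) = c * (?H - ln (real N)) + ((\<Sum>n=1..w. 1 / real n * ?e n) + (\<Sum>n=w+1..N. 1 / real n * ?e n))"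
      using eq by (simp add: algebra_simps)
    also have "\<bar>\<dots>\<bar> \<le> \<bar>c\<bar> * 1 + (C * l + C * l)"
      using 1 2 mult_left_mono[OF H, of "\<bar>c\<bar>"] abs_mult[of c "?H - ln (real N)"] by linarith
    finally show ?thesis by (simp add: l_def)
  qed
  have "c = 1"
  proof (rule ccontr)
    assume "c \<noteq> 1"
    hence pos: "\<bar>1 - c\<bar> > 0" by simp
    have "((\<lambda>N. (\<bar>c\<bar> + 2 * C * sqrt (lg (real N))) / ln (real N)) \<longlongrightarrow> 0) sequentially"
      unfolding lg_def by real_asymp
    hence "eventually (\<lambda>N. (\<bar>c\<bar> + 2 * C * sqrt (lg (real N))) / ln (real N) < \<bar>1 - c\<bar>) sequentially"
      using pos by (rule order_tendstoD)
    moreover have "eventually (\<lambda>N. N \<ge> (2::nat)) sequentially" by (rule eventually_ge_at_top)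
    ultimately have "eventually (\<lambda>N::nat. False) sequentially"
    proof eventually_elim
      case (elim N)
      have "ln (real N) > 0" using elim by simp
      with elim(1) have "\<bar>c\<bar> + 2 * C * sqrt (lg (real N)) < \<bar>1 - c\<bar> * ln (real N)"
        by (simp add: field_simps)
      thus False using bound[of N] elim by simp
    qed
    thus False by simp
  qed
  with C show ?thesis by blast
qed

lemma sieve_sum_less_1: "y < 1 \<Longrightarrow> sieve_sum f y = 0"
proof -
  assume "y < 1"
  hence "{d. 1 \<le> d \<and> real d \<le> y} = {}" by auto
  thus ?thesis by (simp only: sieve_sum_def sum.empty)
qed

section \<open>Sieve sums with prescribed local factors\<close>

lemma sieve_sum_cong:
  assumes "\<And>p. prime p \<Longrightarrow> f p = g p"
  shows "sieve_sum f y = sieve_sum g y"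
  unfolding sieve_sum_def
  by (intro sum.cong refl arg_cong2[of _ _ _ _ "(*)"] prod.cong) (auto intro: assms)

text \<open>Split d according to divisibility by q. For d = q * e with q not dividing e, mu changes
  sign and y / d = (y / q) / e; the value 0 at q removes the other e. This allows the local factors
  to be changed one prime at a time.\<close>

lemma sieve_sum_fun_upd:
  assumes q: "prime q"
  shows "sieve_sum f y = sieve_sum (f(q := 0)) y - f q / real q * sieve_sum (f(q := 0)) (y / real q)"
proof -
  define t where "t = (\<lambda>f y d. moebius_mu d / real d * (\<Prod>p\<in>prime_factors d. f p :: real) * ln (y / real d))"
  let ?S = "\<lambda>y. {d. 1 \<le> d \<and> real d \<le> y}"
  let ?f0 = "f(q := 0)"
  have fin: "finite (?S y)" for y by simp
  have q0: "q > 0" using q by (rule prime_gt_0_nat)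
  have A: "(\<Sum>d\<in>{d\<in>?S y. \<not> q dvd d}. t f y d) = (\<Sum>d\<in>?S y. t ?f0 y d)"
  proof (rule sum.mono_neutral_cong_left)
    show "\<forall>d\<in>?S y - {d\<in>?S y. \<not> q dvd d}. t ?f0 y d = 0"
    proof
      fix d assume "d \<in> ?S y - {d\<in>?S y. \<not> q dvd d}"
      hence "q \<in> prime_factors d" using q by (auto simp: in_prime_factors_iff)
      thus "t ?f0 y d = 0" by (auto simp: t_def intro!: prod_zero)
    qed
  next
    fix d assume "d \<in> {d\<in>?S y. \<not> q dvd d}"
    hence "q \<notin> prime_factors d" by (auto simp: in_prime_factors_iff)
    thus "t f y d = t ?f0 y d" unfolding t_def by (auto intro!: prod.cong)
  qed (use fin in auto)
  have pt: "t f y (q * e) = - (f q / real q) * t ?f0 (y / real q) e" if e: "e \<ge> 1" for e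
  proof (cases "q dvd e")
    case True
    hence "q\<^sup>2 dvd q * e" by (simp add: power2_eq_square)
    hence "\<not> squarefree (q * e)" using q by (auto simp: squarefree_def dest: spec[of _ q])
    moreover have "q \<in> prime_factors e" using True q e by (auto simp: in_prime_factors_iff)
    hence "(\<Prod>p\<in>prime_factors e. ?f0 p) = 0" by (auto intro!: prod_zero)
    ultimately show ?thesis by (simp add: t_def moebius_mu_not_squarefree)
  next
    case False
    have pf: "prime_factors (q * e) = insert q (prime_factors e)"
      using q q0 e by (subst prime_factors_product) (auto simp: prime_factorization_prime)
    have "q \<notin> prime_factors e" using False by (auto simp: in_prime_factors_iff)
    hence "(\<Prod>p\<in>prime_factors (q * e). f p) = f q * (\<Prod>p\<in>prime_factors e. f p)"
      unfolding pf by simp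
    also have "(\<Prod>p\<in>prime_factors e. f p) = (\<Prod>p\<in>prime_factors e. ?f0 p)"
      using \<open>q \<notin> prime_factors e\<close> by (auto intro!: prod.cong)
    finally show ?thesis
      by (simp add: t_def moebius_mu_prime_mult[OF q False])
  qed
  have B: "(\<Sum>d\<in>{d\<in>?S y. q dvd d}. t f y d) = (\<Sum>e\<in>?S (y / real q). t f y (q * e))"
    by (rule sum.reindex_bij_witness[where i = "\<lambda>e. q * e" and j = "\<lambda>d. d div q"])
       (use q0 in \<open>auto simp: field_simps real_of_nat_div Suc_le_eq intro!: Nat.gr0I elim!: dvdE\<close>)
  have "sieve_sum f y = (\<Sum>d\<in>{d\<in>?S y. \<not> q dvd d} \<union> {d\<in>?S y. q dvd d}. t f y d)"
    unfolding sieve_sum_def t_def by (intro sum.cong) auto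
  also have "\<dots> = (\<Sum>d\<in>{d\<in>?S y. \<not> q dvd d}. t f y d) + (\<Sum>d\<in>{d\<in>?S y. q dvd d}. t f y d)"
    by (rule sum.union_disjoint) (auto intro: finite_subset[OF _ fin[of y]])
  also have "\<dots> = (\<Sum>d\<in>?S y. t ?f0 y d) + (\<Sum>e\<in>?S (y / real q). - (f q / real q) * t ?f0 (y / real q) e)"
  proof -
    have "(\<Sum>e\<in>?S (y / real q). t f y (q * e)) = (\<Sum>e\<in>?S (y / real q). - (f q / real q) * t ?f0 (y / real q) e)"
      by (rule sum.cong[OF refl], rule pt) simp
    thus ?thesis unfolding A B by (rule arg_cong)
  qed
  also have "\<dots> = sieve_sum ?f0 y - f q / real q * sieve_sum ?f0 (y / real q)"
    by (simp only: sieve_sum_def t_def sum_distrib_left[symmetric] minus_mult_left[symmetric] sum_negf diff_conv_add_uminus)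
  finally show ?thesis .
qed

text \<open>
  The factor \<open>4\<close> per prime comes from \<open>1 + 4 / sqrt q \<le> 4\<close>; this is why the error term is chosen to grow by at
  most \<open>sqrt q\<close> when \<open>y\<close> is replaced by \<open>y / q\<close>.
\<close>

lemma sieve_sum_zero_on:
  assumes base: "\<And>y. y > 0 \<Longrightarrow> \<bar>sieve_sum (\<lambda>_. 1) y - 1\<bar> \<le> \<eta> + sqrt (Y / y)"
    and \<eta>: "\<eta> \<ge> 0" and Y: "Y \<ge> 1" and P: "finite P" "\<And>p. p \<in> P \<Longrightarrow> prime p" and y: "y > 0"
  shows "\<bar>sieve_sum (\<lambda>p. if p \<in> P then 0 else 1) y - (\<Prod>p\<in>P. real p / (real p - 1))\<bar>
           \<le> 4 ^ card P * (\<eta> + sqrt (Y / y))"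
  using P y
proof (induction P arbitrary: y rule: finite_induct)
  case empty
  thus ?case using base by simp
next
  case (insert q P)
  define W where "W = (\<lambda>y. \<eta> + sqrt (Y / y))"
  define c where "c = (\<Prod>p\<in>P. real p / (real p - 1))"
  define c' where "c' = (\<Prod>p\<in>insert q P. real p / (real p - 1))"
  define F where "F = sieve_sum (\<lambda>p. if p \<in> P then 0 else 1)"
  define F' where "F' = sieve_sum (\<lambda>p. if p \<in> insert q P then 0 else 1)"
  have q: "prime q" "real q \<ge> 2" using insert.prems(1)[of q] prime_ge_2_nat[of q] by auto
  have c'c: "c' = c * (real q / (real q - 1))" using insert.hyps by (simp add: c_def c'_def mult.commute)
  hence cc: "c' = c + c' / real q" using q by (simp add: field_simps)
  have rec: "F y = F' y - 1 / real q * F' (y / real q)" for y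
  proof -
    have "(\<lambda>p. if p \<in> P then 0 else 1 :: real)(q := 0) = (\<lambda>p. if p \<in> insert q P then 0 else 1)" by auto
    thus ?thesis using sieve_sum_fun_upd[OF q(1), of "\<lambda>p. if p \<in> P then 0 else 1" y] insert.hyps
      by (simp add: F_def F'_def)
  qed
  have IH: "\<bar>F y - c\<bar> \<le> 4 ^ card P * W y" if "y > 0" for y
    unfolding F_def c_def W_def by (rule insert.IH) (use insert.prems that in auto)
  have c'b: "\<bar>c'\<bar> \<le> 2 ^ card (insert q P)"
  proof -
    have "\<bar>real p / (real p - 1)\<bar> \<le> 2" if "p \<in> insert q P" for p
      using insert.prems(1)[OF that] prime_ge_2_nat[of p] by (auto simp: field_simps)
    hence "(\<Prod>p\<in>insert q P. \<bar>real p / (real p - 1)\<bar>) \<le> (\<Prod>p\<in>insert q P. 2)"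
      by (intro prod_mono) auto
    thus ?thesis unfolding c'_def abs_prod by (simp only: prod_constant)
  qed
  have Wq: "1 / real q * W (y / real q) \<le> 3 / 4 * W y" if "y > 0" for y
  proof -
    have sq: "sqrt (real q) \<ge> 4 / 3"
      using q by (intro real_le_rsqrt) (simp add: power2_eq_square)
    have "1 * \<eta> \<le> sqrt (real q) * \<eta>" using \<eta> sq by (intro mult_right_mono) linarith+
    hence "W (y / real q) \<le> sqrt (real q) * W y"
      using that q by (simp add: W_def algebra_simps real_sqrt_mult[symmetric])
    hence "1 / real q * W (y / real q) \<le> 1 / real q * (sqrt (real q) * W y)"
      by (rule mult_left_mono) simp
    also have "\<dots> = W y / sqrt (real q)"
      using q real_sqrt_mult_self[of "real q"] by (simp add: field_simps)
    also have "\<dots> \<le> W y / (4 / 3)"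
      using sq \<eta> Y that q(2) by (intro divide_left_mono) (auto simp: W_def)
    finally show ?thesis by simp
  qed
  \<comment> \<open>The recursion reads F' y = F y + F' (y/q) / q, and c' is its fixed point: c' = c
    + c' / q. It is iterated by induction on an integer above y, since y / q <= y / 2. Below 1 the
    function F' vanishes and W >= 1 makes the claim trivial. The induction closes because 4^n +
    (3/4) 4^(n+1) = 4^(n+1).\<close>
  have main: "\<bar>F' y - c'\<bar> \<le> 4 ^ card (insert q P) * W y" if "y > 0" "y < real n" for n y
    using that
  proof (induction n arbitrary: y)
    case (Suc n)
    show ?case
    proof (cases "y < 1")
      case True
      have "W y \<ge> 1"
      proof -
        have "1 \<le> Y / y" using True Y Suc.prems by simp
        hence "1 \<le> sqrt (Y / y)" by simp
        thus ?thesis using \<eta> unfolding W_def by linarith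
      qed
      have "\<bar>F' y - c'\<bar> = \<bar>c'\<bar>" using True by (simp add: F'_def sieve_sum_less_1)
      also have "\<dots> \<le> 2 ^ card (insert q P)" by (rule c'b)
      also have "\<dots> \<le> 4 ^ card (insert q P) * 1" by (simp add: power_mono)
      also have "\<dots> \<le> 4 ^ card (insert q P) * W y"
        using \<open>W y \<ge> 1\<close> by (intro mult_left_mono) auto
      finally show ?thesis .
    next
      case False
      have "y / real q \<le> y / 2" using q Suc.prems by (intro divide_left_mono) auto
      also have "y / 2 < real n" using False Suc.prems by (cases n) auto
      finally have "\<bar>F' (y / real q) - c'\<bar> \<le> 4 ^ card (insert q P) * W (y / real q)"
        using q Suc.prems by (intro Suc.IH) auto
      hence "\<bar>1 / real q * (F' (y / real q) - c')\<bar> \<le> 1 / real q * (4 ^ card (insert q P) * W (y / real q))"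
        unfolding abs_mult by (intro mult_mono) auto
      also have "\<dots> = 4 ^ card (insert q P) * (1 / real q * W (y / real q))" by simp
      also have "\<dots> \<le> 4 ^ card (insert q P) * (3 / 4 * W y)"
        using Suc.prems by (intro mult_left_mono Wq) auto
      finally have 1: "\<bar>1 / real q * (F' (y / real q) - c')\<bar> \<le> 4 ^ card (insert q P) * (3 / 4 * W y)" .
      have eq: "F' y - c' = (F y - c) + 1 / real q * (F' (y / real q) - c')"
        using rec[of y] cc by (simp add: right_diff_distrib)
      have "\<bar>F' y - c'\<bar> \<le> 4 ^ card P * W y + 4 ^ card (insert q P) * (3 / 4 * W y)"
        unfolding eq using IH[OF Suc.prems(1)] 1 by linarith
      also have "\<dots> = 4 ^ card (insert q P) * W y" using insert.hyps by (simp add: field_simps)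
      finally show ?thesis .
    qed
  qed auto
  obtain n where "y < real n" using reals_Archimedean2 by blast
  from main[OF insert.prems(2) this] show ?case by (simp only: F'_def c'_def W_def)
qed

text \<open>For a prime q with local factor q the recursion is H y - H (y/q): the main terms cancel,
  so a single such prime makes the limit 0. The error at y / q multiplies Y by q, and adding two
  errors costs a factor 2 per prime.\<close>

lemma sieve_sum_bound:
  assumes base: "\<And>y. y > 0 \<Longrightarrow> \<bar>sieve_sum (\<lambda>_. 1) y - 1\<bar> \<le> \<eta> + sqrt (Y / y)"
    and \<eta>: "\<eta> \<ge> 0" and Y: "Y \<ge> 1" and P: "finite P" "\<And>p. p \<in> P \<Longrightarrow> prime p" and y: "y > 0"
    and Q: "Q \<subseteq> P"
  shows "\<bar>sieve_sum (\<lambda>p. if p \<in> Q then real p else if p \<in> P then 0 else 1) y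
            - (if Q = {} then \<Prod>p\<in>P. real p / (real p - 1) else 0)\<bar>
           \<le> 4 ^ card P * 2 ^ card Q * (\<eta> + sqrt (Y * real (\<Prod>Q) / y))"
proof -
  have "finite Q" using Q P(1) finite_subset by blast
  thus ?thesis using Q y
  proof (induction Q arbitrary: y rule: finite_induct)
    case empty
    thus ?case using sieve_sum_zero_on[OF base \<eta> Y P, of y] by simp
  next
    case (insert q Q)
    define H where "H = sieve_sum (\<lambda>p. if p \<in> Q then real p else if p \<in> P then 0 else 1)"
    define c where "c = (if Q = {} then \<Prod>p\<in>P. real p / (real p - 1) else 0)"
    define M where "M = 4 ^ card P * 2 ^ card Q * (\<eta> + sqrt (Y * real (\<Prod>(insert q Q)) / y))"
    have q: "prime q" "real q \<ge> 1" using insert.prems P(2)[of q] prime_ge_1_nat[of q] by auto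
    let ?f = "\<lambda>p. if p \<in> insert q Q then real p else if p \<in> P then 0 else 1"
    have "?f(q := 0) = (\<lambda>p. if p \<in> Q then real p else if p \<in> P then 0 else 1)"
      using insert by auto
    hence rec: "sieve_sum ?f y = H y - H (y / real q)"
      using sieve_sum_fun_upd[OF q(1), of ?f y] q by (simp add: H_def)
    have pr: "real (\<Prod>(insert q Q)) = real q * real (\<Prod>Q)" using insert by simp
    have "\<bar>H y - c\<bar> \<le> 4 ^ card P * 2 ^ card Q * (\<eta> + sqrt (Y * real (\<Prod>Q) / y))"
      unfolding H_def c_def by (rule insert.IH) (use insert.prems in auto)
    also have "\<dots> \<le> M"
      unfolding M_def pr
    proof (intro mult_left_mono add_left_mono real_sqrt_le_mono divide_right_mono)
      have "1 * real (\<Prod>Q) \<le> real q * real (\<Prod>Q)" using q by (intro mult_right_mono) (auto simp del: of_nat_prod)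
      thus "real (\<Prod>Q) \<le> real q * real (\<Prod>Q)" by simp
    qed (use Y insert.prems in auto)
    finally have 1: "\<bar>H y - c\<bar> \<le> M" .
    have "\<bar>H (y / real q) - c\<bar> \<le> 4 ^ card P * 2 ^ card Q * (\<eta> + sqrt (Y * real (\<Prod>Q) / (y / real q)))"
      unfolding H_def c_def by (rule insert.IH) (use insert.prems q in auto)
    also have "\<dots> = M" unfolding M_def pr by (simp add: mult_ac)
    finally have 2: "\<bar>H (y / real q) - c\<bar> \<le> M" .
    have "\<bar>sieve_sum ?f y\<bar> \<le> 2 * M" unfolding rec using 1 2 by linarith
    also have "\<dots> = 4 ^ card P * 2 ^ card (insert q Q) * (\<eta> + sqrt (Y * real (\<Prod>(insert q Q)) / y))"
      using insert.hyps by (simp add: M_def)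
    finally show ?case by simp
  qed
qed

text \<open>For y >= Y the asymptotics give the first term. For y < Y the square root exceeds the
  trivial bounds: C >= C0^2 serves 1 <= y < Y, and C >= 1 serves y < 1, where the sieve sum is 0.
  Keeping Y free lets it be chosen as a power of R.\<close>

lemma sieve_sum_1_uniform:
  assumes "primes_level_of_distribution \<theta>" "\<theta> > 0" and s: "s \<ge> 1"
  shows "\<exists>C\<ge>1. \<forall>Y\<ge>1. \<forall>y>0. \<bar>sieve_sum (\<lambda>_. 1) y - 1\<bar> \<le> C / lg Y ^ s + sqrt (C * Y / y)"
proof -
  obtain C0 where C0: "C0 \<ge> 0" "\<And>y. y \<ge> 1 \<Longrightarrow> \<bar>sieve_sum (\<lambda>_. 1) y - 1\<bar> \<le> C0 / lg y ^ s"
    using sieve_sum_1_asymptotics[OF assms] by blast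
  define C where "C = max 1 (C0\<^sup>2) + C0"
  have C: "C \<ge> 1" "C \<ge> C0" "C \<ge> C0\<^sup>2" using C0(1) by (auto simp: C_def)
  have "\<bar>sieve_sum (\<lambda>_. 1) y - 1\<bar> \<le> C / lg Y ^ s + sqrt (C * Y / y)" if Y: "Y \<ge> 1" and y: "y > 0" for Y y
  proof -
    have nn: "C / lg Y ^ s \<ge> 0" "sqrt (C * Y / y) \<ge> 0" using C lg_ge_1[OF Y] Y y by auto
    consider "y < 1" | "1 \<le> y" "y < Y" | "Y \<le> y" by linarith
    thus ?thesis
    proof cases
      case 1
      have "1 * 1 \<le> C * Y" using C Y by (intro mult_mono) auto
      hence "1 \<le> C * Y / y" using 1 y by simp
      hence "1 \<le> sqrt (C * Y / y)" by simp
      thus ?thesis using nn unfolding sieve_sum_less_1[OF 1] by linarith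
    next
      case 2
      have "\<bar>sieve_sum (\<lambda>_. 1) y - 1\<bar> \<le> C0 / lg y ^ s" using 2 by (intro C0) auto
      also have "\<dots> \<le> C0 / 1" using lg_ge_1[OF 2(1)] C0 by (intro divide_left_mono one_le_power) auto
      also have "\<dots> = sqrt (C0\<^sup>2 * 1)" using C0 by simp
      also have "\<dots> \<le> sqrt (C * (Y / y))" using C 2 y by (intro real_sqrt_le_mono mult_mono) auto
      finally show ?thesis using nn by simp
    next
      case 3
      have "\<bar>sieve_sum (\<lambda>_. 1) y - 1\<bar> \<le> C0 / lg y ^ s" using 3 Y by (intro C0) auto
      also have "\<dots> \<le> C / lg Y ^ s"
        using C0 C lg_ge_1[OF Y] lg_mono[of Y y] 3 Y by (intro frac_le power_mono) auto
      finally show ?thesis using nn(2) by linarith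
    qed
  qed
  with C show ?thesis by blast
qed

section \<open>Divisor sums\<close>

definition tau :: "nat \<Rightarrow> nat" where "tau n = card {d. d dvd n}"

lemma tau_mult_le:
  assumes "a > 0" "b > 0"
  shows "tau (a * b) \<le> tau a * tau b"
proof -
  have "{d. d dvd a * b} \<subseteq> (\<lambda>(x,y). x * y) ` ({d. d dvd a} \<times> {d. d dvd b})"
  proof
    fix d assume "d \<in> {d. d dvd a * b}"
    then obtain x y where "d = x * y" "x dvd a" "y dvd b" using division_decomp[of d a b] by auto
    thus "d \<in> (\<lambda>(x,y). x * y) ` ({d. d dvd a} \<times> {d. d dvd b})" by force
  qed
  hence "card {d. d dvd a * b} \<le> card ({d. d dvd a} \<times> {d. d dvd b})"
    using assms by (intro surj_card_le) auto
  thus ?thesis by (simp add: tau_def card_cartesian_product)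
qed

text \<open>One factor \<open>tau D\<close> counts the factorisations D = d * e, and
  submultiplicativity distributes the remaining power over d and e. The sum for m + 1 is thus at
  most the square of the sum for m, which doubles the exponent.\<close>

lemma sum_tau_power_over_le:
  assumes "x \<ge> 1"
  shows "(\<Sum>D=1..x. real (tau D) ^ m / real D) \<le> lg (real x) ^ (2 ^ m)"
  using assms
proof (induction m arbitrary: x)
  case 0
  thus ?case using sum_inverse_le_lg[of x] by simp
next
  case (Suc m)
  let ?S = "\<lambda>x. \<Sum>D=1..x. real (tau D) ^ m / real D"
  have S0: "?S x \<ge> 0" for x by (intro sum_nonneg) auto
  have "(\<Sum>D=1..x. real (tau D) ^ Suc m / real D) = (\<Sum>D=1..x. \<Sum>d | d dvd D. real (tau (d * (D div d))) ^ m / real (d * (D div d)))"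
    by (intro sum.cong refl) (simp add: tau_def)
  also have "\<dots> = (\<Sum>d=1..x. \<Sum>e=1..x div d. real (tau (d * e)) ^ m / real (d * e))"
    by (rule sum_hyperbola[symmetric])
  also have "\<dots> \<le> (\<Sum>d=1..x. \<Sum>e=1..x div d. real (tau d) ^ m / real d * (real (tau e) ^ m / real e))"
  proof (intro sum_mono)
    fix d e assume "d \<in> {1..x}" "e \<in> {1..x div d}"
    hence "real (tau (d * e)) \<le> real (tau d * tau e)" by (intro of_nat_mono tau_mult_le) auto
    hence "real (tau (d * e)) ^ m \<le> real (tau d * tau e) ^ m" by (intro power_mono) auto
    hence "real (tau (d * e)) ^ m / real (d * e) \<le> real (tau d * tau e) ^ m / real (d * e)"
      by (intro divide_right_mono) auto
    also have "\<dots> = real (tau d) ^ m / real d * (real (tau e) ^ m / real e)"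
      by (simp add: power_mult_distrib)
    finally show "real (tau (d * e)) ^ m / real (d * e) \<le> real (tau d) ^ m / real d * (real (tau e) ^ m / real e)" .
  qed
  also have "\<dots> = (\<Sum>d=1..x. real (tau d) ^ m / real d * ?S (x div d))"
    by (simp only: sum_distrib_left)
  also have "\<dots> \<le> (\<Sum>d=1..x. real (tau d) ^ m / real d * ?S x)"
    by (intro sum_mono mult_left_mono sum_mono2) auto
  also have "\<dots> = ?S x * ?S x" by (simp only: sum_distrib_right)
  also have "\<dots> \<le> lg (real x) ^ (2 ^ m) * lg (real x) ^ (2 ^ m)"
    using S0[of x] Suc.IH[OF Suc.prems] by (intro mult_mono) (auto intro: order_trans)
  also have "\<dots> = lg (real x) ^ (2 ^ Suc m)" by (simp add: power_add[symmetric] mult_2)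
  finally show ?case .
qed

lemma prod_primes_dvd:
  fixes x :: nat
  assumes "finite S" "\<And>p. p \<in> S \<Longrightarrow> prime p \<and> p dvd x"
  shows "\<Prod>S dvd x"
  using assms
proof (induction S rule: finite_induct)
  case (insert q S)
  have "\<not> q dvd \<Prod>S"
  proof
    assume "q dvd \<Prod>S"
    then obtain p where p: "p \<in> S" "q dvd p" using insert by (auto simp: prime_dvd_prod_iff)
    hence "q = p" using insert.prems by (intro primes_dvd_imp_eq) auto
    thus False using p insert.hyps by simp
  qed
  hence "coprime q (\<Prod>S)" using insert by (intro prime_imp_coprime) auto
  thus ?case using insert by (auto intro!: divides_mult)
qed auto

lemma prod_prime_factors_squarefree:
  assumes "squarefree (n::nat)"
  shows "\<Prod>(prime_factors n) = n"
proof -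
  have n: "n > 0" using assms by (auto intro: Nat.gr0I)
  have "n = (\<Prod>p\<in>prime_factors n. p ^ multiplicity p n)"
    using n by (rule prime_factorization_nat)
  also have "\<dots> = (\<Prod>p\<in>prime_factors n. p)"
    using assms n squarefree_factorial_semiring'[of n] by (intro prod.cong) auto
  finally show ?thesis by simp
qed

text \<open>Products over different sets of primes of n are different divisors of n.\<close>

lemma two_power_card_prime_factors_le_tau:
  assumes n: "n > 0"
  shows "2 ^ card (prime_factors n) \<le> tau n"
proof -
  have "card (Pow (prime_factors n)) \<le> card {d. d dvd n}"
  proof (rule card_inj_on_le[where f = "\<lambda>S. \<Prod>S"])
    show "inj_on (\<lambda>S. \<Prod>S) (Pow (prime_factors n))"
    proof (rule inj_onI)
      fix S T assume ST: "S \<in> Pow (prime_factors n)" "T \<in> Pow (prime_factors n)" "\<Prod>S = \<Prod>T"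
      have mem: "p \<in> S \<longleftrightarrow> prime p \<and> p dvd \<Prod>S" if "S \<subseteq> prime_factors n" for S p
      proof -
        have "finite S" using that by (rule finite_subset) simp
        have pr: "prime q" if "q \<in> S" for q using that \<open>S \<subseteq> prime_factors n\<close> by (auto simp: in_prime_factors_iff)
        show ?thesis
        proof
          assume "p \<in> S"
          thus "prime p \<and> p dvd \<Prod>S" using pr \<open>finite S\<close> by (auto intro: dvd_prodI)
        next
          assume p: "prime p \<and> p dvd \<Prod>S"
          then obtain q where "q \<in> S" "p dvd q" using \<open>finite S\<close> by (auto simp: prime_dvd_prod_iff)
          thus "p \<in> S" using p pr primes_dvd_imp_eq by blast
        qed
      qed
      have sub: "S \<subseteq> prime_factors n" "T \<subseteq> prime_factors n" using ST by auto
      show "S = T"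
        by (intro equalityI subsetI) (simp_all only: mem[OF sub(1)] mem[OF sub(2)] ST(3))
    qed
    show "(\<lambda>S. \<Prod>S) ` Pow (prime_factors n) \<subseteq> {d. d dvd n}"
    proof safe
      fix S assume S: "S \<subseteq> prime_factors n"
      hence "finite S" by (rule finite_subset) simp
      thus "\<Prod>S dvd n" using S by (intro prod_primes_dvd) (auto simp: in_prime_factors_iff)
    qed
  qed (use n in auto)
  thus ?thesis by (simp add: card_Pow tau_def)
qed

text \<open>The product of the primes of n is at least 2^(their number) and at most n. The factor 2
  comes from ln 2 >= 1/2, which is \<open>ln_Suc_div_ge_inverse\<close> at 1.\<close>

lemma card_prime_factors_le_ln:
  assumes n: "n \<ge> 1"
  shows "real (card (prime_factors n)) \<le> 2 * ln (real n)"
proof -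
  have "(2::nat) ^ card (prime_factors n) = (\<Prod>p\<in>prime_factors n. 2)" by simp
  also have "\<dots> \<le> \<Prod>(prime_factors n)"
    by (intro prod_mono) (auto simp: in_prime_factors_iff prime_ge_2_nat)
  also have "\<dots> \<le> n"
    using n by (intro dvd_imp_le prod_primes_dvd) (auto simp: in_prime_factors_iff)
  finally have "real (2 ^ card (prime_factors n)) \<le> real n" by (rule of_nat_mono)
  hence "ln (2 ^ card (prime_factors n)) \<le> ln (real n)" using n by simp
  hence "real (card (prime_factors n)) * ln 2 \<le> ln (real n)" by (simp add: ln_realpow)
  moreover have "real (card (prime_factors n)) * (1/2) \<le> real (card (prime_factors n)) * ln 2"
    using ln_Suc_div_ge_inverse[of 1] by (intro mult_left_mono) auto
  ultimately show ?thesis by linarith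
qed

section \<open>Sums over a progression\<close>

lemma card_progression_atMost:
  fixes c q B :: nat
  assumes q: "q \<ge> 1"
  shows "\<exists>c0\<in>{1..q}. \<forall>B. card {m\<in>{1..B}. [m = c] (mod q)} = (B + q - c0) div q"
proof -
  \<comment> \<open>Counting starts at 1, so the class of 0 is represented by q; c0 <= q keeps the
    subtraction in B + q - c0 exact.\<close>
  define c0 where "c0 = (if c mod q = 0 then q else c mod q)"
  have c0: "1 \<le> c0" "c0 \<le> q" using q by (auto simp: c0_def Suc_le_eq intro: less_imp_le)
  have "c0 mod q = c mod q" by (simp add: c0_def)
  hence cc: "[c0 = c] (mod q)" by (simp only: Cong.cong_def)
  have "card {m\<in>{1..B}. [m = c] (mod q)} = (B + q - c0) div q" for B
  proof -
    have "bij_betw (\<lambda>k. c0 + k * q) {..<(B + q - c0) div q} {m\<in>{1..B}. [m = c] (mod q)}"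
    proof (rule bij_betwI[where g = "\<lambda>m. (m - c0) div q"])
      show "(\<lambda>k. c0 + k * q) \<in> {..<(B + q - c0) div q} \<rightarrow> {m\<in>{1..B}. [m = c] (mod q)}"
      proof
        fix k assume "k \<in> {..<(B + q - c0) div q}"
        hence "Suc k \<le> (B + q - c0) div q" by simp
        hence "Suc k * q \<le> B + q - c0" using q by (simp add: less_eq_div_iff_mult_less_eq)
        hence "c0 + k * q \<le> B" using c0 by simp
        moreover have "[c0 + k * q = c] (mod q)" using cc by (simp add: Cong.cong_def)
        ultimately show "c0 + k * q \<in> {m\<in>{1..B}. [m = c] (mod q)}" using c0 by auto
      qed
      have rep: "c0 \<le> m \<and> q dvd m - c0" if "1 \<le> m" "[m = c] (mod q)" for m
      proof -
        have m: "[m = c0] (mod q)" using that cc by (meson cong_sym cong_trans)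
        have "c0 \<le> m"
        proof (rule ccontr)
          assume "\<not> c0 \<le> m"
          hence "q dvd c0 - m" using m by (simp add: cong_altdef_nat cong_sym_eq)
          moreover have "c0 - m > 0" "c0 - m < q" using \<open>\<not> c0 \<le> m\<close> that c0 by auto
          ultimately show False by (auto dest: dvd_imp_le)
        qed
        thus ?thesis using m by (simp add: cong_altdef_nat)
      qed
      show "(\<lambda>m. (m - c0) div q) \<in> {m\<in>{1..B}. [m = c] (mod q)} \<rightarrow> {..<(B + q - c0) div q}"
      proof
        fix m assume "m \<in> {m\<in>{1..B}. [m = c] (mod q)}"
        hence m: "1 \<le> m" "m \<le> B" "[m = c] (mod q)" by auto
        have "(m - c0) div q + 1 = (m - c0 + q) div q" using q by simp
        also have "\<dots> \<le> (B + q - c0) div q"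
          using m rep[OF m(1,3)] by (intro div_le_mono) auto
        finally show "(m - c0) div q \<in> {..<(B + q - c0) div q}" by simp
      qed
      show "c0 + (m - c0) div q * q = m" if "m \<in> {m\<in>{1..B}. [m = c] (mod q)}" for m
        using rep[of m] that by auto
    qed (use q in auto)
    from bij_betw_same_card[OF this] show ?thesis by simp
  qed
  with c0 show ?thesis by auto
qed

text \<open>The two counts up to A and B are floors with the same shift c0. Their rounding errors
  lie in [0, 1), so the difference is off by at most 1.\<close>

lemma card_progression:
  fixes c q A B :: nat
  assumes q: "q \<ge> 1" and AB: "A \<le> B"
  shows "\<bar>real (card {m\<in>{A<..B}. [m = c] (mod q)}) - (real B - real A) / real q\<bar> \<le> 1"
proof -
  obtain c0 where c0: "c0 \<in> {1..q}" "\<And>B. card {m\<in>{1..B}. [m = c] (mod q)} = (B + q - c0) div q"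
    using card_progression_atMost[OF q, of c] by blast
  have "{m\<in>{1..B}. [m = c] (mod q)} = {m\<in>{1..A}. [m = c] (mod q)} \<union> {m\<in>{A<..B}. [m = c] (mod q)}"
    using AB by auto
  hence "card {m\<in>{1..B}. [m = c] (mod q)} = card {m\<in>{1..A}. [m = c] (mod q)} + card {m\<in>{A<..B}. [m = c] (mod q)}"
    by (simp only:) (rule card_Un_disjoint, auto)
  hence eq: "real (card {m\<in>{A<..B}. [m = c] (mod q)}) = real ((B + q - c0) div q) - real ((A + q - c0) div q)"
    unfolding c0(2) by simp
  have fl: "real ((X + q - c0) div q) \<le> (real X + real q - real c0) / real q"
      "(real X + real q - real c0) / real q < real ((X + q - c0) div q) + 1" for X
    using floor_correct[of "real (X + q - c0) / real q"] c0(1)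
    by (simp_all add: floor_divide_of_nat_eq of_nat_diff)
  show ?thesis unfolding eq using fl[of A] fl[of B] by (simp add: diff_divide_distrib add_divide_distrib abs_le_iff)
qed

lemma progression_and_multiple:
  fixes c d D :: nat
  assumes "gcd d D dvd c"
  shows "\<exists>c'. \<forall>m. ([m = c] (mod D) \<and> d dvd m) \<longleftrightarrow> [m = c'] (mod lcm d D)"
proof -
  obtain x where x: "[d * x = c] (mod D)" using cong_solve_dvd_nat[OF assms] by blast
  have "([m = c] (mod D) \<and> d dvd m) \<longleftrightarrow> [m = d * x] (mod lcm d D)" for m
  proof
    assume m: "[m = c] (mod D) \<and> d dvd m"
    have "m mod d = (d * x) mod d" using m by simp
    hence "[m = d * x] (mod d)" by (simp only: Cong.cong_def)
    moreover have "[m = d * x] (mod D)" using m x by (meson cong_sym cong_trans)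
    ultimately show "[m = d * x] (mod lcm d D)" by (rule cong_cong_lcm_nat)
  next
    assume m: "[m = d * x] (mod lcm d D)"
    have "[m = d * x] (mod D)" "[m = d * x] (mod d)"
      using m by (auto intro: cong_dvd_modulus_nat)
    thus "[m = c] (mod D) \<and> d dvd m"
      using x by (auto intro: cong_trans simp: cong_dvd_iff)
  qed
  thus ?thesis by blast
qed

lemma no_common_multiple_in_progression:
  fixes c d D m :: nat
  assumes "\<not> gcd d D dvd c" "[m = c] (mod D)"
  shows "\<not> d dvd m"
proof
  assume "d dvd m"
  hence "gcd d D dvd m" by (meson gcd_dvd1 dvd_trans)
  moreover have "[m = c] (mod gcd d D)" using assms(2) by (rule cong_dvd_modulus_nat) simp
  ultimately show False using assms(1) by (simp add: cong_dvd_iff)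
qed

section \<open>\<open>Lambda_R\<close> over a progression\<close>

text \<open>For squarefree d, the product of these values over the primes of d, divided by d, is the
  proportion of multiples of d within the class of c modulo D.\<close>

definition local_density :: "nat \<Rightarrow> nat \<Rightarrow> nat \<Rightarrow> real" where
  "local_density D c p = (if p dvd D then if p dvd c then real p else 0 else 1)"

text \<open>Primes of d outside D contribute 1, so only the primes of the squarefree number gcd d D
  count; one of them not dividing c makes the product 0.\<close>

lemma prod_local_density:
  assumes d: "squarefree d" and D: "D > 0"
  shows "(\<Prod>p\<in>prime_factors d. local_density D c p) = (if gcd d D dvd c then real (gcd d D) else 0)"
proof -
  define g where "g = gcd d D"
  have d0: "d > 0" using d by (auto intro: Nat.gr0I)
  have g: "squarefree g" using d unfolding g_def by (rule squarefree_mono[rotated]) simp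
  have pf: "prime_factors g = {p\<in>prime_factors d. p dvd D}"
    using d0 D by (auto simp: g_def in_prime_factors_iff intro: dvd_trans)
  have gprod: "\<Prod>(prime_factors g) = g" by (rule prod_prime_factors_squarefree[OF g])
  show ?thesis
  proof (cases "g dvd c")
    case True
    have "(\<Prod>p\<in>prime_factors d. local_density D c p) = (\<Prod>p\<in>prime_factors g. real p)"
      unfolding pf
      by (rule prod.mono_neutral_cong_right)
         (use True pf in \<open>auto simp: local_density_def in_prime_factors_iff intro: dvd_trans\<close>)
    also have "\<dots> = real g" unfolding of_nat_prod[symmetric] gprod ..
    finally show ?thesis using True by (simp add: g_def)
  next
    case False
    have "\<exists>p\<in>prime_factors g. \<not> p dvd c"
    proof (rule ccontr)
      assume "\<not> ?thesis"
      hence "\<Prod>(prime_factors g) dvd c" by (intro prod_primes_dvd) (auto simp: in_prime_factors_iff)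
      with False show False by (simp only: gprod)
    qed
    then obtain p where "p \<in> prime_factors d" "p dvd D" "\<not> p dvd c" unfolding pf by auto
    hence "(\<Prod>p\<in>prime_factors d. local_density D c p) = 0"
      by (auto simp: local_density_def intro!: prod_zero)
    thus ?thesis using False by (simp add: g_def)
  qed
qed

lemma Lambda_R_of_pos:
  assumes "m \<ge> 1"
  shows "Lambda_R R (int m) = (\<Sum>d | 1 \<le> d \<and> real d \<le> R. if d dvd m then moebius_mu d * ln (R / real d) else 0)"
proof -
  have "Lambda_R R (int m) = (\<Sum>d | d dvd m \<and> real d \<le> R. moebius_mu d * ln (R / real d))"
    using assms by (simp add: Lambda_R_def)
  also have "\<dots> = (\<Sum>d | 1 \<le> d \<and> real d \<le> R. if d dvd m then moebius_mu d * ln (R / real d) else 0)"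
    using assms by (intro sum.mono_neutral_cong_left) (auto intro: Suc_leI dvd_pos_nat)
  finally show ?thesis .
qed

text \<open>For each d, the multiples of d in the class form a class modulo lcm d D or do not exist;
  d * D = gcd * lcm turns the count into the local density. Rounding costs at most ln R for each of
  the at most R values of d.\<close>

lemma sum_Lambda_R_progression:
  assumes D: "D \<ge> 1" and AB: "A \<le> B" and R: "R \<ge> 1"
  shows "\<bar>(\<Sum>m\<in>{m\<in>{A<..B}. [m = c] (mod D)}. Lambda_R R (int m))
           - (real B - real A) / real D * sieve_sum (local_density D c) R\<bar> \<le> R * ln R"
proof -
  let ?I = "{m\<in>{A<..B}. [m = c] (mod D)}"
  let ?S = "{d. 1 \<le> d \<and> real d \<le> R}"
  let ?P = "\<lambda>d. \<Prod>p\<in>prime_factors d. local_density D c p"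
  have "(\<Sum>m\<in>?I. Lambda_R R (int m)) = (\<Sum>m\<in>?I. \<Sum>d\<in>?S. if d dvd m then moebius_mu d * ln (R / real d) else 0)"
    by (intro sum.cong refl Lambda_R_of_pos) auto
  also have "\<dots> = (\<Sum>d\<in>?S. \<Sum>m\<in>?I. if d dvd m then moebius_mu d * ln (R / real d) else 0)"
    by (rule sum.swap)
  also have "\<dots> = (\<Sum>d\<in>?S. moebius_mu d * ln (R / real d) * real (card {m\<in>?I. d dvd m}))"
    by (intro sum.cong refl) (simp add: sum.If_cases Int_def mult.commute)
  finally have 1: "(\<Sum>m\<in>?I. Lambda_R R (int m)) = (\<Sum>d\<in>?S. moebius_mu d * ln (R / real d) * real (card {m\<in>?I. d dvd m}))" .
  have 2: "(real B - real A) / real D * sieve_sum (local_density D c) R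
      = (\<Sum>d\<in>?S. moebius_mu d * ln (R / real d) * ((real B - real A) * ?P d / (real d * real D)))"
    unfolding sieve_sum_def sum_distrib_left by (intro sum.cong refl) (simp add: mult_ac)
  have tm: "\<bar>moebius_mu d * ln (R / real d) * (real (card {m\<in>?I. d dvd m}) - (real B - real A) * ?P d / (real d * real D))\<bar> \<le> ln R"
    if d: "d \<in> ?S" for d
  proof (cases "squarefree d")
    case False
    thus ?thesis using R by (simp add: moebius_mu_not_squarefree)
  next
    case True
    have P: "?P d = (if gcd d D dvd c then real (gcd d D) else 0)"
      by (rule prod_local_density[OF True]) (use D in simp)
    have "\<bar>real (card {m\<in>?I. d dvd m}) - (real B - real A) * ?P d / (real d * real D)\<bar> \<le> 1"
    proof (cases "gcd d D dvd c")
      case True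
      from progression_and_multiple[OF True]
      obtain c' where c': "\<forall>m. ([m = c] (mod D) \<and> d dvd m) \<longleftrightarrow> [m = c'] (mod lcm d D)" by (rule exE)
      have "{m\<in>?I. d dvd m} = {m\<in>{A<..B}. [m = c] (mod D) \<and> d dvd m}" by auto
      hence "{m\<in>?I. d dvd m} = {m\<in>{A<..B}. [m = c'] (mod lcm d D)}" by (simp only: c'[rule_format])
      moreover have "(real B - real A) * ?P d / (real d * real D) = (real B - real A) / real (lcm d D)"
      proof -
        have "real d * real D = real (gcd d D) * real (lcm d D)"
          by (simp only: of_nat_mult[symmetric] prod_gcd_lcm_nat[symmetric])
        moreover have "gcd d D > 0" using D by simp
        ultimately show ?thesis unfolding P using True by simp
      qed
      moreover have "lcm d D \<ge> 1" using d D by (simp add: Suc_le_eq lcm_pos_nat)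
      ultimately show ?thesis using card_progression[OF _ AB] by simp
    next
      case False
      hence "{m\<in>?I. d dvd m} = {}" using no_common_multiple_in_progression[OF False] by auto
      hence c0: "card {m\<in>?I. d dvd m} = 0" by (simp only: card.empty)
      show ?thesis unfolding c0 P using False by simp
    qed
    moreover have "\<bar>moebius_mu d * ln (R / real d)\<bar> \<le> ln R"
    proof -
      have "\<bar>ln (R / real d)\<bar> \<le> ln R" using d R by (simp add: ln_div)
      hence "\<bar>moebius_mu d\<bar> * \<bar>ln (R / real d)\<bar> \<le> 1 * ln R"
        by (intro mult_mono abs_moebius_mu_le) auto
      thus ?thesis by (simp add: abs_mult)
    qed
    ultimately have "\<bar>moebius_mu d * ln (R / real d)\<bar> * \<bar>real (card {m\<in>?I. d dvd m}) - (real B - real A) * ?P d / (real d * real D)\<bar> \<le> ln R * 1"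
      using R by (intro mult_mono) auto
    thus ?thesis by (simp add: abs_mult)
  qed
  have "\<bar>(\<Sum>m\<in>?I. Lambda_R R (int m)) - (real B - real A) / real D * sieve_sum (local_density D c) R\<bar>
    = \<bar>\<Sum>d\<in>?S. moebius_mu d * ln (R / real d) * (real (card {m\<in>?I. d dvd m}) - (real B - real A) * ?P d / (real d * real D))\<bar>"
    unfolding 1 2 sum_subtractf[symmetric] right_diff_distrib ..
  also have "\<dots> \<le> (\<Sum>d\<in>?S. ln R)"
    by (rule order_trans[OF sum_abs sum_mono]) (rule tm)
  also have "\<dots> = real (nat \<lfloor>R\<rfloor>) * ln R" by (simp only: nat_real_le_set) simp
  also have "\<dots> \<le> R * ln R" using R by (intro mult_right_mono) auto
  finally show ?thesis .
qed

section \<open>The von Mangoldt function over a progression\<close>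

definition max_error :: "nat \<Rightarrow> nat \<Rightarrow> real" where
  "max_error N q = Max ((\<lambda>a. \<bar>E_ap (real N) q a\<bar>) ` totatives q)"

lemma psi_ap_nat: "psi_ap (real N) q a = (\<Sum>m\<in>{m\<in>{1..N}. [m = a] (mod q)}. mangoldt m)"
proof -
  have "{n. 1 \<le> n \<and> real n \<le> real N \<and> [n = a] (mod q)} = {m\<in>{1..N}. [m = a] (mod q)}" by auto
  thus ?thesis by (simp only: psi_ap_def)
qed

lemma max_error_nonneg:
  assumes "q \<ge> 1" shows "max_error N q \<ge> 0"
proof -
  have "1 \<in> totatives q" using assms by (auto simp: totatives_def)
  hence "\<bar>E_ap (real N) q 1\<bar> \<le> max_error N q" unfolding max_error_def by (intro Max_ge) auto
  thus ?thesis by linarith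
qed

lemma psi_ap_coprime:
  assumes "q \<ge> 1" "coprime c q"
  shows "\<bar>psi_ap (real N) q c - real N / real (totient q)\<bar> \<le> max_error N q"
proof -
  obtain a where a: "a \<in> totatives q" "[a = c] (mod q)"
  \<comment> \<open>For q = 1 the remainder c mod q is 0, which does not lie in
    \<open>totatives 1\<close>; the representative there is 1.\<close>
  proof (cases "q = 1")
    case True
    show ?thesis by (rule that[of 1]) (auto simp: True Cong.cong_def)
  next
    case False
    have "c mod q \<in> totatives q"
      using assms False by (auto simp: totatives_def intro!: Nat.gr0I)
    moreover have "[c mod q = c] (mod q)" by simp
    ultimately show ?thesis by (rule that)
  qed
  have "{m\<in>{1..N}. [m = a] (mod q)} = {m\<in>{1..N}. [m = c] (mod q)}"
    using a(2) by (meson cong_sym cong_trans)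
  hence "psi_ap (real N) q c = psi_ap (real N) q a" by (simp only: psi_ap_nat)
  moreover have "coprime a q" using a(1) by (auto simp: totatives_def)
  ultimately have "psi_ap (real N) q c - real N / real (totient q) = E_ap (real N) q a"
    by (simp add: E_ap_def)
  thus ?thesis using a(1) unfolding max_error_def by (auto intro!: Max_ge)
qed

text \<open>Every member of the class shares a factor with q, so only powers of primes dividing q
  contribute: at most 2 ln q primes, at most 2 ln N exponents, and ln N for each term.\<close>

lemma psi_ap_not_coprime:
  assumes q: "q \<ge> 1" and c: "\<not> coprime c q" and N: "N \<ge> 1"
  shows "psi_ap (real N) q c \<le> 4 * ln (real q) * ln (real N) ^ 2"
proof -
  define K where "K = nat \<lfloor>2 * ln (real N)\<rfloor>"
  let ?S = "{m\<in>{1..N}. [m = c] (mod q)}"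
  let ?T = "{m\<in>?S. mangoldt m \<noteq> (0::real)}"
  have lnN: "ln (real N) \<ge> 0" using N by simp
  have sub: "?T \<subseteq> (\<lambda>(p,k). p ^ k) ` (prime_factors q \<times> {1..K})"
  proof
    fix m assume m: "m \<in> ?T"
    hence "primepow m" by (auto simp: mangoldt_def split: if_splits)
    then obtain p k where pk: "prime p" "k > 0" "m = p ^ k" unfolding primepow_def by blast
    have "\<not> coprime m q" using m c cong_imp_coprime[of c m q] cong_imp_coprime[of m c q] by blast
    hence "\<not> coprime p q" using pk by auto
    hence "p dvd q" using pk(1) prime_imp_coprime by blast
    hence p: "p \<in> prime_factors q" using pk q by (auto simp: in_prime_factors_iff)
    have "(2::nat) ^ k \<le> p ^ k" using pk prime_ge_2_nat by (intro power_mono) auto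
    also have "\<dots> \<le> N" using m pk by auto
    finally have "real (2 ^ k) \<le> real N" by (rule of_nat_mono)
    hence "ln (2 ^ k) \<le> ln (real N)" using N by simp
    hence "real k * ln 2 \<le> ln (real N)" by (simp add: ln_realpow)
    moreover have "real k * (1/2) \<le> real k * ln 2"
      using ln_Suc_div_ge_inverse[of 1] by (intro mult_left_mono) auto
    ultimately have "k \<le> K" by (simp add: K_def le_nat_floor)
    thus "m \<in> (\<lambda>(p,k). p ^ k) ` (prime_factors q \<times> {1..K})" using p pk by force
  qed
  have "psi_ap (real N) q c = (\<Sum>m\<in>?T. mangoldt m)"
    unfolding psi_ap_nat by (rule sum.mono_neutral_right) auto
  also have "\<dots> \<le> (\<Sum>m\<in>?T. ln (real N))"
  proof (rule sum_mono)
    fix m assume "m \<in> ?T"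
    hence m: "1 \<le> m" "m \<le> N" by auto
    have "mangoldt m \<le> ln (real m)" using m by (intro mangoldt_le) auto
    also have "\<dots> \<le> ln (real N)" using m by simp
    finally show "mangoldt m \<le> ln (real N)" .
  qed
  also have "\<dots> = real (card ?T) * ln (real N)" by simp
  also have "\<dots> \<le> (real (card (prime_factors q)) * real K) * ln (real N)"
  proof (intro mult_right_mono lnN)
    have "card ?T \<le> card (prime_factors q \<times> {1..K})"
      by (rule surj_card_le[OF _ sub]) auto
    also have "\<dots> = card (prime_factors q) * K" by (simp add: card_cartesian_product)
    finally have "real (card ?T) \<le> real (card (prime_factors q) * K)" by (rule of_nat_mono)
    thus "real (card ?T) \<le> real (card (prime_factors q)) * real K" by (simp only: of_nat_mult)
  qed
  also have "\<dots> \<le> (2 * ln (real q) * (2 * ln (real N))) * ln (real N)"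
    using q lnN by (intro mult_right_mono mult_mono card_prime_factors_le_ln) (auto simp: K_def)
  also have "\<dots> = 4 * ln (real q) * ln (real N) ^ 2" by (simp add: power2_eq_square)
  finally show ?thesis .
qed

text \<open>The interval (A, B] differs from [1, N] in at most 4 n0 integers, 3 n0 lost and n0
  gained, all of them at most 2 N.\<close>

lemma sum_mangoldt_progression:
  assumes N: "n0 \<le> N" "N \<ge> 1" and A: "A \<le> 2 * n0" and B: "B \<le> N + n0" "N \<le> B + n0"
  shows "\<bar>(\<Sum>m\<in>{m\<in>{A<..B}. [m = c] (mod q)}. mangoldt m) - psi_ap (real N) q c\<bar> \<le> 4 * real n0 * ln (2 * real N)"
proof -
  let ?S = "{m\<in>{A<..B}. [m = c] (mod q)}" and ?T = "{m\<in>{1..N}. [m = c] (mod q)}"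
  have bd: "0 \<le> (\<Sum>m\<in>X. mangoldt m :: real) \<and> (\<Sum>m\<in>X. mangoldt m) \<le> real k * ln (2 * real N)"
    if "finite X" "X \<subseteq> {1..2*N}" "card X \<le> k" for X k
  proof
    show "0 \<le> (\<Sum>m\<in>X. mangoldt m :: real)" by (intro sum_nonneg mangoldt_nonneg)
    have "(\<Sum>m\<in>X. mangoldt m :: real) \<le> (\<Sum>m\<in>X. ln (2 * real N))"
    proof (rule sum_mono)
      fix m assume "m \<in> X"
      hence m: "1 \<le> m" "m \<le> 2 * N" using that by auto
      have "mangoldt m \<le> ln (real m)" using m by (intro mangoldt_le) auto
      also have "\<dots> \<le> ln (real (2 * N))" using m by (intro ln_mono) (auto simp del: of_nat_mult)
      finally show "mangoldt m \<le> ln (2 * real N)" by simp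
    qed
    also have "\<dots> = real (card X) * ln (2 * real N)" by simp
    also have "\<dots> \<le> real k * ln (2 * real N)"
      using that N by (intro mult_right_mono) auto
    finally show "(\<Sum>m\<in>X. mangoldt m :: real) \<le> real k * ln (2 * real N)" .
  qed
  have c1: "card (?S - ?T) \<le> n0"
  proof -
    have "?S - ?T \<subseteq> {N<..B}" by auto
    hence "card (?S - ?T) \<le> card {N<..B}" by (intro card_mono) auto
    thus ?thesis using B by simp
  qed
  have c2: "card (?T - ?S) \<le> 3 * n0"
  proof -
    have "?T - ?S \<subseteq> {1..A} \<union> {B<..N}" by auto
    hence "card (?T - ?S) \<le> card ({1..A} \<union> {B<..N})" by (intro card_mono) auto
    also have "\<dots> \<le> card {1..A} + card {B<..N}" by (rule card_Un_le)
    finally show ?thesis using A B by simp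
  qed
  have "(\<Sum>m\<in>?S. mangoldt m) - (\<Sum>m\<in>?T. mangoldt m :: real) = (\<Sum>m\<in>?S-?T. mangoldt m) - (\<Sum>m\<in>?T-?S. mangoldt m)"
  proof -
    have "(\<Sum>m\<in>?S. mangoldt m :: real) = (\<Sum>m\<in>?S-?T. mangoldt m) + (\<Sum>m\<in>?S\<inter>?T. mangoldt m)"
      by (subst sum.union_disjoint[symmetric]) (auto intro: sum.cong)
    moreover have "(\<Sum>m\<in>?T. mangoldt m :: real) = (\<Sum>m\<in>?T-?S. mangoldt m) + (\<Sum>m\<in>?S\<inter>?T. mangoldt m)"
      by (subst sum.union_disjoint[symmetric]) (auto intro: sum.cong)
    ultimately show ?thesis by simp
  qed
  moreover have "0 \<le> (\<Sum>m\<in>?S-?T. mangoldt m :: real) \<and> (\<Sum>m\<in>?S-?T. mangoldt m) \<le> real n0 * ln (2 * real N)"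
    by (rule bd[OF _ _ c1]) (use B N in auto)
  moreover have "0 \<le> (\<Sum>m\<in>?T-?S. mangoldt m :: real) \<and> (\<Sum>m\<in>?T-?S. mangoldt m) \<le> real (3 * n0) * ln (2 * real N)"
    by (rule bd[OF _ _ c2]) (use B N in auto)
  moreover have "real (3 * n0) * ln (2 * real N) + real n0 * ln (2 * real N) = 4 * real n0 * ln (2 * real N)"
    by (simp add: algebra_simps)
  moreover have "real n0 * ln (2 * real N) \<ge> 0" "real (3 * n0) * ln (2 * real N) \<ge> 0" using N by auto
  ultimately show ?thesis unfolding psi_ap_nat by linarith
qed

lemma prod_prime_factors_eq_totient_quotient:
  assumes "D \<ge> 1"
  shows "(\<Prod>p\<in>prime_factors D. real p / (real p - 1)) = real D / real (totient D)"
proof -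
  have "real (totient D) = real D * (\<Prod>p\<in>prime_factors D. 1 - 1 / real p)" by (rule totient_formula2)
  also have "(\<Prod>p\<in>prime_factors D. 1 - 1 / real p) = (\<Prod>p\<in>prime_factors D. inverse (real p / (real p - 1)))"
  proof (intro prod.cong refl)
    fix p assume "p \<in> prime_factors D"
    hence "p \<ge> 2" using prime_ge_2_nat by (auto simp: in_prime_factors_iff)
    thus "1 - 1 / real p = inverse (real p / (real p - 1))" by (simp add: field_simps)
  qed
  also have "\<dots> = inverse (\<Prod>p\<in>prime_factors D. real p / (real p - 1))"
    by (rule prod_inversef[unfolded comp_def])
  finally show ?thesis using assms by (simp add: field_simps)
qed

text \<open>P consists of the primes of D and Q of those that also divide c, so Q is empty exactly
  in the coprime case. The cube comes from 4^|P| 2^|Q| <= (2^|P|)^3 and 2^|P| <=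
  \<open>tau D\<close>.\<close>

lemma sieve_sum_local_density:
  assumes base: "\<And>y. y > 0 \<Longrightarrow> \<bar>sieve_sum (\<lambda>_. 1) y - 1\<bar> \<le> \<eta> + sqrt (Y / y)"
    and \<eta>: "\<eta> \<ge> 0" and Y: "Y \<ge> 1" and D: "D \<ge> 1" and R: "R \<ge> 1"
    and H: "real (\<Prod>{p\<in>prime_factors D. p dvd c}) \<le> H"
  shows "\<bar>sieve_sum (local_density D c) R - (if coprime c D then real D / real (totient D) else 0)\<bar>
           \<le> real (tau D) ^ 3 * (\<eta> + sqrt (Y * H / R))"
proof -
  define P where "P = prime_factors D"
  define Q where "Q = {p\<in>P. p dvd c}"
  define c0 where "c0 = (if Q = {} then \<Prod>p\<in>P. real p / (real p - 1) else 0)"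
  have QP: "Q \<subseteq> P" by (auto simp: Q_def)
  have Q: "Q = {} \<longleftrightarrow> coprime c D"
  proof
    assume "Q = {}"
    show "coprime c D"
    proof (rule ccontr)
      assume "\<not> coprime c D"
      hence "gcd c D \<noteq> 1" by (simp only: coprime_iff_gcd_eq_1 not_False_eq_True)
      then obtain p where "prime p" "p dvd gcd c D" using prime_factor_nat by blast
      hence "p \<in> Q" using D by (auto simp: Q_def P_def in_prime_factors_iff)
      with \<open>Q = {}\<close> show False by simp
    qed
  next
    assume "coprime c D"
    thus "Q = {}" by (auto simp: Q_def P_def in_prime_factors_iff dest: coprime_common_divisor)
  qed
  have c0: "c0 = (if coprime c D then real D / real (totient D) else 0)"
    unfolding c0_def Q P_def prod_prime_factors_eq_totient_quotient[OF D] ..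
  have "sieve_sum (local_density D c) R = sieve_sum (\<lambda>p. if p \<in> Q then real p else if p \<in> P then 0 else 1) R"
    by (rule sieve_sum_cong) (use D in \<open>auto simp: local_density_def Q_def P_def in_prime_factors_iff\<close>)
  hence "\<bar>sieve_sum (local_density D c) R - c0\<bar> \<le> 4 ^ card P * 2 ^ card Q * (\<eta> + sqrt (Y * real (\<Prod>Q) / R))"
    unfolding c0_def using sieve_sum_bound[OF base \<eta> Y _ _ _ QP, of R] R
    by (auto simp: P_def in_prime_factors_iff)
  also have "\<dots> \<le> real (tau D) ^ 3 * (\<eta> + sqrt (Y * H / R))"
  proof (intro mult_mono add_mono order_refl real_sqrt_le_mono divide_right_mono mult_left_mono)
    have tw: "2 ^ card P \<le> real (tau D)"
      using of_nat_mono[OF two_power_card_prime_factors_le_tau[of D], where ?'a = real] D by (simp add: P_def)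
    have "(2::real) ^ card Q \<le> 2 ^ card P"
      using card_mono[OF _ QP] by (intro power_increasing) (auto simp: P_def)
    hence "(4::real) ^ card P * 2 ^ card Q \<le> 4 ^ card P * 2 ^ card P" by simp
    also have "\<dots> = (2 ^ card P) ^ 3" by (simp add: power_mult[symmetric] power_mult_distrib[symmetric] mult.commute[of _ 3] power_mult)
    also have "\<dots> \<le> real (tau D) ^ 3" using tw by (intro power_mono) auto
    finally show "(4::real) ^ card P * 2 ^ card Q \<le> real (tau D) ^ 3" .
    show "real (\<Prod>Q) \<le> H" using H by (simp only: Q_def P_def)
  qed (use \<eta> Y R in \<open>auto simp del: of_nat_prod\<close>)
  finally show ?thesis by (simp only: c0)
qed

text \<open>Both sums are compared with a main term. That of psi has length N, that of
  \<open>Lambda_R\<close> has length N - n0; since s / D is 1 / totient D or 0, hence at most 1, the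
  mismatch costs at most n0.\<close>

lemma progression_difference:
  assumes base: "\<And>y. y > 0 \<Longrightarrow> \<bar>sieve_sum (\<lambda>_. 1) y - 1\<bar> \<le> \<eta> + sqrt (Y / y)"
    and \<eta>: "\<eta> \<ge> 0" and Y: "Y \<ge> 1" and D: "D \<ge> 1" and R: "R \<ge> 1"
    and H: "real (\<Prod>{p\<in>prime_factors D. p dvd c}) \<le> H"
    and N: "n0 \<le> N" "N \<ge> 1" and A: "A \<le> 2 * n0" and B: "B \<le> N + n0" "N \<le> B + n0" "B + n0 = A + N"
  shows "\<bar>\<Sum>m\<in>{m\<in>{A<..B}. [m = c] (mod D)}. mangoldt m - Lambda_R R (int m)\<bar>
     \<le> max_error N D + real N / real D * (real (tau D) ^ 3 * (\<eta> + sqrt (Y * H / R)))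
        + (4 * real n0 * ln (2 * real N) + 4 * ln (real D) * ln (real N) ^ 2 + R * ln R + real n0)"
proof -
  define U :: real where "U = (\<Sum>m\<in>{m\<in>{A<..B}. [m = c] (mod D)}. mangoldt m)"
  define V where "V = (\<Sum>m\<in>{m\<in>{A<..B}. [m = c] (mod D)}. Lambda_R R (int m))"
  define S where "S = sieve_sum (local_density D c) R"
  define s where "s = (if coprime c D then real D / real (totient D) else 0)"
  define e where "e = real (tau D) ^ 3 * (\<eta> + sqrt (Y * H / R))"
  have AB: "A \<le> B" using N B by linarith
  have BA: "real B - real A = real N - real n0" using B(3) by linarith
  have Se: "\<bar>S - s\<bar> \<le> e"
    unfolding S_def s_def e_def by (rule sieve_sum_local_density[OF base \<eta> Y D R H])
  have triangle: "\<bar>u - v\<bar> \<le> b + d + (a + c + e)"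
    if "\<bar>u - t\<bar> \<le> a" "\<bar>t - t3\<bar> \<le> b" "\<bar>v - t1\<bar> \<le> c" "\<bar>t1 - t2\<bar> \<le> d" "\<bar>t3 - t2\<bar> \<le> e"
    for u v t t1 t2 t3 a b c d e :: real using that by linarith
  have 1: "\<bar>U - psi_ap (real N) D c\<bar> \<le> 4 * real n0 * ln (2 * real N)"
    unfolding U_def by (rule sum_mangoldt_progression[OF N A B(1,2)])
  have 2: "\<bar>psi_ap (real N) D c - real N / real D * s\<bar> \<le> max_error N D + 4 * ln (real D) * ln (real N) ^ 2"
  proof (cases "coprime c D")
    case True
    have "4 * ln (real D) * ln (real N) ^ 2 \<ge> 0" using D by simp
    moreover have "real N / real D * s = real N / real (totient D)" using True D by (simp add: s_def)
    ultimately show ?thesis using psi_ap_coprime[OF D True, of N] by linarith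
  next
    case False
    have "psi_ap (real N) D c \<ge> 0" unfolding psi_ap_def by (intro sum_nonneg mangoldt_nonneg)
    thus ?thesis using psi_ap_not_coprime[OF D False N(2)] False max_error_nonneg[OF D, of N]
      by (simp add: s_def)
  qed
  have 3: "\<bar>V - (real N - real n0) / real D * S\<bar> \<le> R * ln R"
    unfolding V_def S_def BA[symmetric] by (rule sum_Lambda_R_progression[OF D AB R])
  have 4: "\<bar>(real N - real n0) / real D * S - (real N - real n0) / real D * s\<bar> \<le> real N / real D * e"
  proof -
    have "\<bar>(real N - real n0) / real D\<bar> * \<bar>S - s\<bar> \<le> real N / real D * e"
      using N D Se by (intro mult_mono) (auto intro!: divide_right_mono)
    thus ?thesis by (simp only: abs_mult[symmetric] right_diff_distrib)
  qed
  have 5: "\<bar>real N / real D * s - (real N - real n0) / real D * s\<bar> \<le> real n0"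
  proof -
    have eq: "real N / real D * s - (real N - real n0) / real D * s = real n0 * (s / real D)"
      by (simp add: diff_divide_distrib left_diff_distrib)
    have "1 \<le> real (totient D)" using D totient_gt_0_iff[of D] by linarith
    hence "0 \<le> 1 / real (totient D)" "1 / real (totient D) \<le> 1 / 1"
      by (intro divide_nonneg_nonneg divide_left_mono; use D in simp)+
    moreover have "s / real D = (if coprime c D then 1 / real (totient D) else 0)" using D by (simp add: s_def)
    ultimately have sD: "0 \<le> s / real D" "s / real D \<le> 1" by auto
    hence "real n0 * (s / real D) \<le> real n0 * 1" by (intro mult_left_mono) auto
    moreover have "0 \<le> real n0 * (s / real D)" using sD(1) by (intro mult_nonneg_nonneg) auto
    ultimately show ?thesis unfolding eq by linarith
  qed
  have "(\<Sum>m\<in>{m\<in>{A<..B}. [m = c] (mod D)}. mangoldt m - Lambda_R R (int m)) = U - V"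
    by (simp add: U_def V_def sum_subtractf)
  thus ?thesis using triangle[OF 1 2 3 4 5] unfolding e_def[symmetric] by (simp add: add_ac)
qed

section \<open>Expansion of the correlations over divisor tuples\<close>

lemma Lambda_R_eq_sum:
  assumes "m \<ge> 1"
  shows "Lambda_R R m = (\<Sum>d | 1 \<le> d \<and> real d \<le> R. moebius_mu d * ln (R / real d) * of_bool (int d dvd m))"
proof -
  have "Lambda_R R m = Lambda_R R (int (nat m))" using assms by simp
  also have "\<dots> = (\<Sum>d | 1 \<le> d \<and> real d \<le> R. if d dvd nat m then moebius_mu d * ln (R / real d) else 0)"
    by (rule Lambda_R_of_pos) (use assms in auto)
  also have "\<dots> = (\<Sum>d | 1 \<le> d \<and> real d \<le> R. moebius_mu d * ln (R / real d) * of_bool (int d dvd m))"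
  proof (intro sum.cong refl)
    fix d
    have "d dvd nat m \<longleftrightarrow> int d dvd m" using int_dvd_int_iff[of d "nat m"] assms by simp
    thus "(if d dvd nat m then moebius_mu d * ln (R / real d) else 0) =
          moebius_mu d * ln (R / real d) * of_bool (int d dvd m)" by simp
  qed
  finally show ?thesis .
qed

text \<open>Summation begins after n0 so that all n + h l are positive; only there is
  \<open>Lambda_R\<close> given by its divisor sum.\<close>

lemma sum_prod_Lambda_R:
  fixes h :: "'i \<Rightarrow> int" and F :: "nat \<Rightarrow> real"
  assumes L: "finite L" and h: "\<And>l. l \<in> L \<Longrightarrow> \<bar>h l\<bar> \<le> int n0"
  shows "(\<Sum>n\<in>{n0<..N}. (\<Prod>l\<in>L. Lambda_R R (int n + h l)) * F n) =
    (\<Sum>p\<in>PiE L (\<lambda>_. {d. 1 \<le> d \<and> real d \<le> R}). (\<Prod>l\<in>L. moebius_mu (p l) * ln (R / real (p l))) *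
       (\<Sum>n\<in>{n\<in>{n0<..N}. \<forall>l\<in>L. int (p l) dvd int n + h l}. F n))"
proof -
  let ?S = "{d. 1 \<le> d \<and> real d \<le> R}"
  let ?w = "\<lambda>p. \<Prod>l\<in>L. moebius_mu (p l) * ln (R / real (p l))"
  have finS: "finite ?S" by simp
  have "(\<Sum>n\<in>{n0<..N}. (\<Prod>l\<in>L. Lambda_R R (int n + h l)) * F n) =
     (\<Sum>n\<in>{n0<..N}. \<Sum>p\<in>PiE L (\<lambda>_. ?S). ?w p * (of_bool (\<forall>l\<in>L. int (p l) dvd int n + h l) * F n))"
  proof (intro sum.cong refl)
    fix n assume n: "n \<in> {n0<..N}"
    have "(\<Prod>l\<in>L. Lambda_R R (int n + h l))
        = (\<Prod>l\<in>L. \<Sum>d\<in>?S. moebius_mu d * ln (R / real d) * of_bool (int d dvd int n + h l))"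
    proof (intro prod.cong refl Lambda_R_eq_sum)
      fix l assume "l \<in> L"
      thus "1 \<le> int n + h l" using h[of l] n by auto
    qed
    also have "\<dots> = (\<Sum>p\<in>PiE L (\<lambda>_. ?S). \<Prod>l\<in>L. moebius_mu (p l) * ln (R / real (p l)) * of_bool (int (p l) dvd int n + h l))"
      by (rule prod_sum_PiE[OF L finS])
    also have "\<dots> = (\<Sum>p\<in>PiE L (\<lambda>_. ?S). ?w p * of_bool (\<forall>l\<in>L. int (p l) dvd int n + h l))"
    proof (intro sum.cong refl)
      fix p :: "'i \<Rightarrow> nat"
      have "(\<Prod>l\<in>L. of_bool (int (p l) dvd int n + h l) :: real) = of_bool (\<forall>l\<in>L. int (p l) dvd int n + h l)"
        using L by (induction L rule: finite_induct) auto
      thus "(\<Prod>l\<in>L. moebius_mu (p l) * ln (R / real (p l)) * of_bool (int (p l) dvd int n + h l))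
         = ?w p * of_bool (\<forall>l\<in>L. int (p l) dvd int n + h l)"
        by (simp only: prod.distrib)
    qed
    finally show "(\<Prod>l\<in>L. Lambda_R R (int n + h l)) * F n =
        (\<Sum>p\<in>PiE L (\<lambda>_. ?S). ?w p * (of_bool (\<forall>l\<in>L. int (p l) dvd int n + h l) * F n))"
      by (simp only: sum_distrib_right mult.assoc)
  qed
  also have "\<dots> = (\<Sum>p\<in>PiE L (\<lambda>_. ?S). \<Sum>n\<in>{n0<..N}. ?w p * (of_bool (\<forall>l\<in>L. int (p l) dvd int n + h l) * F n))"
    by (rule sum.swap)
  also have "\<dots> = (\<Sum>p\<in>PiE L (\<lambda>_. ?S). ?w p * (\<Sum>n\<in>{n\<in>{n0<..N}. \<forall>l\<in>L. int (p l) dvd int n + h l}. F n))"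
  proof (intro sum.cong refl)
    fix p :: "'i \<Rightarrow> nat"
    have "(\<Sum>n\<in>{n0<..N}. of_bool (\<forall>l\<in>L. int (p l) dvd int n + h l) * F n) = (\<Sum>n\<in>{n\<in>{n0<..N}. \<forall>l\<in>L. int (p l) dvd int n + h l}. F n)"
      by (rule sum.mono_neutral_cong_right) auto
    thus "(\<Sum>n\<in>{n0<..N}. ?w p * (of_bool (\<forall>l\<in>L. int (p l) dvd int n + h l) * F n)) =
      ?w p * (\<Sum>n\<in>{n\<in>{n0<..N}. \<forall>l\<in>L. int (p l) dvd int n + h l}. F n)"
      by (simp only: sum_distrib_left[symmetric])
  qed
  finally show ?thesis .
qed

lemma cong_nat_iff_int_dvd_diff: "[a = b] (mod m) \<longleftrightarrow> int m dvd int a - int b"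
  using cong_int_iff[of a b m] cong_iff_dvd_diff[of "int a" "int b" "int m"] by blast

text \<open>Relative to one common solution b, each divisibility says that \<open>p l\<close>
  divides n - b. Tuples without a solution yield empty sums, so no compatibility condition on the
  moduli has to be formulated.\<close>

lemma progression_of_tuple:
  fixes h :: "'i \<Rightarrow> int" and p :: "'i \<Rightarrow> nat"
  assumes b: "\<And>l. l \<in> L \<Longrightarrow> int (p l) dvd int b + h l"
  shows "(\<forall>l\<in>L. int (p l) dvd int n + h l) \<longleftrightarrow> [n = b] (mod Lcm (p ` L))"
proof -
  have "int (p l) dvd int n + h l \<longleftrightarrow> int (p l) dvd int n - int b" if "l \<in> L" for l
  proof -
    have "int n + h l = (int n - int b) + (int b + h l)" by simp
    thus ?thesis using b[OF that] by (metis dvd_add_left_iff)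
  qed
  hence "(\<forall>l\<in>L. int (p l) dvd int n + h l) \<longleftrightarrow> (\<forall>l\<in>L. int (p l) dvd int n - int b)" by simp
  also have "\<dots> \<longleftrightarrow> (\<forall>l\<in>L. p l dvd nat \<bar>int n - int b\<bar>)"
    by (simp only: dvd_nat_abs_iff)
  also have "\<dots> \<longleftrightarrow> Lcm (p ` L) dvd nat \<bar>int n - int b\<bar>" by (auto simp del: dvd_nat_abs_iff simp add: Lcm_dvd_iff)
  also have "\<dots> \<longleftrightarrow> int (Lcm (p ` L)) dvd int n - int b" by (simp only: dvd_nat_abs_iff)
  also have "\<dots> \<longleftrightarrow> [n = b] (mod Lcm (p ` L))"
    by (rule cong_nat_iff_int_dvd_diff[symmetric])
  finally show ?thesis .
qed

lemma Lcm_tuple_bounds: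
  fixes p :: "'i \<Rightarrow> nat"
  assumes L: "finite L" and p: "p \<in> PiE L (\<lambda>_. {d. 1 \<le> d \<and> real d \<le> R})"
  shows "Lcm (p ` L) \<ge> 1" "Lcm (p ` L) dvd (\<Prod>l\<in>L. p l)" "real (Lcm (p ` L)) \<le> R ^ card L"
proof -
  have pl: "1 \<le> p l" "real (p l) \<le> R" if "l \<in> L" for l using p that by (auto simp: PiE_def Pi_def)
  show 1: "Lcm (p ` L) dvd (\<Prod>l\<in>L. p l)"
    by (rule Lcm_least) (use L in \<open>auto intro: dvd_prodI\<close>)
  have pos: "(\<Prod>l\<in>L. p l) > 0" using pl by (intro prod_pos) (auto simp: Suc_le_eq)
  show "Lcm (p ` L) \<ge> 1" using 1 pos by (auto simp: Suc_le_eq intro: dvd_pos_nat)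
  have "real (Lcm (p ` L)) \<le> real (\<Prod>l\<in>L. p l)" using dvd_imp_le[OF 1 pos] by (rule of_nat_mono)
  also have "\<dots> = (\<Prod>l\<in>L. real (p l))" by simp
  also have "\<dots> \<le> (\<Prod>l\<in>L. R)" using pl by (intro prod_mono) auto
  finally show "real (Lcm (p ` L)) \<le> R ^ card L" by simp
qed

text \<open>
  A prime dividing both \<open>D\<close> and the residue class of \<open>n + j\<close> divides some \<open>h l - j\<close>, which is nonzero and at
  most \<open>2 n0\<close>; this bounds the modulus lost in the sieve.
\<close>

lemma sum_tuple_difference:
  fixes h :: "'i \<Rightarrow> int" and p :: "'i \<Rightarrow> nat"
  assumes base: "\<And>y. y > 0 \<Longrightarrow> \<bar>sieve_sum (\<lambda>_. 1) y - 1\<bar> \<le> \<eta> + sqrt (Y / y)"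
    and \<eta>: "\<eta> \<ge> 0" and Y: "Y \<ge> 1" and R: "R \<ge> 1"
    and L: "finite L" and h: "\<And>l. l \<in> L \<Longrightarrow> \<bar>h l\<bar> \<le> int n0" "\<And>l. l \<in> L \<Longrightarrow> h l \<noteq> j"
    and j: "\<bar>j\<bar> \<le> int n0" and N: "n0 \<le> N" "N \<ge> 1"
    and p: "p \<in> PiE L (\<lambda>_. {d. 1 \<le> d \<and> real d \<le> R})"
  defines "D \<equiv> Lcm (p ` L)"
  shows "\<bar>\<Sum>n\<in>{n\<in>{n0<..N}. \<forall>l\<in>L. int (p l) dvd int n + h l}. mangoldt_int (int n + j) - Lambda_R R (int n + j)\<bar>
     \<le> max_error N D + real N / real D * (real (tau D) ^ 3 * (\<eta> + sqrt (Y * (2 * real n0) ^ card L / R)))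
        + (4 * real n0 * ln (2 * real N) + 4 * (real (card L) * ln R) * ln (real N) ^ 2 + R * ln R + real n0)"
proof -
  have D: "D \<ge> 1" "D dvd (\<Prod>l\<in>L. p l)" "real D \<le> R ^ card L"
    unfolding D_def by (rule Lcm_tuple_bounds[OF L p])+
  have lnD: "ln (real D) \<le> real (card L) * ln R"
  proof -
    have "ln (real D) \<le> ln (R ^ card L)" using D R by simp
    thus ?thesis using R by (simp add: ln_realpow)
  qed
  let ?T = "{n\<in>{n0<..N}. \<forall>l\<in>L. int (p l) dvd int n + h l}"
  show ?thesis
  proof (cases "?T = {}")
    case True
    have "0 \<le> max_error N D" by (rule max_error_nonneg[OF D(1)])
    moreover have "0 \<le> real N / real D * (real (tau D) ^ 3 * (\<eta> + sqrt (Y * (2 * real n0) ^ card L / R)))"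
      using \<eta> Y R by (intro mult_nonneg_nonneg add_nonneg_nonneg) auto
    moreover have "0 \<le> 4 * real n0 * ln (2 * real N)" "0 \<le> 4 * (real (card L) * ln R) * ln (real N) ^ 2" "0 \<le> R * ln R"
      using R N by auto
    ultimately show ?thesis unfolding True by simp
  next
    case False
    then obtain b where "b \<in> ?T" by blast
    hence b: "n0 < b" "b \<le> N" "\<And>l. l \<in> L \<Longrightarrow> int (p l) dvd int b + h l" by auto
    \<comment> \<open>Substitution m = n + j. As |j| <= n0 <= N and n0 < b, none of the three
      conversions to natural numbers truncates.\<close>
    define A where "A = nat (int n0 + j)"
    define B where "B = nat (int N + j)"
    define c where "c = nat (int b + j)"
    have ints: "int A = int n0 + j" "int B = int N + j" "int c = int b + j"
      using j N b by (auto simp: A_def B_def c_def)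
    have T: "?T = {n\<in>{n0<..N}. [n = b] (mod D)}"
      unfolding D_def using progression_of_tuple[of L p b h] b(3) by auto
    have cong: "[n = b] (mod D) \<longleftrightarrow> [nat (int n + j) = c] (mod D)" if "n0 < n" for n
    proof -
      have "int (nat (int n + j)) = int n + j" using that j by simp
      hence "int (nat (int n + j)) - int c = int n - int b" using ints by simp
      thus ?thesis by (simp only: cong_nat_iff_int_dvd_diff)
    qed
    have "(\<Sum>n\<in>?T. mangoldt_int (int n + j) - Lambda_R R (int n + j))
        = (\<Sum>m\<in>{m\<in>{A<..B}. [m = c] (mod D)}. mangoldt m - Lambda_R R (int m))"
      unfolding T
    proof (rule sum.reindex_bij_witness[where i = "\<lambda>m. nat (int m - j)" and j = "\<lambda>n. nat (int n + j)"], goal_cases)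
      case (4 m)
      hence m: "A < m" "m \<le> B" "[m = c] (mod D)" by auto
      have n: "n0 < nat (int m - j)" "nat (int m - j) \<le> N" using m(1,2) ints j by linarith+
      have "nat (int (nat (int m - j)) + j) = m" using n by linarith
      thus ?case using n m(3) cong[OF n(1)] by auto
    next
      case (2 n)
      hence n: "n0 < n" "n \<le> N" "[n = b] (mod D)" by auto
      have "A < nat (int n + j)" "nat (int n + j) \<le> B" using n(1,2) ints j by linarith+
      thus ?case using n(3) cong[OF n(1)] by auto
    qed (use j ints in \<open>auto simp: mangoldt_int_def\<close>)
    also have "\<bar>\<dots>\<bar> \<le> max_error N D + real N / real D * (real (tau D) ^ 3 * (\<eta> + sqrt (Y * (2 * real n0) ^ card L / R)))
        + (4 * real n0 * ln (2 * real N) + 4 * ln (real D) * ln (real N) ^ 2 + R * ln R + real n0)"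
    proof (rule progression_difference[OF base \<eta> Y D(1) R _ N])
      let ?Q = "{q\<in>prime_factors D. q dvd c}"
      let ?P = "\<Prod>l\<in>L. nat \<bar>h l - j\<bar>"
      have "\<Prod>?Q dvd ?P"
      proof (rule prod_primes_dvd, simp)
        fix q assume "q \<in> ?Q"
        hence q: "prime q" "q dvd D" "q dvd c" by (auto simp: in_prime_factors_iff)
        have "q dvd (\<Prod>l\<in>L. p l)" using q(2) D(2) by (rule dvd_trans)
        then obtain l where l: "l \<in> L" "q dvd p l" using L q(1) by (auto simp: prime_dvd_prod_iff)
        have "int q dvd int b + h l" using l(2) int_dvd_int_iff[of q "p l"] b(3)[OF l(1)] dvd_trans by blast
        moreover have "int q dvd int b + j" using q(3) int_dvd_int_iff[of q c] unfolding ints(3) by blast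
        ultimately have "int q dvd (int b + h l) - (int b + j)" by (rule dvd_diff)
        hence "int q dvd h l - j" by simp
        hence "q dvd nat \<bar>h l - j\<bar>" by (simp only: dvd_nat_abs_iff)
        hence "q dvd ?P" using L l(1) by (meson dvd_prodI dvd_trans)
        thus "prime q \<and> q dvd ?P" using q(1) by blast
      qed
      moreover have "?P > 0" using h(2) by (intro prod_pos) auto
      ultimately have "\<Prod>?Q \<le> ?P" by (rule dvd_imp_le)
      also have "?P \<le> (\<Prod>l\<in>L. 2 * n0)"
      proof (intro prod_mono conjI)
        fix l assume "l \<in> L"
        thus "nat \<bar>h l - j\<bar> \<le> 2 * n0" using h(1)[of l] j by linarith
      qed auto
      finally have "\<Prod>?Q \<le> (2 * n0) ^ card L" by simp
      hence "real (\<Prod>?Q) \<le> real ((2 * n0) ^ card L)" by (rule of_nat_mono)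
      thus "real (\<Prod>?Q) \<le> (2 * real n0) ^ card L" by simp
    next
      show "A \<le> 2 * n0" "B \<le> N + n0" "N \<le> B + n0" "B + n0 = A + N" using ints j by linarith+
    qed
    also have "\<dots> \<le> max_error N D + real N / real D * (real (tau D) ^ 3 * (\<eta> + sqrt (Y * (2 * real n0) ^ card L / R)))
        + (4 * real n0 * ln (2 * real N) + 4 * (real (card L) * ln R) * ln (real N) ^ 2 + R * ln R + real n0)"
      using lnD by (intro add_left_mono add_right_mono mult_right_mono mult_left_mono) auto
    finally show ?thesis .
  qed
qed

text \<open>All entries of a tuple with least common multiple D divide D, so at most
  \<open>tau D ^ card L\<close> tuples share this D.\<close>

lemma sum_over_tuples_le:
  fixes g :: "nat \<Rightarrow> real"
  assumes L: "finite L" and g: "\<And>D. D \<ge> 1 \<Longrightarrow> g D \<ge> 0"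
  shows "(\<Sum>p\<in>PiE L (\<lambda>_. {d. 1 \<le> d \<and> real d \<le> R}). g (Lcm (p ` L)))
          \<le> (\<Sum>D | 1 \<le> D \<and> real D \<le> R ^ card L. real (tau D) ^ card L * g D)"
proof -
  let ?P = "PiE L (\<lambda>_. {d. 1 \<le> d \<and> real d \<le> R})"
  let ?T = "{D. 1 \<le> D \<and> real D \<le> R ^ card L}"
  have finP: "finite ?P" using L by (intro finite_PiE) auto
  have "(\<Sum>p\<in>?P. g (Lcm (p ` L))) = (\<Sum>D\<in>?T. \<Sum>p\<in>{p\<in>?P. Lcm (p ` L) = D}. g (Lcm (p ` L)))"
    by (rule sum.group[symmetric, OF finP]) (use Lcm_tuple_bounds[OF L] in auto)
  also have "\<dots> = (\<Sum>D\<in>?T. real (card {p\<in>?P. Lcm (p ` L) = D}) * g D)"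
    by (intro sum.cong refl) simp
  also have "\<dots> \<le> (\<Sum>D\<in>?T. real (tau D) ^ card L * g D)"
  proof (intro sum_mono mult_right_mono)
    fix D assume D: "D \<in> ?T"
    have "{p\<in>?P. Lcm (p ` L) = D} \<subseteq> PiE L (\<lambda>_. {d. d dvd D})"
      by (auto simp: PiE_def Pi_def intro: dvd_Lcm)
    hence "card {p\<in>?P. Lcm (p ` L) = D} \<le> card (PiE L (\<lambda>_. {d. d dvd D}))"
      using D L by (intro card_mono finite_PiE) auto
    also have "\<dots> = tau D ^ card L" using L by (simp add: card_PiE tau_def)
    finally have "real (card {p\<in>?P. Lcm (p ` L) = D}) \<le> real (tau D ^ card L)" by (rule of_nat_mono)
    thus "real (card {p\<in>?P. Lcm (p ` L) = D}) \<le> real (tau D) ^ card L" by simp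
    show "g D \<ge> 0" using D by (intro g) auto
  qed
  finally show ?thesis .
qed

section \<open>Level of distribution with divisor weights\<close>

text \<open>Trivial estimate: at most N/D + 1 <= 2 N/D terms of size at most ln N, and a main term N
  / totient D. The divisor function enters through D / totient D, a product of factors p / (p-1) <=
  2 over the primes of D.\<close>

lemma max_error_le:
  assumes D: "1 \<le> D" "D \<le> N"
  shows "max_error N D \<le> 3 * lg (real N) * real N * (real (tau D) / real D)"
proof -
  have N: "N \<ge> 1" using D by simp
  have lg: "lg (real N) \<ge> 1" using N by (intro lg_ge_1) auto
  have tw: "2 ^ card (prime_factors D) \<le> real (tau D)"
    using of_nat_mono[OF two_power_card_prime_factors_le_tau[of D], where ?'a = real] D by simp
  have tau1: "real (tau D) \<ge> 1" using tw by (rule order_trans[OF one_le_power, rotated]) simp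
  have D\<phi>: "real D / real (totient D) \<le> real (tau D)"
  proof -
    have "(\<Prod>p\<in>prime_factors D. real p / (real p - 1)) \<le> (\<Prod>p\<in>prime_factors D. 2)"
    proof (rule prod_mono)
      fix p assume "p \<in> prime_factors D"
      hence "p \<ge> 2" using prime_ge_2_nat by (auto simp: in_prime_factors_iff)
      thus "0 \<le> real p / (real p - 1) \<and> real p / (real p - 1) \<le> 2" by (simp add: field_simps)
    qed
    hence "real D / real (totient D) \<le> 2 ^ card (prime_factors D)"
      by (simp add: prod_prime_factors_eq_totient_quotient[OF D(1)])
    thus ?thesis using tw by (rule order_trans)
  qed
  have "\<bar>E_ap (real N) D a\<bar> \<le> 3 * lg (real N) * real N * (real (tau D) / real D)" if a: "a \<in> totatives D" for a
  proof -
    have E: "E_ap (real N) D a = psi_ap (real N) D a - real N / real (totient D)"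
      using a by (auto simp: E_ap_def totatives_def)
    have "psi_ap (real N) D a \<le> (\<Sum>m\<in>{m\<in>{1..N}. [m = a] (mod D)}. ln (real N))"
      unfolding psi_ap_nat
    proof (rule sum_mono)
      fix m assume "m \<in> {m\<in>{1..N}. [m = a] (mod D)}"
      hence m: "1 \<le> m" "m \<le> N" by auto
      have "mangoldt m \<le> ln (real m)" using m by (intro mangoldt_le) auto
      also have "\<dots> \<le> ln (real N)" using m by simp
      finally show "mangoldt m \<le> ln (real N)" .
    qed
    also have "\<dots> = real (card {m\<in>{1..N}. [m = a] (mod D)}) * ln (real N)" by simp
    also have "\<dots> \<le> (2 * (real N / real D)) * lg (real N)"
    proof (intro mult_mono)
      have "{0<..N} = {1..N}" by auto
      hence "real (card {m\<in>{1..N}. [m = a] (mod D)}) \<le> real N / real D + 1"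
        using card_progression[OF D(1), of 0 N a] by simp
      also have "1 \<le> real N / real D" using D by simp
      finally show "real (card {m\<in>{1..N}. [m = a] (mod D)}) \<le> 2 * (real N / real D)" by simp
    qed (use lg N in \<open>auto simp: lg_def\<close>)
    also have "\<dots> \<le> 2 * lg (real N) * real N * (real (tau D) / real D)"
    proof -
      have "2 * lg (real N) * (real N / real D) * 1 \<le> 2 * lg (real N) * (real N / real D) * real (tau D)"
        using lg tau1 by (intro mult_left_mono) auto
      thus ?thesis by (simp add: mult_ac)
    qed
    finally have 1: "psi_ap (real N) D a \<le> 2 * lg (real N) * real N * (real (tau D) / real D)" .
    have "real N / real (totient D) = real N / real D * (real D / real (totient D))" using D by simp
    also have "\<dots> \<le> (lg (real N) * (real N / real D)) * real (tau D)"
    proof (intro mult_mono D\<phi>)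
      have "1 * (real N / real D) \<le> lg (real N) * (real N / real D)" using lg by (intro mult_right_mono) auto
      thus "real N / real D \<le> lg (real N) * (real N / real D)" by simp
    qed (use lg in auto)
    also have "\<dots> = lg (real N) * real N * (real (tau D) / real D)" by simp
    finally have 2: "real N / real (totient D) \<le> lg (real N) * real N * (real (tau D) / real D)" .
    have 3: "psi_ap (real N) D a \<ge> 0" unfolding psi_ap_def by (intro sum_nonneg mangoldt_nonneg)
    have 4: "real N / real (totient D) \<ge> 0" by simp
    have "lg (real N) * real N * (real (tau D) / real D) \<ge> 0" using lg by simp
    thus ?thesis unfolding E using 1 2 3 4 by linarith
  qed
  moreover have "1 \<in> totatives D" using D by (auto simp: totatives_def)
  ultimately show ?thesis unfolding max_error_def using D by (subst Max_le_iff) auto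
qed

text \<open>
  The weights are removed by \<open>\<tau>\<^sup>K \<le> T + \<tau>\<^sup>2\<^sup>K / T\<close> with \<open>T\<close> a power of the logarithm, and the
  trivial bound for the second part.
\<close>

lemma weighted_level_of_distribution:
  assumes level: "primes_level_of_distribution \<theta>" and \<theta>: "\<theta> \<le> 1" and \<delta>: "\<delta> > 0"
  shows "\<exists>C\<ge>0. eventually (\<lambda>N. (\<Sum>D | 1 \<le> D \<and> real D \<le> real N powr (\<theta> - \<delta>). real (tau D) ^ K * max_error N D)
            \<le> C * (real N / lg (real N) ^ B)) sequentially"
proof -
  \<comment> \<open>The threshold T is l^m. In the second part 1 / l^m has to pay for the factor l
    of the trivial bound and for l^(2^(2K+1)) from the sum of tau^(2K+1) / D, and still leave 1 /
    l^B. In the first part l^m is regained by using the hypothesis with exponent m + B.\<close>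
  define m where "m = 2 ^ (2 * K + 1) + 1 + B"
  let ?T = "\<lambda>x. \<Sum>q | 1 \<le> q \<and> real q \<le> x powr (\<theta> - \<delta>). Max ((\<lambda>a. \<bar>E_ap x q a\<bar>) ` totatives q)"
  have "?T \<in> O(\<lambda>x. x / ln x powr (real (m + B)))"
  proof (rule level[unfolded primes_level_of_distribution_def, rule_format, OF \<delta>])
    show "real (m + B) > 0" unfolding of_nat_0_less_iff by (simp add: m_def)
  qed
  then obtain c where c: "c > 0" "eventually (\<lambda>x. norm (?T x) \<le> c * norm (x / ln x powr real (m + B))) at_top"
    by (rule landau_o.bigE)
  have ev: "eventually (\<lambda>N. norm (?T (real N)) \<le> c * norm (real N / ln (real N) powr real (m + B))) sequentially"
    using c(2) by (rule eventually_compose_filterlim[OF _ filterlim_real_sequentially])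
  have ev3: "eventually (\<lambda>N. N \<ge> (3::nat)) sequentially" by (rule eventually_ge_at_top)
  define C where "C = c * 2 ^ (m + B) + 3"
  have "eventually (\<lambda>N. (\<Sum>D | 1 \<le> D \<and> real D \<le> real N powr (\<theta> - \<delta>). real (tau D) ^ K * max_error N D)
            \<le> C * (real N / lg (real N) ^ B)) sequentially"
    using ev ev3
  proof eventually_elim
    case (elim N)
    define l where "l = lg (real N)"
    let ?S = "{D. 1 \<le> D \<and> real D \<le> real N powr (\<theta> - \<delta>)}"
    have "exp 1 \<le> (3::real)" by (rule exp_le)
    hence ln1: "ln (real N) \<ge> 1" using elim by (subst ln_ge_iff) auto
    have l1: "l \<ge> 1" and l2: "l \<le> 2 * ln (real N)" using ln1 by (auto simp: l_def lg_def)
    have DN: "D \<le> N" if "D \<in> ?S" for D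
    proof -
      have "real D \<le> real N powr (\<theta> - \<delta>)" using that by simp
      also have "\<dots> \<le> real N powr 1" using elim \<theta> \<delta> by (intro powr_mono) auto
      finally show ?thesis using elim by simp
    qed
    have E0: "max_error N D \<ge> 0" if "D \<in> ?S" for D using that by (intro max_error_nonneg) auto
    have pt: "real (tau D) ^ K * max_error N D \<le> l ^ m * max_error N D + 1 / l ^ m * (real (tau D) ^ (2 * K) * max_error N D)"
      if D: "D \<in> ?S" for D
    proof -
      let ?t = "real (tau D) ^ K"
      have "?t \<le> l ^ m + 1 / l ^ m * real (tau D) ^ (2 * K)"
      proof (cases "?t \<le> l ^ m")
        case True
        have "1 / l ^ m * real (tau D) ^ (2 * K) \<ge> 0" using l1 by simp
        with True show ?thesis by linarith
      next
        case False
        have "l ^ m * ?t \<le> ?t * ?t" using False by (intro mult_right_mono) auto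
        hence "?t \<le> 1 / l ^ m * (?t * ?t)" using l1 by (simp add: field_simps)
        also have "?t * ?t = real (tau D) ^ (2 * K)" by (simp add: power_add[symmetric] mult_2)
        finally show ?thesis using l1 by (auto intro: order_trans)
      qed
      from mult_right_mono[OF this E0[OF D]] show ?thesis by (simp add: algebra_simps)
    qed
    have "(\<Sum>D\<in>?S. real (tau D) ^ K * max_error N D)
        \<le> l ^ m * (\<Sum>D\<in>?S. max_error N D) + 1 / l ^ m * (\<Sum>D\<in>?S. real (tau D) ^ (2 * K) * max_error N D)"
      unfolding sum_distrib_left sum.distrib[symmetric] by (rule sum_mono) (rule pt)
    also have "l ^ m * (\<Sum>D\<in>?S. max_error N D) \<le> c * 2 ^ (m + B) * (real N / l ^ B)"
    proof -
      have "(\<Sum>D\<in>?S. max_error N D) \<le> c * (real N / ln (real N) powr real (m + B))"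
        using elim(1) ln1 unfolding max_error_def by simp
      also have "ln (real N) powr real (m + B) = ln (real N) ^ (m + B)"
        using ln1 by (subst powr_realpow) auto
      also have "c * (real N / ln (real N) ^ (m + B)) \<le> c * (real N / (l / 2) ^ (m + B))"
        using c(1) l1 l2 ln1 by (intro mult_left_mono divide_left_mono power_mono mult_pos_pos zero_less_power) auto
      finally have "l ^ m * (\<Sum>D\<in>?S. max_error N D) \<le> l ^ m * (c * (real N / (l / 2) ^ (m + B)))"
        using l1 by (intro mult_left_mono) auto
      also have "\<dots> = c * 2 ^ (m + B) * (real N / l ^ B)" using l1 by (simp add: power_divide power_add)
      finally show ?thesis .
    qed
    also have "1 / l ^ m * (\<Sum>D\<in>?S. real (tau D) ^ (2 * K) * max_error N D) \<le> 3 * (real N / l ^ B)"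
    proof -
      have "(\<Sum>D\<in>?S. real (tau D) ^ (2 * K) * max_error N D)
          \<le> (\<Sum>D\<in>?S. 3 * l * real N * (real (tau D) ^ (2 * K + 1) / real D))"
      proof (rule sum_mono)
        fix D assume D: "D \<in> ?S"
        have "real (tau D) ^ (2 * K) * max_error N D \<le> real (tau D) ^ (2 * K) * (3 * l * real N * (real (tau D) / real D))"
          unfolding l_def using D DN[OF D] by (intro mult_left_mono max_error_le) auto
        thus "real (tau D) ^ (2 * K) * max_error N D \<le> 3 * l * real N * (real (tau D) ^ (2 * K + 1) / real D)"
          by (simp add: mult_ac)
      qed
      also have "\<dots> \<le> (\<Sum>D=1..N. 3 * l * real N * (real (tau D) ^ (2 * K + 1) / real D))"
        using DN l1 by (intro sum_mono2) (auto intro!: mult_nonneg_nonneg divide_nonneg_nonneg)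
      also have "\<dots> = 3 * l * real N * (\<Sum>D=1..N. real (tau D) ^ (2 * K + 1) / real D)"
        by (simp only: sum_distrib_left)
      also have "\<dots> \<le> 3 * l * real N * l ^ (2 ^ (2 * K + 1))"
        unfolding l_def using elim l1[unfolded l_def] by (intro mult_left_mono sum_tau_power_over_le) auto
      finally have "1 / l ^ m * (\<Sum>D\<in>?S. real (tau D) ^ (2 * K) * max_error N D)
          \<le> 1 / l ^ m * (3 * l * real N * l ^ (2 ^ (2 * K + 1)))"
        using l1 by (intro mult_left_mono) auto
      also have "\<dots> = 3 * (real N / l ^ B)" using l1 by (simp add: m_def power_add)
      finally show ?thesis .
    qed
    finally show ?case by (simp add: C_def l_def algebra_simps)
  qed
  moreover have "C \<ge> 0" using c(1) by (simp add: C_def)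
  ultimately show ?thesis by blast
qed

section \<open>Comparison of the two correlations\<close>

text \<open>Each tuple has weight at most ln R ^ card L. Errors depending on D are grouped by D at
  the cost of \<open>tau D ^ card L\<close>, which with the cube from the sieve gives the power card
  L + 3; the remaining errors are multiplied by the number of tuples, at most R ^ card L.\<close>

lemma correlation_difference_large_n:
  fixes h :: "'i \<Rightarrow> int"
  assumes base: "\<And>y. y > 0 \<Longrightarrow> \<bar>sieve_sum (\<lambda>_. 1) y - 1\<bar> \<le> \<eta> + sqrt (Y / y)"
    and \<eta>: "\<eta> \<ge> 0" and Y: "Y \<ge> 1" and R: "R \<ge> 1"
    and L: "finite L" and h: "\<And>l. l \<in> L \<Longrightarrow> \<bar>h l\<bar> \<le> int n0" "\<And>l. l \<in> L \<Longrightarrow> h l \<noteq> j"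
    and j: "\<bar>j\<bar> \<le> int n0" and N: "n0 \<le> N" "N \<ge> 1" and RK: "R ^ card L \<le> real N"
  shows "\<bar>\<Sum>n\<in>{n0<..N}. (\<Prod>l\<in>L. Lambda_R R (int n + h l)) * (mangoldt_int (int n + j) - Lambda_R R (int n + j))\<bar>
     \<le> ln R ^ card L *
        ((\<Sum>D | 1 \<le> D \<and> real D \<le> R ^ card L. real (tau D) ^ card L * max_error N D)
         + real N * (\<eta> + sqrt (Y * (2 * real n0) ^ card L / R)) * lg (real N) ^ (2 ^ (card L + 3))
         + R ^ card L * (4 * real n0 * ln (2 * real N) + 4 * (real (card L) * ln R) * ln (real N) ^ 2 + R * ln R + real n0))"
proof -
  let ?K = "card L"
  let ?P = "PiE L (\<lambda>_. {d. 1 \<le> d \<and> real d \<le> R})"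
  let ?F = "\<lambda>n. mangoldt_int (int n + j) - Lambda_R R (int n + j)"
  let ?T = "\<lambda>p. {n\<in>{n0<..N}. \<forall>l\<in>L. int (p l) dvd int n + h l}"
  define e where "e = \<eta> + sqrt (Y * (2 * real n0) ^ card L / R)"
  define er where "er = 4 * real n0 * ln (2 * real N) + 4 * (real (card L) * ln R) * ln (real N) ^ 2 + R * ln R + real n0"
  define g where "g = (\<lambda>D. max_error N D + real N / real D * (real (tau D) ^ 3 * e))"
  have e0: "e \<ge> 0" using \<eta> Y R by (simp add: e_def)
  have er0: "er \<ge> 0" using R N by (simp add: er_def)
  have g0: "g D \<ge> 0" if "D \<ge> 1" for D
    using max_error_nonneg[OF that, of N] e0 by (auto simp: g_def intro!: add_nonneg_nonneg mult_nonneg_nonneg)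
  have w: "\<bar>\<Prod>l\<in>L. moebius_mu (p l) * ln (R / real (p l))\<bar> \<le> ln R ^ ?K" if p: "p \<in> ?P" for p
  proof -
    have "(\<Prod>l\<in>L. \<bar>moebius_mu (p l) * ln (R / real (p l))\<bar>) \<le> (\<Prod>l\<in>L. ln R)"
    proof (rule prod_mono)
      fix l assume "l \<in> L"
      hence pl: "1 \<le> p l" "real (p l) \<le> R" using p by (auto simp: PiE_def Pi_def)
      have "\<bar>ln (R / real (p l))\<bar> \<le> ln R" using pl R by (simp add: ln_div)
      hence "\<bar>moebius_mu (p l)\<bar> * \<bar>ln (R / real (p l))\<bar> \<le> 1 * ln R"
        by (intro mult_mono abs_moebius_mu_le) auto
      thus "0 \<le> \<bar>moebius_mu (p l) * ln (R / real (p l))\<bar> \<and> \<bar>moebius_mu (p l) * ln (R / real (p l))\<bar> \<le> ln R"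
        by (simp add: abs_mult)
    qed
    thus ?thesis by (simp add: abs_prod)
  qed
  have cardP: "real (card ?P) \<le> R ^ ?K"
  proof -
    have "real (card {d. 1 \<le> d \<and> real d \<le> R}) \<le> R"
      unfolding nat_real_le_set using R by simp
    hence "real (card {d. 1 \<le> d \<and> real d \<le> R}) ^ ?K \<le> R ^ ?K" by (intro power_mono) auto
    thus ?thesis using L by (simp add: card_PiE)
  qed
  have "\<bar>\<Sum>n\<in>{n0<..N}. (\<Prod>l\<in>L. Lambda_R R (int n + h l)) * ?F n\<bar>
      = \<bar>\<Sum>p\<in>?P. (\<Prod>l\<in>L. moebius_mu (p l) * ln (R / real (p l))) * (\<Sum>n\<in>?T p. ?F n)\<bar>"
    by (rule arg_cong[where f = abs], rule sum_prod_Lambda_R[OF L h(1)])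
  also have "\<dots> \<le> (\<Sum>p\<in>?P. ln R ^ ?K * (g (Lcm (p ` L)) + er))"
  proof (rule order_trans[OF sum_abs sum_mono])
    fix p assume p: "p \<in> ?P"
    have "\<bar>\<Sum>n\<in>?T p. ?F n\<bar> \<le> g (Lcm (p ` L)) + er"
      unfolding g_def er_def e_def
      by (rule sum_tuple_difference[OF base \<eta> Y R L h j N p])
    thus "\<bar>(\<Prod>l\<in>L. moebius_mu (p l) * ln (R / real (p l))) * (\<Sum>n\<in>?T p. ?F n)\<bar> \<le> ln R ^ ?K * (g (Lcm (p ` L)) + er)"
      unfolding abs_mult using R by (intro mult_mono w[OF p]) auto
  qed
  also have "\<dots> = ln R ^ ?K * ((\<Sum>p\<in>?P. g (Lcm (p ` L))) + real (card ?P) * er)"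
    by (simp add: sum_distrib_left[symmetric] sum.distrib)
  also have "\<dots> \<le> ln R ^ ?K * ((\<Sum>D | 1 \<le> D \<and> real D \<le> R ^ ?K. real (tau D) ^ ?K * g D) + R ^ ?K * er)"
    using R er0 by (intro mult_left_mono add_mono mult_right_mono cardP sum_over_tuples_le[OF L g0]) auto
  also have "(\<Sum>D | 1 \<le> D \<and> real D \<le> R ^ ?K. real (tau D) ^ ?K * g D) =
      (\<Sum>D | 1 \<le> D \<and> real D \<le> R ^ ?K. real (tau D) ^ ?K * max_error N D) +
      real N * e * (\<Sum>D | 1 \<le> D \<and> real D \<le> R ^ ?K. real (tau D) ^ (?K + 3) / real D)"
    unfolding sum_distrib_left sum.distrib[symmetric] g_def
    by (intro sum.cong refl) (simp add: algebra_simps power_add)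
  also have "(\<Sum>D | 1 \<le> D \<and> real D \<le> R ^ ?K. real (tau D) ^ (?K + 3) / real D) \<le> lg (real N) ^ (2 ^ (?K + 3))"
  proof -
    have "(\<Sum>D | 1 \<le> D \<and> real D \<le> R ^ ?K. real (tau D) ^ (?K + 3) / real D) \<le> (\<Sum>D=1..N. real (tau D) ^ (?K + 3) / real D)"
    proof (rule sum_mono2)
      show "{D. 1 \<le> D \<and> real D \<le> R ^ ?K} \<subseteq> {1..N}" using RK by (auto dest: order_trans)
    qed auto
    also have "\<dots> \<le> lg (real N) ^ (2 ^ (?K + 3))" by (rule sum_tau_power_over_le[OF N(2)])
    finally show ?thesis .
  qed
  finally show ?thesis
    unfolding e_def[symmetric] er_def[symmetric] using R e0
    by (simp add: mult_left_mono)
qed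

lemma abs_Lambda_R_le:
  assumes R: "R \<ge> 1" and m: "m \<le> int M"
  shows "\<bar>Lambda_R R m\<bar> \<le> real M * ln R"
proof (cases "m \<ge> 1")
  case True
  have "\<bar>Lambda_R R m\<bar> \<le> (\<Sum>d | d dvd nat m \<and> real d \<le> R. ln R)"
    unfolding Lambda_R_def if_P[OF True]
  proof (rule order_trans[OF sum_abs sum_mono])
    fix d assume d: "d \<in> {d. d dvd nat m \<and> real d \<le> R}"
    have "d \<ge> 1" using dvd_pos_nat[of "nat m" d] d True by simp
    hence "\<bar>ln (R / real d)\<bar> \<le> ln R" using d R by (simp add: ln_div)
    hence "\<bar>moebius_mu d\<bar> * \<bar>ln (R / real d)\<bar> \<le> 1 * ln R"
      by (intro mult_mono abs_moebius_mu_le) auto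
    thus "\<bar>moebius_mu d * ln (R / real d)\<bar> \<le> ln R" by (simp add: abs_mult)
  qed
  also have "\<dots> = real (card {d. d dvd nat m \<and> real d \<le> R}) * ln R" by simp
  also have "\<dots> \<le> real M * ln R"
  proof (intro mult_right_mono of_nat_mono)
    have "{d. d dvd nat m \<and> real d \<le> R} \<subseteq> {1..nat m}" 
    proof
      fix d assume "d \<in> {d. d dvd nat m \<and> real d \<le> R}"
      thus "d \<in> {1..nat m}" using True dvd_imp_le[of d "nat m"] dvd_pos_nat[of "nat m" d] by simp
    qed
    hence "card {d. d dvd nat m \<and> real d \<le> R} \<le> card {1..nat m}" by (intro card_mono) auto
    thus "card {d. d dvd nat m \<and> real d \<le> R} \<le> M" using m by simp
  qed (use R in auto)
  finally show ?thesis .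
qed (use R in \<open>auto simp: Lambda_R_def\<close>)

text \<open>For n <= n0 some n + h l may be nonpositive and the divisor expansion fails. With so few
  n, the bound m ln R for |\<open>Lambda_R\<close> m| suffices.\<close>

lemma correlation_difference_small_n:
  fixes h :: "'i \<Rightarrow> int"
  assumes R: "R \<ge> 1" and L: "finite L" and h: "\<And>l. l \<in> L \<Longrightarrow> \<bar>h l\<bar> \<le> int n0"
    and j: "\<bar>j\<bar> \<le> int n0" and N: "n0 \<le> N"
  shows "\<bar>\<Sum>n\<in>{1..n0}. (\<Prod>l\<in>L. Lambda_R R (int n + h l)) * (mangoldt_int (int n + j) - Lambda_R R (int n + j))\<bar>
     \<le> real n0 * ((2 * real n0 * ln R) ^ card L * (ln (2 * real N) + 2 * real n0 * ln R))"
proof -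
  have b: "\<bar>Lambda_R R (int n + x)\<bar> \<le> 2 * real n0 * ln R" if "n \<in> {1..n0}" "\<bar>x\<bar> \<le> int n0" for n x
  proof -
    have "int n + x \<le> int (2 * n0)" using that by auto
    from abs_Lambda_R_le[OF R this] show ?thesis by simp
  qed
  have mg: "\<bar>mangoldt_int (int n + x)\<bar> \<le> ln (2 * real N)" if "n \<in> {1..n0}" "\<bar>x\<bar> \<le> int n0" for n x
  proof (cases "nat (int n + x) = 0")
    case False
    have "mangoldt (nat (int n + x)) \<le> ln (real (nat (int n + x)))" using False by (intro mangoldt_le) auto
    also have "\<dots> \<le> ln (real (2 * N))" using False that N by (intro ln_mono of_nat_mono) auto
    finally show ?thesis by (simp add: mangoldt_int_def)
  qed (use that N in \<open>auto simp: mangoldt_int_def\<close>)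
  have "\<bar>\<Sum>n\<in>{1..n0}. (\<Prod>l\<in>L. Lambda_R R (int n + h l)) * (mangoldt_int (int n + j) - Lambda_R R (int n + j))\<bar>
     \<le> (\<Sum>n\<in>{1..n0}. (2 * real n0 * ln R) ^ card L * (ln (2 * real N) + 2 * real n0 * ln R))"
  proof (rule order_trans[OF sum_abs sum_mono])
    fix n assume n: "n \<in> {1..n0}"
    have "(\<Prod>l\<in>L. \<bar>Lambda_R R (int n + h l)\<bar>) \<le> (\<Prod>l\<in>L. 2 * real n0 * ln R)"
      using b[OF n] h by (intro prod_mono) auto
    moreover have "\<bar>mangoldt_int (int n + j) - Lambda_R R (int n + j)\<bar> \<le> ln (2 * real N) + 2 * real n0 * ln R"
      using mg[OF n j] b[OF n j] by linarith
    ultimately show "\<bar>(\<Prod>l\<in>L. Lambda_R R (int n + h l)) * (mangoldt_int (int n + j) - Lambda_R R (int n + j))\<bar>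
        \<le> (2 * real n0 * ln R) ^ card L * (ln (2 * real N) + 2 * real n0 * ln R)"
      unfolding abs_mult abs_prod using R by (intro mult_mono) auto
  qed
  thus ?thesis by simp
qed

text \<open>The index set L has K = k - 1 elements and h may repeat values on it; this is how powers
  of one factor are covered. C depends only on the fixed parameters and is uniform in R, L, h and
  j.\<close>

lemma correlation_difference:
  fixes \<theta> \<epsilon> c\<^sub>1 c\<^sub>2 c\<^sub>3 :: real and K B :: nat
  assumes level: "primes_level_of_distribution \<theta>" and \<theta>: "0 < \<theta>" "\<theta> \<le> 1"
    and K: "K \<ge> 1" and \<epsilon>: "\<epsilon> > 0" and c: "c\<^sub>1 > 0" "c\<^sub>2 > 0" "c\<^sub>3 > 0"
  shows "\<exists>C\<ge>0. eventually (\<lambda>N. \<forall>R L (h :: 'i \<Rightarrow> int) j.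
           R \<ge> 1 \<longrightarrow> finite L \<longrightarrow> card L = K \<longrightarrow> (\<forall>l\<in>L. h l \<noteq> j) \<longrightarrow>
           (\<forall>l\<in>L. \<bar>real_of_int (h l)\<bar> \<le> c\<^sub>1 * R powr (1 / real (Suc K))) \<longrightarrow>
           \<bar>real_of_int j\<bar> \<le> c\<^sub>1 * R powr (1 / real (Suc K)) \<longrightarrow>
           c\<^sub>2 * real N powr \<epsilon> \<le> R \<longrightarrow>
           R \<le> c\<^sub>3 * real N powr (min (\<theta> / real K) (1 / real (Suc K)) - \<epsilon>) \<longrightarrow>
           \<bar>\<Sum>n\<in>{1..N}. (\<Prod>l\<in>L. Lambda_R R (int n + h l)) * (mangoldt_int (int n + j) - Lambda_R R (int n + j))\<bar>
             \<le> C * (real N / lg (real N) ^ B)) sequentially"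
proof -
  define k where "k = Suc K"
  have k0: "real k > 0" by (simp add: k_def)
  have powr_power: "(x powr y) ^ n = x powr (y * real n)" if "x > 0" for x y :: real and n
    using that by (simp add: powr_realpow[symmetric] powr_powr)
  \<comment> \<open>The sieve error l^(-M) pays for the weights ln R ^ K and for the divisor sum
    l^(2^(K+3)), leaving l^(-B).\<close>
  define M where "M = B + K + 2 ^ (K + 3)"
  \<comment> \<open>Chosen for \<open>lg Y0 >= \<kappa> * l\<close> with Y0 = R^(1/(2k)). From R >=
    c2 N^\<epsilon>, half of \<epsilon> absorbs c2 and ln Y0 >= \<epsilon> / (4k) ln N remains; the
    minimum with 1 takes care of the summand 1 in \<open>lg\<close>.\<close>
  define \<kappa> where "\<kappa> = min 1 (\<epsilon> / (4 * real k))"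
  have \<kappa>: "\<kappa> > 0" "\<kappa> \<le> 1" "\<kappa> \<le> \<epsilon> / (4 * real k)" using \<epsilon> by (auto simp: \<kappa>_def k_def)
  obtain Cs where Cs: "Cs \<ge> 1"
    "\<And>Y y. Y \<ge> 1 \<Longrightarrow> y > 0 \<Longrightarrow> \<bar>sieve_sum (\<lambda>_. 1) y - 1\<bar> \<le> Cs / lg Y ^ Suc M + sqrt (Cs * Y / y)"
    using sieve_sum_1_uniform[OF level \<theta>(1), of "Suc M"] by auto
  \<comment> \<open>The moduli reach R^K <= c3^K N^(\<theta> - K \<epsilon>). Half of the margin K
    \<epsilon> absorbs c3^K, the other half is the loss in the level of distribution.\<close>
  obtain C1 where C1: "C1 \<ge> 0"
    "eventually (\<lambda>N. (\<Sum>D | 1 \<le> D \<and> real D \<le> real N powr (\<theta> - real K * \<epsilon> / 2). real (tau D) ^ K * max_error N D)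
            \<le> C1 * (real N / lg (real N) ^ (B + K))) sequentially"
    using weighted_level_of_distribution[OF level \<theta>(2), of "real K * \<epsilon> / 2" K "B + K"] K \<epsilon> by auto
  obtain Cp where Cp: "Cp > 0" "\<And>x. x \<ge> 1 \<Longrightarrow> lg x ^ M \<le> Cp * x powr (1/2)"
    using lg_power_le_powr[of "1/2" M] by auto
  \<comment> \<open>The errors of order R^k l^(K+3) fall under N / l^B because R^k leaves a factor
    N^(k \<epsilon>) to spare.\<close>
  obtain Cq where Cq: "Cq > 0" "\<And>x. x \<ge> 1 \<Longrightarrow> lg x ^ (K + 3 + B) \<le> Cq * x powr (real k * \<epsilon>)"
    using lg_power_le_powr[of "real k * \<epsilon>" "K + 3 + B"] \<epsilon> by (auto simp: k_def)
  define Ce where "Ce = (Cs + sqrt (Cs * (2 * c\<^sub>1) ^ K) * Cp) / \<kappa> ^ M"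
  define Cerr where "Cerr = (5 * c\<^sub>1 + 4 * real K + 1) + c\<^sub>1 * (2 * c\<^sub>1) ^ K * (1 + 2 * c\<^sub>1)"
  define C where "C = C1 + Ce + Cerr * (c\<^sub>3 ^ k * Cq)"
  have Ce0: "Ce \<ge> 0" using Cs(1) Cp(1) \<kappa> c by (simp add: Ce_def)
  have Cerr0: "Cerr \<ge> 0" using c by (simp add: Cerr_def)
  have C0: "C \<ge> 0" using C1(1) Ce0 Cerr0 c Cq(1) by (simp add: C_def)
  have ev1: "eventually (\<lambda>N. N \<ge> (3::nat)) sequentially" by (rule eventually_ge_at_top)
  have ev2: "eventually (\<lambda>N. c\<^sub>3 \<le> real N powr \<epsilon>) sequentially" using \<epsilon> by real_asymp
  have ev3: "eventually (\<lambda>N. c\<^sub>1 \<le> real N powr (1/2)) sequentially" by real_asymp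
  have ev4: "eventually (\<lambda>N. c\<^sub>3 ^ K \<le> real N powr (real K * \<epsilon> / 2)) sequentially"
  proof -
    have "real K * \<epsilon> / 2 > 0" using K \<epsilon> by simp
    thus ?thesis by real_asymp
  qed
  have ev5: "eventually (\<lambda>N. - ln c\<^sub>2 \<le> \<epsilon> / 2 * ln (real N)) sequentially" using \<epsilon> by real_asymp
  have "eventually (\<lambda>N. \<forall>R L (h :: 'i \<Rightarrow> int) j.
           R \<ge> 1 \<longrightarrow> finite L \<longrightarrow> card L = K \<longrightarrow> (\<forall>l\<in>L. h l \<noteq> j) \<longrightarrow>
           (\<forall>l\<in>L. \<bar>real_of_int (h l)\<bar> \<le> c\<^sub>1 * R powr (1 / real (Suc K))) \<longrightarrow>
           \<bar>real_of_int j\<bar> \<le> c\<^sub>1 * R powr (1 / real (Suc K)) \<longrightarrow>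
           c\<^sub>2 * real N powr \<epsilon> \<le> R \<longrightarrow>
           R \<le> c\<^sub>3 * real N powr (min (\<theta> / real K) (1 / real (Suc K)) - \<epsilon>) \<longrightarrow>
           \<bar>\<Sum>n\<in>{1..N}. (\<Prod>l\<in>L. Lambda_R R (int n + h l)) * (mangoldt_int (int n + j) - Lambda_R R (int n + j))\<bar>
             \<le> C * (real N / lg (real N) ^ B)) sequentially"
    using C1(2) ev1 ev2 ev3 ev4 ev5
  proof (eventually_elim, intro allI impI)
    fix N :: nat and R :: real and L :: "'i set" and h :: "'i \<Rightarrow> int" and j :: int
    assume wl: "(\<Sum>D | 1 \<le> D \<and> real D \<le> real N powr (\<theta> - real K * \<epsilon> / 2). real (tau D) ^ K * max_error N D)
            \<le> C1 * (real N / lg (real N) ^ (B + K))"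
      and N3: "3 \<le> N" and large: "c\<^sub>3 \<le> real N powr \<epsilon>" "c\<^sub>1 \<le> real N powr (1/2)"
        "c\<^sub>3 ^ K \<le> real N powr (real K * \<epsilon> / 2)" "- ln c\<^sub>2 \<le> \<epsilon> / 2 * ln (real N)"
      and R: "1 \<le> R" and L: "finite L" and card: "card L = K" and hj: "\<forall>l\<in>L. h l \<noteq> j"
      and h: "\<forall>l\<in>L. \<bar>real_of_int (h l)\<bar> \<le> c\<^sub>1 * R powr (1 / real (Suc K))"
      and j: "\<bar>real_of_int j\<bar> \<le> c\<^sub>1 * R powr (1 / real (Suc K))"
      and Rlow: "c\<^sub>2 * real N powr \<epsilon> \<le> R"
      and Rup: "R \<le> c\<^sub>3 * real N powr (min (\<theta> / real K) (1 / real (Suc K)) - \<epsilon>)"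
    define \<rho> where "\<rho> = R powr (1 / real k)"
    define n0 where "n0 = nat \<lfloor>c\<^sub>1 * \<rho>\<rfloor>"
    define l where "l = lg (real N)"
    have N1: "real N \<ge> 1" using N3 by simp
    have \<rho>1: "\<rho> \<ge> 1" using R by (simp add: \<rho>_def ge_one_powr_ge_zero)
    have \<rho>k: "\<rho> ^ k = R" using R k0 by (simp add: \<rho>_def powr_power)
    have \<rho>R: "\<rho> \<le> R"
    proof -
      have "\<rho> \<le> R powr 1" unfolding \<rho>_def using R by (intro powr_mono) (auto simp: k_def)
      thus ?thesis using R by simp
    qed
    have n0: "real n0 \<le> c\<^sub>1 * \<rho>" using c \<rho>1 by (simp add: n0_def)
    have hn0: "\<bar>h i\<bar> \<le> int n0" if "i \<in> L" for i
    proof -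
      have "real_of_int \<bar>h i\<bar> \<le> c\<^sub>1 * \<rho>" using h that by (simp add: \<rho>_def k_def)
      hence "\<bar>h i\<bar> \<le> \<lfloor>c\<^sub>1 * \<rho>\<rfloor>" by (simp add: le_floor_iff)
      thus ?thesis unfolding n0_def by linarith
    qed
    have jn0: "\<bar>j\<bar> \<le> int n0"
    proof -
      have "real_of_int \<bar>j\<bar> \<le> c\<^sub>1 * \<rho>" using j by (simp add: \<rho>_def k_def)
      hence "\<bar>j\<bar> \<le> \<lfloor>c\<^sub>1 * \<rho>\<rfloor>" by (simp add: le_floor_iff)
      thus ?thesis unfolding n0_def by linarith
    qed
    have Rk: "R \<le> real N powr (1 / real k)"
    proof -
      have "R \<le> c\<^sub>3 * real N powr (1 / real k - \<epsilon>)"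
      proof (rule order_trans[OF Rup mult_left_mono])
        show "real N powr (min (\<theta> / real K) (1 / real (Suc K)) - \<epsilon>) \<le> real N powr (1 / real k - \<epsilon>)"
          using N1 by (intro powr_mono) (auto simp: k_def)
      qed (use c in simp)
      also have "\<dots> \<le> real N powr \<epsilon> * real N powr (1 / real k - \<epsilon>)"
        using large(1) by (intro mult_right_mono) auto
      also have "\<dots> = real N powr (1 / real k)" using N1 by (simp add: powr_add[symmetric])
      finally show ?thesis .
    qed
    have Rhalf: "R \<le> real N powr (1/2)"
      using Rk N1 K by (elim order_trans) (intro powr_mono, auto simp: k_def field_simps)
    have RN: "R \<le> real N"
    proof -
      have "R \<le> real N powr 1" using Rhalf N1 by (elim order_trans) (intro powr_mono, auto)
      thus ?thesis using N1 by simp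
    qed
    have n0N: "n0 \<le> N"
    proof -
      have "real n0 \<le> c\<^sub>1 * \<rho>" by (rule n0)
      also have "\<dots> \<le> real N powr (1/2) * real N powr (1/2)"
        using large(2) \<rho>R Rhalf c \<rho>1 by (intro mult_mono) auto
      also have "\<dots> = real N" using N1 by (simp add: powr_add[symmetric])
      finally show ?thesis by simp
    qed
    have RKN: "R ^ K \<le> real N"
    proof -
      have "R ^ K \<le> R ^ k" using R by (intro power_increasing) (auto simp: k_def)
      also have "\<dots> \<le> (real N powr (1 / real k)) ^ k" using Rk R by (intro power_mono) auto
      also have "\<dots> = real N" using N1 k0 by (simp add: powr_power)
      finally show ?thesis .
    qed
    have RKlevel: "R ^ K \<le> real N powr (\<theta> - real K * \<epsilon> / 2)"
    proof -
      have "R \<le> c\<^sub>3 * real N powr (\<theta> / real K - \<epsilon>)"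
      proof (rule order_trans[OF Rup mult_left_mono])
        show "real N powr (min (\<theta> / real K) (1 / real (Suc K)) - \<epsilon>) \<le> real N powr (\<theta> / real K - \<epsilon>)"
          using N1 by (intro powr_mono) auto
      qed (use c in simp)
      hence "R ^ K \<le> (c\<^sub>3 * real N powr (\<theta> / real K - \<epsilon>)) ^ K" using R by (intro power_mono) auto
      also have "\<dots> = c\<^sub>3 ^ K * real N powr (\<theta> - real K * \<epsilon>)"
      proof -
        have "(\<theta> / real K - \<epsilon>) * real K = \<theta> - real K * \<epsilon>" using K by (simp add: field_simps)
        thus ?thesis using N1 by (simp add: power_mult_distrib powr_power)
      qed
      also have "\<dots> \<le> real N powr (real K * \<epsilon> / 2) * real N powr (\<theta> - real K * \<epsilon>)"
        using large(3) by (intro mult_right_mono) auto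
      also have "\<dots> = real N powr (\<theta> - real K * \<epsilon> / 2)" by (simp add: powr_add[symmetric] mult.commute)
      finally show ?thesis .
    qed
    have Rkk: "R ^ k \<le> c\<^sub>3 ^ k * real N powr (1 - real k * \<epsilon>)"
    proof -
      have "R \<le> c\<^sub>3 * real N powr (1 / real k - \<epsilon>)"
      proof (rule order_trans[OF Rup mult_left_mono])
        show "real N powr (min (\<theta> / real K) (1 / real (Suc K)) - \<epsilon>) \<le> real N powr (1 / real k - \<epsilon>)"
          using N1 by (intro powr_mono) (auto simp: k_def)
      qed (use c in simp)
      hence "R ^ k \<le> (c\<^sub>3 * real N powr (1 / real k - \<epsilon>)) ^ k" using R by (intro power_mono) auto
      also have "\<dots> = c\<^sub>3 ^ k * real N powr ((1 / real k - \<epsilon>) * real k)"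
        using N1 by (simp add: power_mult_distrib powr_power)
      also have "(1 / real k - \<epsilon>) * real k = 1 - real k * \<epsilon>" using k0 by (simp add: field_simps)
      finally show ?thesis .
    qed
    have l1: "l \<ge> 1" using lg_ge_1[OF N1] by (simp add: l_def)
    have lnR: "0 \<le> ln R" "ln R \<le> l"
    proof -
      have "ln R \<le> ln (real N)" using R RN by simp
      thus "ln R \<le> l" unfolding l_def lg_def by linarith
    qed (use R in simp)
    have lnN: "0 \<le> ln (real N)" "ln (real N) \<le> l" using N1 by (auto simp: l_def lg_def)
    have ln2N: "0 \<le> ln (2 * real N)" "ln (2 * real N) \<le> l"
    proof -
      have "ln 2 \<le> (2::real) - 1" by (rule ln_le_minus_one) simp
      thus "ln (2 * real N) \<le> l" using N1 by (simp add: l_def lg_def ln_mult)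
    qed (use N1 in auto)

    \<comment> \<open>With \<rho> = R^(1/k) and n0 <= c1 \<rho>, the quotient (2 n0)^K / R is of
      order 1 / \<rho>. The choice Y0^2 = \<rho> makes Y0 (2 n0)^K / R of order 1 / Y0, so both
      parts of the sieve error are small, one in terms of \<open>lg Y0\<close>, the other as a power
      of Y0.\<close>
    define Y0 where "Y0 = R powr (1 / (2 * real k))"
    have Y01: "Y0 \<ge> 1" using R by (simp add: Y0_def ge_one_powr_ge_zero)
    have Y02: "Y0\<^sup>2 = \<rho>" using R k0 by (simp add: Y0_def \<rho>_def powr_power)
    have lY: "\<kappa> * l \<le> lg Y0"
    proof -
      have "ln (c\<^sub>2 * real N powr \<epsilon>) \<le> ln R" using Rlow c N1 R by simp
      hence "ln c\<^sub>2 + \<epsilon> * ln (real N) \<le> ln R" using c N1 by (simp add: ln_mult ln_powr)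
      hence "\<epsilon> / 2 * ln (real N) \<le> ln R" using large(4) by linarith
      hence "1 / (2 * real k) * (\<epsilon> / 2 * ln (real N)) \<le> 1 / (2 * real k) * ln R"
        by (rule mult_left_mono) simp
      moreover have "ln Y0 = 1 / (2 * real k) * ln R" using R by (simp add: Y0_def ln_powr)
      moreover have "\<kappa> * ln (real N) \<le> \<epsilon> / (4 * real k) * ln (real N)"
        using \<kappa>(3) lnN by (intro mult_right_mono) auto
      ultimately have "\<kappa> * ln (real N) \<le> ln Y0" by simp
      thus ?thesis using \<kappa>(2) by (simp add: l_def lg_def algebra_simps)
    qed
    have lYM: "1 / lg Y0 ^ M \<le> 1 / \<kappa> ^ M * (1 / l ^ M)"
    proof -
      have "(\<kappa> * l) ^ M \<le> lg Y0 ^ M" using lY \<kappa> l1 by (intro power_mono) auto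
      hence "1 / lg Y0 ^ M \<le> 1 / (\<kappa> * l) ^ M"
        using \<kappa> l1 lg_ge_1[OF Y01] by (intro divide_left_mono) auto
      thus ?thesis by (simp add: power_mult_distrib)
    qed
    define e where "e = Cs / lg Y0 ^ Suc M + sqrt (Cs * Y0 * (2 * real n0) ^ K / R)"
    have e0: "e \<ge> 0" unfolding e_def using Cs(1) Y01 lg_ge_1[OF Y01] R
      by (intro add_nonneg_nonneg) auto
    have e: "e \<le> Ce / l ^ M"
    proof -
      have lg1: "lg Y0 \<ge> 1" by (rule lg_ge_1[OF Y01])
      have "Cs / lg Y0 ^ Suc M \<le> Cs / lg Y0 ^ M"
        using lg1 Cs(1) by (intro divide_left_mono power_increasing) auto
      hence 1: "Cs / lg Y0 ^ Suc M \<le> Cs * (1 / lg Y0 ^ M)" by simp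
      have "Cs * Y0 * (2 * real n0) ^ K / R \<le> Cs * (2 * c\<^sub>1) ^ K * (1 / Y0)"
      proof -
        have "(2 * real n0) ^ K \<le> (2 * c\<^sub>1 * \<rho>) ^ K" using n0 by (intro power_mono) auto
        hence "Cs * Y0 * (2 * real n0) ^ K / R \<le> Cs * Y0 * (2 * c\<^sub>1 * \<rho>) ^ K / R"
          using Cs(1) Y01 R by (intro divide_right_mono mult_left_mono) auto
        also have "\<dots> = Cs * (2 * c\<^sub>1) ^ K * (Y0 / \<rho>)"
          unfolding \<rho>k[symmetric] using \<rho>1 by (simp add: k_def power_mult_distrib)
        also have "Y0 / \<rho> = 1 / Y0" unfolding Y02[symmetric] using Y01 by (simp add: power2_eq_square)
        finally show ?thesis .
      qed
      hence "sqrt (Cs * Y0 * (2 * real n0) ^ K / R) \<le> sqrt (Cs * (2 * c\<^sub>1) ^ K * (1 / Y0))"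
        by (rule real_sqrt_le_mono)
      also have "\<dots> = sqrt (Cs * (2 * c\<^sub>1) ^ K) * (1 / sqrt Y0)" by (simp add: real_sqrt_mult real_sqrt_divide)
      also have "\<dots> \<le> sqrt (Cs * (2 * c\<^sub>1) ^ K) * (Cp * (1 / lg Y0 ^ M))"
      proof (intro mult_left_mono)
        have "lg Y0 ^ M \<le> Cp * sqrt Y0" using Cp(2)[OF Y01] Y01 by (simp add: powr_half_sqrt)
        thus "1 / sqrt Y0 \<le> Cp * (1 / lg Y0 ^ M)" using Y01 lg1 by (simp add: field_simps)
      qed (use Cs c in auto)
      finally have "e \<le> (Cs + sqrt (Cs * (2 * c\<^sub>1) ^ K) * Cp) * (1 / lg Y0 ^ M)"
        unfolding e_def using 1 by (simp add: algebra_simps)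
      also have "\<dots> \<le> (Cs + sqrt (Cs * (2 * c\<^sub>1) ^ K) * Cp) * (1 / \<kappa> ^ M * (1 / l ^ M))"
        using lYM Cs(1) Cp(1) c by (intro mult_left_mono) auto
      also have "\<dots> = Ce / l ^ M" by (simp add: Ce_def)
      finally show ?thesis .
    qed
    have small: "\<bar>\<Sum>n\<in>{1..n0}. (\<Prod>l\<in>L. Lambda_R R (int n + h l)) * (mangoldt_int (int n + j) - Lambda_R R (int n + j))\<bar>
        \<le> c\<^sub>1 * (2 * c\<^sub>1) ^ K * (1 + 2 * c\<^sub>1) * (R ^ k * l ^ (K + 3))"
    proof -
      have "\<bar>\<Sum>n\<in>{1..n0}. (\<Prod>l\<in>L. Lambda_R R (int n + h l)) * (mangoldt_int (int n + j) - Lambda_R R (int n + j))\<bar>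
        \<le> real n0 * ((2 * real n0 * ln R) ^ K * (ln (2 * real N) + 2 * real n0 * ln R))"
        using correlation_difference_small_n[OF R L hn0 jn0 n0N] card by simp
      also have "\<dots> \<le> (c\<^sub>1 * \<rho>) * ((2 * (c\<^sub>1 * \<rho>) * l) ^ K * (\<rho> * l + 2 * (c\<^sub>1 * \<rho>) * l))"
      proof (intro mult_mono power_mono add_mono n0 lnR order_refl)
        have "ln (2 * real N) \<le> 1 * l" using ln2N by simp
        also have "\<dots> \<le> \<rho> * l" using \<rho>1 l1 by (intro mult_right_mono) auto
        finally show "ln (2 * real N) \<le> \<rho> * l" .
      qed (use c \<rho>1 l1 lnR ln2N in auto)
      also have "\<dots> = c\<^sub>1 * (2 * c\<^sub>1) ^ K * (1 + 2 * c\<^sub>1) * ((\<rho> ^ k * \<rho>) * l ^ (K + 1))"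
        by (simp add: k_def power_mult_distrib algebra_simps)
      also have "\<dots> \<le> c\<^sub>1 * (2 * c\<^sub>1) ^ K * (1 + 2 * c\<^sub>1) * (R ^ k * l ^ (K + 3))"
      proof (intro mult_left_mono mult_mono)
        \<comment> \<open>The k + 1 factors \<rho> arise from the n0 values of n, the K factors
          indexed by L and the last factor. They fit into R^k because \<rho> <= R and k >=
          2.\<close>
        have "\<rho> ^ k * \<rho> \<le> R * R" unfolding \<rho>k using \<rho>R R by (intro mult_left_mono) auto
        also have "\<dots> = R ^ 2" by (simp add: power2_eq_square)
        also have "\<dots> \<le> R ^ k" using R K by (intro power_increasing) (auto simp: k_def)
        finally show "\<rho> ^ k * \<rho> \<le> R ^ k" .
        show "l ^ (K + 1) \<le> l ^ (K + 3)" using l1 by (intro power_increasing) auto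
      qed (use c l1 R in auto)
      finally show ?thesis .
    qed
    define er where "er = 4 * real n0 * ln (2 * real N) + 4 * (real K * ln R) * ln (real N) ^ 2 + R * ln R + real n0"
    have er0: "er \<ge> 0" using R ln2N lnR by (simp add: er_def)
    have er: "er \<le> (5 * c\<^sub>1 + 4 * real K + 1) * (R * l ^ 3)"
    proof -
      have Rl: "R * l \<le> R * l ^ 3" "R \<le> R * l ^ 3" "l ^ 3 \<le> R * l ^ 3"
      proof -
        have "l ^ 1 \<le> l ^ 3" using l1 by (intro power_increasing) auto
        thus "R * l \<le> R * l ^ 3" using R by (intro mult_left_mono) auto
        have "1 \<le> l ^ 3" using l1 by (rule one_le_power)
        hence "R * 1 \<le> R * l ^ 3" using R by (intro mult_left_mono) auto
        thus "R \<le> R * l ^ 3" by simp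
        have "1 * l ^ 3 \<le> R * l ^ 3" using R l1 by (intro mult_right_mono) auto
        thus "l ^ 3 \<le> R * l ^ 3" by simp
      qed
      have nR: "real n0 \<le> c\<^sub>1 * R" using n0 \<rho>R c by (elim order_trans) simp
      have "4 * real n0 * ln (2 * real N) \<le> 4 * (c\<^sub>1 * R) * l"
        using nR ln2N c R by (intro mult_mono) auto
      also have "\<dots> = 4 * c\<^sub>1 * (R * l)" by simp
      also have "\<dots> \<le> 4 * c\<^sub>1 * (R * l ^ 3)" using mult_left_mono[OF Rl(1), of "4 * c\<^sub>1"] c by simp
      finally have 1: "4 * real n0 * ln (2 * real N) \<le> 4 * c\<^sub>1 * (R * l ^ 3)" .
      have "4 * (real K * ln R) * ln (real N) ^ 2 \<le> 4 * (real K * l) * l ^ 2"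
        using lnR lnN l1 by (intro mult_mono power_mono) auto
      also have "\<dots> = 4 * real K * l ^ 3" by (simp add: power2_eq_square power3_eq_cube)
      also have "\<dots> \<le> 4 * real K * (R * l ^ 3)" using Rl(3) by (intro mult_left_mono) auto
      finally have 2: "4 * (real K * ln R) * ln (real N) ^ 2 \<le> 4 * real K * (R * l ^ 3)" .
      have "R * ln R \<le> R * l" using lnR R by (intro mult_left_mono) auto
      hence 3: "R * ln R \<le> R * l ^ 3" using Rl(1) by linarith
      have "c\<^sub>1 * R \<le> c\<^sub>1 * (R * l ^ 3)" using Rl(2) c by (intro mult_left_mono) auto
      hence 4: "real n0 \<le> c\<^sub>1 * (R * l ^ 3)" using nR by linarith
      show ?thesis unfolding er_def using 1 2 3 4 by (simp add: algebra_simps)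
    qed
    let ?Sum = "\<Sum>D | 1 \<le> D \<and> real D \<le> R ^ K. real (tau D) ^ K * max_error N D"
    have S: "?Sum \<le> C1 * (real N / l ^ (B + K))"
    proof -
      have "?Sum \<le> (\<Sum>D | 1 \<le> D \<and> real D \<le> real N powr (\<theta> - real K * \<epsilon> / 2). real (tau D) ^ K * max_error N D)"
        using RKlevel by (intro sum_mono2) (auto intro!: mult_nonneg_nonneg max_error_nonneg)
      thus ?thesis using wl by (simp add: l_def)
    qed
    have "\<bar>\<Sum>n\<in>{n0<..N}. (\<Prod>l\<in>L. Lambda_R R (int n + h l)) * (mangoldt_int (int n + j) - Lambda_R R (int n + j))\<bar>
        \<le> ln R ^ K * (?Sum + real N * e * l ^ (2 ^ (K + 3)) + R ^ K * er)"
    proof -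
      have base: "\<bar>sieve_sum (\<lambda>_. 1) y - 1\<bar> \<le> Cs / lg Y0 ^ Suc M + sqrt (Cs * Y0 / y)" if "y > 0" for y
        by (rule Cs(2)[OF Y01 that])
      have \<eta>: "Cs / lg Y0 ^ Suc M \<ge> 0" using Cs(1) lg_ge_1[OF Y01] by simp
      have Y: "Cs * Y0 \<ge> 1" using mult_mono[of 1 Cs 1 Y0] Cs(1) Y01 by simp
      show ?thesis
        unfolding e_def er_def l_def card[symmetric]
        by (rule correlation_difference_large_n[OF base \<eta> Y R L hn0 _ jn0 n0N])
           (use hj card N3 RKN in auto)
    qed
    also have "\<dots> \<le> l ^ K * (C1 * (real N / l ^ (B + K)) + real N * (Ce / l ^ M) * l ^ (2 ^ (K + 3))
          + R ^ K * ((5 * c\<^sub>1 + 4 * real K + 1) * (R * l ^ 3)))"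
    proof (intro mult_mono power_mono add_mono S mult_right_mono mult_left_mono e er lnR)
      have "?Sum \<ge> 0" by (intro sum_nonneg mult_nonneg_nonneg max_error_nonneg) auto
      thus "0 \<le> ?Sum + real N * e * l ^ (2 ^ (K + 3)) + R ^ K * er"
        using e0 er0 R l1 by (intro add_nonneg_nonneg mult_nonneg_nonneg) auto
    qed (use l1 R e0 er0 Ce0 in auto)
    also have "\<dots> = (C1 + Ce) * (real N / l ^ B) + (5 * c\<^sub>1 + 4 * real K + 1) * (R ^ k * l ^ (K + 3))"
      using l1 by (simp add: M_def k_def power_add field_simps)
    finally have main: "\<bar>\<Sum>n\<in>{n0<..N}. (\<Prod>l\<in>L. Lambda_R R (int n + h l)) * (mangoldt_int (int n + j) - Lambda_R R (int n + j))\<bar>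
        \<le> (C1 + Ce) * (real N / l ^ B) + (5 * c\<^sub>1 + 4 * real K + 1) * (R ^ k * l ^ (K + 3))" .
    have "{1..N} = {1..n0} \<union> {n0<..N}" using n0N by auto
    hence "(\<Sum>n\<in>{1..N}. (\<Prod>l\<in>L. Lambda_R R (int n + h l)) * (mangoldt_int (int n + j) - Lambda_R R (int n + j)))
      = (\<Sum>n\<in>{1..n0}. (\<Prod>l\<in>L. Lambda_R R (int n + h l)) * (mangoldt_int (int n + j) - Lambda_R R (int n + j)))
      + (\<Sum>n\<in>{n0<..N}. (\<Prod>l\<in>L. Lambda_R R (int n + h l)) * (mangoldt_int (int n + j) - Lambda_R R (int n + j)))"
      by (simp only:) (rule sum.union_disjoint, auto)
    hence "\<bar>\<Sum>n\<in>{1..N}. (\<Prod>l\<in>L. Lambda_R R (int n + h l)) * (mangoldt_int (int n + j) - Lambda_R R (int n + j))\<bar>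
       \<le> (C1 + Ce) * (real N / l ^ B) + (5 * c\<^sub>1 + 4 * real K + 1) * (R ^ k * l ^ (K + 3))
         + c\<^sub>1 * (2 * c\<^sub>1) ^ K * (1 + 2 * c\<^sub>1) * (R ^ k * l ^ (K + 3))"
      using main small by linarith
    also have "\<dots> = (C1 + Ce) * (real N / l ^ B) + Cerr * (R ^ k * l ^ (K + 3))"
      by (simp add: Cerr_def algebra_simps)
    also have "\<dots> \<le> (C1 + Ce) * (real N / l ^ B) + Cerr * ((c\<^sub>3 ^ k * Cq) * (real N / l ^ B))"
    proof (intro add_left_mono mult_left_mono Cerr0)
      have "l ^ (K + 3) * l ^ B \<le> Cq * real N powr (real k * \<epsilon>)"
        using Cq(2)[OF N1] by (simp add: l_def power_add)
      hence "l ^ (K + 3) \<le> Cq * real N powr (real k * \<epsilon>) / l ^ B" using l1 by (simp add: field_simps)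
      hence "R ^ k * l ^ (K + 3) \<le> (c\<^sub>3 ^ k * real N powr (1 - real k * \<epsilon>)) * (Cq * real N powr (real k * \<epsilon>) / l ^ B)"
        using Rkk R l1 c by (intro mult_mono) auto
      also have "\<dots> = (c\<^sub>3 ^ k * Cq) * ((real N powr (1 - real k * \<epsilon>) * real N powr (real k * \<epsilon>)) / l ^ B)"
        by simp
      also have "real N powr (1 - real k * \<epsilon>) * real N powr (real k * \<epsilon>) = real N"
        using N1 by (simp add: powr_add[symmetric])
      finally show "R ^ k * l ^ (K + 3) \<le> (c\<^sub>3 ^ k * Cq) * (real N / l ^ B)" .
    qed
    also have "\<dots> = C * (real N / lg (real N) ^ B)"
      by (simp only: C_def l_def distrib_right mult.assoc)
    finally show "\<bar>\<Sum>n\<in>{1..N}. (\<Prod>l\<in>L. Lambda_R R (int n + h l)) * (mangoldt_int (int n + j) - Lambda_R R (int n + j))\<bar>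
      \<le> C * (real N / lg (real N) ^ B)" .
  qed
  with C0 show ?thesis by blast
qed

theorem theorem2:
  fixes \<theta> \<epsilon> A c\<^sub>1 c\<^sub>2 c\<^sub>3 :: real and k r :: nat and a :: "nat \<Rightarrow> nat"
  assumes "0 < \<theta>" and "\<theta> \<le> 1"
    and "primes_level_of_distribution \<theta>"
    and "k \<ge> 2" and "r \<ge> 2"
    and "\<And>i. i \<in> {1..r} \<Longrightarrow> a i \<ge> 1" and "a r = 1" and "(\<Sum>i=1..r. a i) = k"
    and "\<epsilon> > 0" and "A > 0"
    and "c\<^sub>1 > 0" and "c\<^sub>2 > 0" and "c\<^sub>3 > 0"
  shows "\<exists>C N\<^sub>0. \<forall>N\<ge>N\<^sub>0. \<forall>R\<ge>1. \<forall>j :: nat \<Rightarrow> int.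
           inj_on j {1..r} \<longrightarrow>
           (\<forall>i\<in>{1..r}. \<bar>real_of_int (j i)\<bar> \<le> c\<^sub>1 * R powr (1 / real k)) \<longrightarrow>
           c\<^sub>2 * real N powr \<epsilon> \<le> R \<longrightarrow>
           R \<le> c\<^sub>3 * real N powr (min (\<theta> / (real k - 1)) (1 / real k) - \<epsilon>) \<longrightarrow>
           \<bar>mixed_corr R N r j a - corr R N r j a\<bar>
             \<le> C * (R ^ k + real N / ln (real N) powr (A / 2 - 4 powr (real k - 3 / 2) + 2 ^ (k - 1) - 1))"
proof -
  define K where "K = k - 1"
  define X where "X = A / 2 - 4 powr (real k - 3 / 2) + 2 ^ (k - 1) - 1"
  \<comment> \<open>Since any power of the logarithm can be saved, it is enough to take a natural
    number above the exponent X; if X is negative, B is 0.\<close>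
  define B where "B = nat \<lceil>X\<rceil>"
  \<comment> \<open>The factor with index i is repeated a i times, which gives k - a r = k - 1
    factors without exponents.\<close>
  define L where "L = (SIGMA i:{1..r-1}. {..<a i})"
  have K: "K \<ge> 1" "k = Suc K" "real k - 1 = real K" using assms(4) by (auto simp: K_def of_nat_diff)
  have "(\<Sum>i=1..r. a i) = (\<Sum>i=1..r-1. a i) + a r"
    using assms(5) by (cases r) auto
  hence "card L = K" using assms(7,8) by (simp add: L_def K_def)
  have L: "finite L" by (simp add: L_def)
  define P where "P = (\<lambda>C (N::nat). \<forall>R L (h :: nat \<times> nat \<Rightarrow> int) j.
           R \<ge> 1 \<longrightarrow> finite L \<longrightarrow> card L = K \<longrightarrow> (\<forall>l\<in>L. h l \<noteq> j) \<longrightarrow>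
           (\<forall>l\<in>L. \<bar>real_of_int (h l)\<bar> \<le> c\<^sub>1 * R powr (1 / real (Suc K))) \<longrightarrow>
           \<bar>real_of_int j\<bar> \<le> c\<^sub>1 * R powr (1 / real (Suc K)) \<longrightarrow>
           c\<^sub>2 * real N powr \<epsilon> \<le> R \<longrightarrow>
           R \<le> c\<^sub>3 * real N powr (min (\<theta> / real K) (1 / real (Suc K)) - \<epsilon>) \<longrightarrow>
           \<bar>\<Sum>n\<in>{1..N}. (\<Prod>l\<in>L. Lambda_R R (int n + h l)) * (mangoldt_int (int n + j) - Lambda_R R (int n + j))\<bar>
             \<le> C * (real N / lg (real N) ^ B))"
  from correlation_difference[OF assms(3,1,2) K(1) assms(9,11,12,13), where ?'i = "nat \<times> nat" and B = B]
  have "\<exists>C\<ge>0. eventually (P C) sequentially" unfolding P_def .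
  then obtain C N0 where C: "C \<ge> 0" and N0: "\<And>N. N \<ge> N0 \<Longrightarrow> P C N"
    unfolding eventually_sequentially by blast
  show ?thesis
  proof (intro exI[of _ C] exI[of _ "max N0 3"] allI impI, fold X_def)
    fix N :: nat and R :: real and j :: "nat \<Rightarrow> int"
    assume N: "N \<ge> max N0 3" and R: "R \<ge> 1" and inj: "inj_on j {1..r}"
      and jb: "\<forall>i\<in>{1..r}. \<bar>real_of_int (j i)\<bar> \<le> c\<^sub>1 * R powr (1 / real k)"
      and Rl: "c\<^sub>2 * real N powr \<epsilon> \<le> R"
      and Ru: "R \<le> c\<^sub>3 * real N powr (min (\<theta> / (real k - 1)) (1 / real k) - \<epsilon>)"
    have PN: "P C N" using N by (intro N0) simp
    have r: "{1..r} = insert r {1..r-1}" "r \<notin> {1..r-1}" using assms(5) by auto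
    have flat: "(\<Prod>l\<in>L. Lambda_R R (int n + j (fst l))) = (\<Prod>i=1..r-1. Lambda_R R (int n + j i) ^ a i)" for n
    proof -
      have "(\<Prod>l\<in>L. Lambda_R R (int n + j (fst l))) = (\<Prod>i=1..r-1. \<Prod>t<a i. Lambda_R R (int n + j i))"
        unfolding L_def by (subst prod.Sigma) (auto intro!: prod.cong)
      thus ?thesis by simp
    qed
    have "mixed_corr R N r j a - corr R N r j a =
      (\<Sum>n\<in>{1..N}. (\<Prod>l\<in>L. Lambda_R R (int n + j (fst l))) * (mangoldt_int (int n + j r) - Lambda_R R (int n + j r)))"
      unfolding mixed_corr_def corr_def flat r(1) using r(2) assms(7)
      by (simp add: sum_subtractf[symmetric] algebra_simps)
    also have "\<bar>\<dots>\<bar> \<le> C * (real N / lg (real N) ^ B)"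
    proof (rule PN[unfolded P_def, rule_format, OF R L \<open>card L = K\<close>])
      show "j (fst l) \<noteq> j r" if "l \<in> L" for l
      proof -
        from that
        have "fst l \<in> {1..r}" "fst l \<noteq> r" using r by (auto simp: L_def)
        thus "j (fst l) \<noteq> j r" using inj_onD[OF inj, of "fst l" r] r(1) by blast
      qed
      show "\<bar>real_of_int (j (fst l))\<bar> \<le> c\<^sub>1 * R powr (1 / real (Suc K))" if "l \<in> L" for l
      proof -
        from that have "fst l \<in> {1..r}" by (auto simp: L_def)
        thus "\<bar>real_of_int (j (fst l))\<bar> \<le> c\<^sub>1 * R powr (1 / real (Suc K))" using jb K(2) by simp
      qed
      show "\<bar>real_of_int (j r)\<bar> \<le> c\<^sub>1 * R powr (1 / real (Suc K))" using jb K(2) r(1) by simp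
      show "R \<le> c\<^sub>3 * real N powr (min (\<theta> / real K) (1 / real (Suc K)) - \<epsilon>)"
        using Ru by (simp only: K(3)) (simp only: K(2))
    qed (rule Rl)
    also have "\<dots> \<le> C * (R ^ k + real N / ln (real N) powr X)"
    proof (intro mult_left_mono C)
      have "exp 1 \<le> (3::real)" by (rule exp_le)
      hence ln1: "ln (real N) \<ge> 1" using N by (subst ln_ge_iff) auto
      have "ln (real N) powr X \<le> ln (real N) powr real B"
        using ln1 by (intro powr_mono) (auto simp: B_def intro: order_trans[OF le_of_int_ceiling])
      also have "\<dots> = ln (real N) ^ B" using ln1 by (simp add: powr_realpow)
      also have "\<dots> \<le> lg (real N) ^ B" using ln1 by (intro power_mono) (auto simp: lg_def)
      finally have "real N / lg (real N) ^ B \<le> real N / ln (real N) powr X"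
        using ln1 by (intro divide_left_mono mult_pos_pos) (auto simp: lg_def)
      thus "real N / lg (real N) ^ B \<le> R ^ k + real N / ln (real N) powr X"
        using R by (simp add: add_increasing)
    qed
    finally show "\<bar>mixed_corr R N r j a - corr R N r j a\<bar> \<le> C * (R ^ k + real N / ln (real N) powr X)" .
  qed
qed

end
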